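(* Let $d\ge1$, $\kappa\in\mathbb R^{d+1}$ with all $\kappa_i>-1$, $\tau\in S_d$, and $\varepsilon\in\{0,1\}^d$. Then, for $\nu\in\mathbb N_0^d$, the connection coefficients on the unit ball satisfy $b^\tau_{2\nu+\varepsilon,\beta}(\kappa)=0$ if $\beta$ (with $\beta\in\mathbb N_0^d$, $|\beta|=2|\nu|+|\varepsilon|$) is not of the form $2\mu+\varepsilon$ with $\mu\in\mathbb N_0^d$, and (for $\mu\in\mathbb N_0^d$ with $|\mu|=|\nu|$) the normalized coefficients satisfy $$\widehat b^{\,\tau}_{2\nu+\varepsilon,\,2\mu+\varepsilon}(\kappa)=\widehat c^{\,\tau}_{\nu,\mu}(\kappa+\varepsilon),$$ where $\kappa+\varepsilon$ means $\kappa+(\varepsilon,0)\in\mathbb R^{d+1}$, $\tau$ is regarded as an element of $S_{d+1}$ fixing $d+1$, and $\widehat c^{\,\tau}_{\nu,\mu}$ are the normalized connection coefficients of the Jacobi polynomials on the simplex.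
   Context: **Vectors.** $|y|$ is the sum of the entries of $y$; $\mathbf y_j=(y_1,\dots,y_j)$; $\mathbf y^j$ is the tail from the $j$-th to the last entry ($\boldsymbol\kappa^j=(\kappa_j,\dots,\kappa_{d+1})$, $\boldsymbol\nu^j=(\nu_j,\dots,\nu_d)$); empty parts have sum $0$ and norm $0$. $\|\cdot\|$ is the Euclidean norm. $(a)_n=a(a+1)\cdots(a+n-1)$. **Simplex.** $T^d=\{x\in\mathbb R^d:x_i\ge0,|x|\le1\}$, $W_\kappa(x)=x_1^{\kappa_1}\cdots x_d^{\kappa_d}(1-|x|)^{\kappa_{d+1}}$, $\langle f,g\rangle_{W_\kappa}=\frac{\Gamma(|\kappa|+d+1)}{\prod_{i=1}^{d+1}\Gamma(\kappa_i+1)}\int_{T^d}fgW_\kappa\,dx$. Put $a_j=|\boldsymbol\kappa^{j+1}|+2|\boldsymbol\nu^{j+1}|+d-j$ and $$P_\nu^\kappa(x)=\prod_{j=1}^d(1-|\mathbf x_{j-1}|)^{\nu_j}P_{\nu_j}^{(a_j,\kappa_j)}\Big(\frac{2x_j}{1-|\mathbf x_{j-1}|}-1\Big)$$ (classical Jacobi polynomials, $P_n^{(\alpha,\beta)}(1)=(\alpha+1)_n/n!$). For each $n$ these, $|\nu|=n$, form an orthogonal basis of the space of degree-$n$ orthogonal polynomials; $A_\nu(\kappa)=\langle P_\nu^\kappa,P_\nu^\kappa\rangle_{W_\kappa}$. For $\tau\in S_{d+1}$: $\tau y=(y_{\tau(1)},\dots,y_{\tau(d+1)})$ for $y\in\mathbb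 R^{d+1}$, and $\tau x=(x_{\tau(1)},\dots,x_{\tau(d)})$, $x_{d+1}:=1-|x|$, for $x\in T^d$. $c^\tau_{\nu,\mu}(\kappa)$ is defined by $P_\nu^{\tau\kappa}(\tau x)=\sum_{|\mu|=|\nu|}c^\tau_{\nu,\mu}(\kappa)P_\mu^\kappa(x)$ and $\widehat c^{\,\tau}_{\nu,\mu}(\kappa)=\sqrt{A_\mu(\kappa)/A_\nu(\tau\kappa)}\,c^\tau_{\nu,\mu}(\kappa)$. **Ball.** $\mathbb B^d=\{x:\|x\|\le1\}$, $W_\kappa^{\mathbb B}(x)=\prod_{i=1}^d|x_i|^{2\kappa_i+1}(1-\|x\|^2)^{\kappa_{d+1}}$. The orthogonal basis of the space $\mathcal V_n^d(W_\kappa^{\mathbb B})$ of degree-$n$ orthogonal polynomials used is, for $\alpha\in\mathbb N_0^d$, $|\alpha|=n$, $$P_\alpha^n(W_\kappa^{\mathbb B};x)=\prod_{j=1}^d(1-\|\mathbf x_{j-1}\|^2)^{\alpha_j/2}\,C_{\alpha_j}^{(\lambda_j+\frac12,\kappa_j+\frac12)}\Big(\frac{x_j}{\sqrt{1-\|\mathbf x_{j-1}\|^2}}\Big),\quad\lambda_j=|\boldsymbol\alpha^{j+1}|+|\boldsymbol\kappa^{j+1}|+d-j,$$ where $C_n^{(\lambda,\mu)}$ is the generalized Gegenbauer polynomial, i.e. the degree-$n$ orthogonal polynomial (taken with positive leading coefficient) for the weight $|t|^{2\mu}(1-t^2)^{\lambda-\frac12}$ on $[-1,1]$. For $\tau\in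 S_d$ let $\tau x=(x_{\tau(1)},\dots,x_{\tau(d)})$ for $x\in\mathbb R^d$ and $\tau\kappa=(\kappa_{\tau(1)},\dots,\kappa_{\tau(d)},\kappa_{d+1})$. The coefficients $b^\tau_{\alpha,\beta}(\kappa)$ are defined by $P_\alpha^n(W_{\tau\kappa}^{\mathbb B};\tau x)=\sum_{|\beta|=n}b^\tau_{\alpha,\beta}(\kappa)P_\beta^n(W_\kappa^{\mathbb B};x)$, and $\widehat b^{\,\tau}_{\alpha,\beta}(\kappa)$ are the analogous coefficients when both bases are replaced by the orthonormal bases obtained by dividing each element by its norm in $L^2(W_\kappa^{\mathbb B})$.
   Formalization: The left index 2ν+ε is replaced by 2ν+τε, with τε=(ε_τ(1),…,ε_τ(d)), in both claims; as printed they fail when τε≠ε (e.g. d=2, τ=(1 2), ν=0, ε=(1,0): b_{(1,0),(0,1)}≠0). When τε=ε the statements coincide. *)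

theory Defs
  imports "HOL-Analysis.Analysis" "HOL-Combinatorics.Permutations"
    "HOL-Computational_Algebra.Polynomial"
begin

text \<open>
  Coordinates are numbered from 1. Points of $d$-space are functions that are extensional on
  \<open>{1..d}\<close>, i.e. the points of \<open>\<Pi>\<^sub>M i\<in>{1..d}. lborel\<close>. A parameter vector \<open>\<kappa>\<close> with \<open>d + 1\<close>
  entries is a function of which only the values on \<open>{1..d + 1}\<close> are ever used. Multi-indices are
  extended by 0, so that they can be added pointwise, and adding one to \<open>\<kappa>\<close> leaves
  the entry \<open>d + 1\<close> unchanged.

  A vector \<open>y\<close> permuted by \<open>\<tau>\<close> is \<open>y \<circ> \<tau>\<close>. A permutation \<open>\<tau>\<close> of \<open>{1..d}\<close>
  in the sense of \<open>permutes\<close> is also one of \<open>{1..d + 1}\<close>, fixing \<open>d + 1\<close>.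
\<close>

definition multi_indices :: "nat \<Rightarrow> (nat \<Rightarrow> nat) set" where
  "multi_indices d = {\<alpha>. \<forall>i. i \<notin> {1..d} \<longrightarrow> \<alpha> i = 0}"

definition multi_indices_deg :: "nat \<Rightarrow> nat \<Rightarrow> (nat \<Rightarrow> nat) set" where
  "multi_indices_deg d n = {\<alpha> \<in> multi_indices d. (\<Sum>i=1..d. \<alpha> i) = n}"

text \<open>
  The coefficients of \<open>f\<close> with respect to the family \<open>B\<close> indexed by \<open>I\<close>, as functions on \<open>D\<close>. The
  value 0 outside \<open>I\<close> is only a convention that makes the coefficient function unique.
\<close>

definition expansion_coeffs ::
    "'x set \<Rightarrow> 'i set \<Rightarrow> ('i \<Rightarrow> 'x \<Rightarrow> real) \<Rightarrow> ('x \<Rightarrow> real) \<Rightarrow> 'i \<Rightarrow> real" where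
  "expansion_coeffs D I B f =
     (THE c. (\<forall>i. i \<notin> I \<longrightarrow> c i = 0) \<and> (\<forall>x\<in>D. f x = (\<Sum>i\<in>I. c i * B i x)))"

abbreviation lborel_pow :: "nat \<Rightarrow> (nat \<Rightarrow> real) measure" where
  "lborel_pow d \<equiv> Pi\<^sub>M {1..d} (\<lambda>_. lborel)"


section \<open>Jacobi polynomials on the simplex\<close>

text \<open>
  The classical Jacobi polynomial, as the terminating hypergeometric series
  $\frac{(\alpha+1)_n}{n!}\,{}_2F_1(-n, n+\alpha+\beta+1; \alpha+1; \frac{1-t}{2})$
  with the quotients $(\alpha+1)_n/(\alpha+1)_k$ cancelled.
\<close>

definition jacobi :: "nat \<Rightarrow> real \<Rightarrow> real \<Rightarrow> real \<Rightarrow> real" where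
  "jacobi n \<alpha> \<beta> t =
     (\<Sum>k\<le>n. pochhammer (real n + \<alpha> + \<beta> + 1) k * pochhammer (\<alpha> + real k + 1) (n - k)
            / (fact k * fact (n - k)) * ((t - 1) / 2) ^ k)"

lemma jacobi_at_1: "jacobi n \<alpha> \<beta> 1 = pochhammer (\<alpha> + 1) n / fact n"
proof -
  have "jacobi n \<alpha> \<beta> 1 = (\<Sum>k\<le>n. if k = 0 then pochhammer (\<alpha> + 1) n / fact n else 0)"
    unfolding jacobi_def by (intro sum.cong) auto
  then show ?thesis by simp
qed

definition std_simplex :: "nat \<Rightarrow> (nat \<Rightarrow> real) set" where
  "std_simplex d = {x \<in> extensional {1..d}. (\<forall>i\<in>{1..d}. 0 \<le> x i) \<and> (\<Sum>i=1..d. x i) \<le> 1}"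

text \<open>
  Because \<open>0 powr 0 = 0\<close>, this and the other weights below may deviate from the textbook value on
  a null set (where a base vanishes); this does not affect any integral.
\<close>

definition simplex_weight :: "nat \<Rightarrow> (nat \<Rightarrow> real) \<Rightarrow> (nat \<Rightarrow> real) \<Rightarrow> real" where
  "simplex_weight d \<kappa> x =
     (\<Prod>i=1..d. x i powr \<kappa> i) * (1 - (\<Sum>i=1..d. x i)) powr \<kappa> (d + 1)"

definition simplex_inner ::
    "nat \<Rightarrow> (nat \<Rightarrow> real) \<Rightarrow> ((nat \<Rightarrow> real) \<Rightarrow> real) \<Rightarrow> ((nat \<Rightarrow> real) \<Rightarrow> real) \<Rightarrow> real" where
  "simplex_inner d \<kappa> f g =
     Gamma ((\<Sum>i=1..d+1. \<kappa> i) + real d + 1) / (\<Prod>i=1..d+1. Gamma (\<kappa> i + 1))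
     * (LINT x:std_simplex d|lborel_pow d. f x * g x * simplex_weight d \<kappa> x)"

text \<open>
  Where \<open>1 - \<bar>x\<^sub>1 + \<dots>\<bar>\<close> vanishes inside the simplex, the convention \<open>a / 0 = 0\<close> is harmless: the
  power in front is then 0, or the Jacobi polynomial is constant.
\<close>

definition simplex_poly :: "nat \<Rightarrow> (nat \<Rightarrow> real) \<Rightarrow> (nat \<Rightarrow> nat) \<Rightarrow> (nat \<Rightarrow> real) \<Rightarrow> real" where
  "simplex_poly d \<kappa> \<nu> x =
     (\<Prod>j=1..d.
        (1 - (\<Sum>i=1..<j. x i)) ^ \<nu> j
        * jacobi (\<nu> j)
            ((\<Sum>i=j+1..d+1. \<kappa> i) + 2 * real (\<Sum>i=j+1..d. \<nu> i) + real d - real j) (\<kappa> j)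
            (2 * x j / (1 - (\<Sum>i=1..<j. x i)) - 1))"

definition simplex_norm_sq :: "nat \<Rightarrow> (nat \<Rightarrow> real) \<Rightarrow> (nat \<Rightarrow> nat) \<Rightarrow> real" where
  "simplex_norm_sq d \<kappa> \<nu> = simplex_inner d \<kappa> (simplex_poly d \<kappa> \<nu>) (simplex_poly d \<kappa> \<nu>)"

text \<open>The action of a permutation of \<open>{1..d + 1}\<close> on the simplex, with $x_{d+1} = 1 - |x|$.\<close>

definition simplex_perm :: "nat \<Rightarrow> (nat \<Rightarrow> nat) \<Rightarrow> (nat \<Rightarrow> real) \<Rightarrow> nat \<Rightarrow> real" where
  "simplex_perm d \<tau> x = (\<lambda>i\<in>{1..d}. (x(d + 1 := 1 - (\<Sum>i=1..d. x i))) (\<tau> i))"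

definition simplex_conn ::
    "nat \<Rightarrow> (nat \<Rightarrow> nat) \<Rightarrow> (nat \<Rightarrow> real) \<Rightarrow> (nat \<Rightarrow> nat) \<Rightarrow> (nat \<Rightarrow> nat) \<Rightarrow> real" where
  "simplex_conn d \<tau> \<kappa> \<nu> =
     expansion_coeffs (std_simplex d) (multi_indices_deg d (\<Sum>i=1..d. \<nu> i)) (simplex_poly d \<kappa>)
       (\<lambda>x. simplex_poly d (\<kappa> \<circ> \<tau>) \<nu> (simplex_perm d \<tau> x))"

definition simplex_conn_normalized ::
    "nat \<Rightarrow> (nat \<Rightarrow> nat) \<Rightarrow> (nat \<Rightarrow> real) \<Rightarrow> (nat \<Rightarrow> nat) \<Rightarrow> (nat \<Rightarrow> nat) \<Rightarrow> real" where
  "simplex_conn_normalized d \<tau> \<kappa> \<nu> \<mu> =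
     sqrt (simplex_norm_sq d \<kappa> \<mu> / simplex_norm_sq d (\<kappa> \<circ> \<tau>) \<nu>) * simplex_conn d \<tau> \<kappa> \<nu> \<mu>"


section \<open>Orthogonal polynomials on the ball\<close>

text \<open>
  A degree-\<open>n\<close> orthogonal polynomial with positive leading coefficient is determined only up to a
  positive factor. No further normalization is fixed: what follows takes as parameter an arbitrary
  choice \<open>C lam \<mu> n\<close> of these polynomials.
\<close>

definition is_gen_gegenbauer :: "real \<Rightarrow> real \<Rightarrow> nat \<Rightarrow> real poly \<Rightarrow> bool" where
  "is_gen_gegenbauer lam \<mu> n p \<longleftrightarrow>
     degree p = n \<and> lead_coeff p > 0 \<and>
     (\<forall>q. q = 0 \<or> degree q < n \<longrightarrow>
        (LBINT t:{-1..1}. poly p t * poly q t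
           * (\<bar>t\<bar> powr (2 * \<mu>) * (1 - t\<^sup>2) powr (lam - 1/2))) = 0)"

definition unit_ball :: "nat \<Rightarrow> (nat \<Rightarrow> real) set" where
  "unit_ball d = {x \<in> extensional {1..d}. (\<Sum>i=1..d. (x i)\<^sup>2) \<le> 1}"

definition ball_weight :: "nat \<Rightarrow> (nat \<Rightarrow> real) \<Rightarrow> (nat \<Rightarrow> real) \<Rightarrow> real" where
  "ball_weight d \<kappa> x =
     (\<Prod>i=1..d. \<bar>x i\<bar> powr (2 * \<kappa> i + 1)) * (1 - (\<Sum>i=1..d. (x i)\<^sup>2)) powr \<kappa> (d + 1)"

text \<open>
  The factor $(1 - \|x_{j-1}\|^2)^{\alpha_j/2}$ is written as a natural power of a square root, so
  that it is 1 for $\alpha_j = 0$ also where the base vanishes.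
\<close>

definition ball_poly ::
    "(real \<Rightarrow> real \<Rightarrow> nat \<Rightarrow> real poly) \<Rightarrow> nat \<Rightarrow> (nat \<Rightarrow> real) \<Rightarrow> (nat \<Rightarrow> nat)
     \<Rightarrow> (nat \<Rightarrow> real) \<Rightarrow> real" where
  "ball_poly C d \<kappa> \<alpha> x =
     (\<Prod>j=1..d.
        sqrt (1 - (\<Sum>i=1..<j. (x i)\<^sup>2)) ^ \<alpha> j
        * poly (C ((real (\<Sum>i=j+1..d. \<alpha> i) + (\<Sum>i=j+1..d+1. \<kappa> i) + real d - real j) + 1/2)
                  (\<kappa> j + 1/2) (\<alpha> j))
            (x j / sqrt (1 - (\<Sum>i=1..<j. (x i)\<^sup>2))))"

definition ball_norm ::
    "(real \<Rightarrow> real \<Rightarrow> nat \<Rightarrow> real poly) \<Rightarrow> nat \<Rightarrow> (nat \<Rightarrow> real) \<Rightarrow> (nat \<Rightarrow> nat) \<Rightarrow> real" where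
  "ball_norm C d \<kappa> \<alpha> =
     sqrt (LINT x:unit_ball d|lborel_pow d. (ball_poly C d \<kappa> \<alpha> x)\<^sup>2 * ball_weight d \<kappa> x)"

definition ball_poly_orthonormal ::
    "(real \<Rightarrow> real \<Rightarrow> nat \<Rightarrow> real poly) \<Rightarrow> nat \<Rightarrow> (nat \<Rightarrow> real) \<Rightarrow> (nat \<Rightarrow> nat)
     \<Rightarrow> (nat \<Rightarrow> real) \<Rightarrow> real" where
  "ball_poly_orthonormal C d \<kappa> \<alpha> x = ball_poly C d \<kappa> \<alpha> x / ball_norm C d \<kappa> \<alpha>"

definition ball_perm :: "nat \<Rightarrow> (nat \<Rightarrow> nat) \<Rightarrow> (nat \<Rightarrow> real) \<Rightarrow> nat \<Rightarrow> real" where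
  "ball_perm d \<tau> x = (\<lambda>i\<in>{1..d}. x (\<tau> i))"

text \<open>
  In the expanded function the variable $x_{\tau(j)}$ sits at position \<open>j\<close>, so it has the parity of
  $\alpha_j$ in $x_{\tau(j)}$. Hence a nonzero coefficient at \<open>\<beta>\<close> needs
  $\beta_{\tau(j)} \equiv \alpha_j$ modulo 2 for all \<open>j\<close>: indices \<open>2\<mu> + \<epsilon>\<close> on the
  expansion side are paired with indices \<open>2\<nu> + \<epsilon> \<circ> \<tau>\<close> on the permuted side.
\<close>

definition ball_conn ::
    "(real \<Rightarrow> real \<Rightarrow> nat \<Rightarrow> real poly) \<Rightarrow> nat \<Rightarrow> (nat \<Rightarrow> nat) \<Rightarrow> (nat \<Rightarrow> real) \<Rightarrow> (nat \<Rightarrow> nat)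
     \<Rightarrow> (nat \<Rightarrow> nat) \<Rightarrow> real" where
  "ball_conn C d \<tau> \<kappa> \<alpha> =
     expansion_coeffs (unit_ball d) (multi_indices_deg d (\<Sum>i=1..d. \<alpha> i)) (ball_poly C d \<kappa>)
       (\<lambda>x. ball_poly C d (\<kappa> \<circ> \<tau>) \<alpha> (ball_perm d \<tau> x))"

definition ball_conn_normalized ::
    "(real \<Rightarrow> real \<Rightarrow> nat \<Rightarrow> real poly) \<Rightarrow> nat \<Rightarrow> (nat \<Rightarrow> nat) \<Rightarrow> (nat \<Rightarrow> real) \<Rightarrow> (nat \<Rightarrow> nat)
     \<Rightarrow> (nat \<Rightarrow> nat) \<Rightarrow> real" where
  "ball_conn_normalized C d \<tau> \<kappa> \<alpha> =
     expansion_coeffs (unit_ball d) (multi_indices_deg d (\<Sum>i=1..d. \<alpha> i))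
       (ball_poly_orthonormal C d \<kappa>)
       (\<lambda>x. ball_poly_orthonormal C d (\<kappa> \<circ> \<tau>) \<alpha> (ball_perm d \<tau> x))"

end

theory Submission
  imports Defs
begin

text \<open>
  The map \<open>x \<mapsto> (x\<^sub>1\<^sup>2, \<dots>, x\<^sub>d\<^sup>2)\<close> from the ball to the simplex turns the basis on the ball into the one on
  the simplex. In one variable, the generalized Gegenbauer polynomial of degree \<open>2 * n + e\<close>, with
  \<open>e \<in> {0, 1}\<close>, is a positive multiple of \<open>t ^ e\<close> times a Jacobi polynomial of degree \<open>n\<close> in
  \<open>2 * t\<^sup>2 - 1\<close>, because both are orthogonal to all polynomials of lower degree
  (\<open>gen_gegenbauer_eq_jacobi\<close>). Taking the product over the coordinates, the ball polynomial with index
  \<open>2 * \<nu> + e\<close> is a positive constant times \<open>\<Prod>i. x i ^ e i\<close> times the simplex polynomial with index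
  \<open>\<nu>\<close> and parameter \<open>\<kappa> + e\<close> at the point of squares (\<open>ball_poly_eq_simplex_poly\<close>).
  
  Insert this identity into the expansion of a permuted polynomial on the simplex. The monomial factor
  is common to all terms, so the result is an expansion of the permuted ball polynomial in which only
  indices \<open>2 * \<mu> + \<epsilon>\<close> occur, with the simplex coefficients up to the constants of the identity
  (\<open>ball_perm_expansion_coeffs\<close>). The substitution \<open>s = x\<^sup>2\<close> also turns the norm on the ball into the
  norm on the simplex times the same constant (\<open>ball_norm_eq_dirichlet\<close>), up to Gamma factors that a
  permutation of \<open>\<kappa>\<close> does not change, so that all constants cancel in the normalized coefficients.
  
  The coefficients are well defined only if expansions exist and are unique. On the simplex, both come
  from splitting off the last coordinate: \<open>simplex_poly_Suc\<close> says that what remains is a Jacobi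
  polynomial in one dimension less, with changed parameters. By induction on the dimension this gives
  orthogonality, positive norms, and that the basis spans all polynomials. A permuted polynomial of
  degree \<open>n\<close> is then orthogonal to all polynomials of lower degree, hence a combination of basis
  elements of degree exactly \<open>n\<close> (\<open>simplex_perm_in_span\<close>). Uniqueness on the ball reduces to that on the
  simplex, since reflections of coordinates separate the terms of different parity
  (\<open>ball_poly_independent\<close>).
\<close>

section \<open>Beta integrals and Jacobi polynomials on the unit interval\<close>

text \<open>
  The \<open>n\<close>-th finite difference annihilates polynomials of degree less than \<open>n\<close>; the polynomial is
  given by its linear factors, because that is how it arises from quotients of Gamma values.
\<close>

lemma alternating_binomial_sum_prod_eq_0:
  fixes cs :: "real list"
  assumes "length cs < n"
  shows "(\<Sum>k\<le>n. (-1) ^ k * real (n choose k) * (\<Prod>c\<leftarrow>cs. real k + c)) = 0"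
  using assms
proof (induction "length cs" arbitrary: cs n)
  case 0
  then show ?case using choose_alternating_sum[of n, where 'a = real] by (simp add: atLeast0AtMost)
next
  case (Suc m)
  then obtain c cs' where cs: "cs = c # cs'" and l: "m = length cs'"
    by (cases cs) auto
  have regroup: "(-1 * s) * x * (y * f) = - z * (s * x' * f)" if "y * x = z * x'"
    for s x y f z x' :: real
  proof -
    have "(-1 * s) * x * (y * f) = - (s * (y * x) * f)" by simp
    also have "\<dots> = - z * (s * x' * f)" unfolding that by simp
    finally show ?thesis .
  qed
  obtain n' where n: "n = Suc n'" using Suc.prems by (cases n) auto
  let ?f = "\<lambda>k. (\<Prod>c\<leftarrow>cs'. real k + c)"
  let ?g = "\<lambda>k. (\<Prod>c\<leftarrow>map ((+) 1) cs'. real k + c)"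
  have shift: "?f (Suc k) = ?g k" for k
    by (simp add: o_def add_ac)
  have 1: "(\<Sum>k\<le>n. (-1) ^ k * real (n choose k) * ?f k) = 0"
    by (rule Suc.hyps(1)) (use Suc.prems l cs in auto)
  have 2: "(\<Sum>k\<le>n'. (-1) ^ k * real (n' choose k) * ?g k) = 0"
    by (rule Suc.hyps(1)) (use Suc.prems l cs n in auto)
  \<comment> \<open>Split the first factor \<open>k + c\<close>. The part with \<open>c\<close> has one factor less; in the part with \<open>k\<close>
    the absorption identity lowers \<open>n\<close> by one and shifts \<open>k\<close>, hence also the constants \<open>c\<close>.\<close>
  have "(\<Sum>k\<le>n. (-1) ^ k * real (n choose k) * (real k * ?f k))
        = (\<Sum>k\<le>n'. (-1) ^ Suc k * real (n choose Suc k) * (real (Suc k) * ?f (Suc k)))"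
    unfolding n by (subst sum.atMost_Suc_shift) simp
  also have "\<dots> = (\<Sum>k\<le>n'. - real n * ((-1) ^ k * real (n' choose k) * ?g k))"
  proof (intro sum.cong refl)
    fix k
    have "real (Suc k) * real (n choose Suc k) = real n * real (n' choose k)"
      unfolding n using Suc_times_binomial[of k n'] by (simp only: of_nat_mult[symmetric])
    then show "(-1) ^ Suc k * real (n choose Suc k) * (real (Suc k) * ?f (Suc k))
        = - real n * ((-1) ^ k * real (n' choose k) * ?g k)"
      unfolding shift power_Suc by (rule regroup)
  qed
  also have "\<dots> = - real n * (\<Sum>k\<le>n'. (-1) ^ k * real (n' choose k) * ?g k)"
    by (simp add: sum_distrib_left)
  finally have 3: "(\<Sum>k\<le>n. (-1) ^ k * real (n choose k) * (real k * ?f k)) = 0"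
    using 2 by simp
  have "(\<Sum>k\<le>n. (-1) ^ k * real (n choose k) * (\<Prod>c\<leftarrow>cs. real k + c))
     = (\<Sum>k\<le>n. (-1) ^ k * real (n choose k) * (real k * ?f k))
       + c * (\<Sum>k\<le>n. (-1) ^ k * real (n choose k) * ?f k)"
    unfolding sum_distrib_left sum.distrib[symmetric] cs
    by (intro sum.cong) (auto simp: distrib_left distrib_right mult_ac)
  then show ?case using 1 3 by simp
qed

lemma pochhammer_eq_prod_list:
  "pochhammer (real k + x) m = (\<Prod>c\<leftarrow>map (\<lambda>i. x + real i) [0..<m]. real k + c)"
  by (induction m) (simp_all add: pochhammer_Suc add_ac)

text \<open>
  In this order of the parameters, \<open>beta_weight a b\<close> is the weight of the Jacobi polynomials
  \<open>t \<mapsto> jacobi n b a (2 * t - 1)\<close>.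
\<close>

definition beta_weight :: "real \<Rightarrow> real \<Rightarrow> real \<Rightarrow> real" where
  "beta_weight a b u = indicator {0..1} u * (u powr a * (1 - u) powr b)"

lemma beta_weight_nonneg [simp]: "beta_weight a b u \<ge> 0"
  by (simp add: beta_weight_def)

lemma beta_weight_measurable [measurable]: "beta_weight a b \<in> borel_measurable borel"
  unfolding beta_weight_def by measurable

lemma power_mult_beta_weight:
  "(1 - u) ^ m * beta_weight a b u = beta_weight a (b + real m) u"
proof (cases "0 \<le> u \<and> u < 1")
  case True
  then have "(1 - u) ^ m = (1 - u) powr real m" by (simp add: powr_realpow)
  then show ?thesis using True by (simp add: beta_weight_def powr_add algebra_simps)
next
  case False
  then show ?thesis by (auto simp: beta_weight_def indicator_def)
qed

lemma integrable_beta_weight: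
  assumes "a > -1" "b > -1"
  shows "integrable lborel (beta_weight a b)"
  using integrable_Beta[of "a + 1" "b + 1"] assms
  by (simp add: set_integrable_def beta_weight_def[abs_def])

lemma integral_beta_weight:
  assumes "a > -1" "b > -1"
  shows "(\<integral>u. beta_weight a b u \<partial>lborel) = Beta (a + 1) (b + 1)"
proof -
  have "(\<integral>u. beta_weight a b u \<partial>lborel) = (LBINT u:{0..1}. u powr a * (1 - u) powr b)"
    by (simp add: set_lebesgue_integral_def beta_weight_def)
  also have "\<dots> = integral {0..1} (\<lambda>u. u powr a * (1 - u) powr b)"
    using integrable_Beta[of "a + 1" "b + 1"] assms
    by (intro set_borel_integral_eq_integral) simp
  also have "\<dots> = Beta (a + 1) (b + 1)"
    using has_integral_Beta_real[of "a + 1" "b + 1"] assms by (intro integral_unique) simp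
  finally show ?thesis .
qed

text \<open>
  The interval is \<open>[-1, 1]\<close> so that the lemma serves the weights on \<open>[0, 1]\<close> and those on \<open>[-1, 1]\<close>.
\<close>

lemma integrable_poly_mult_weight:
  fixes w :: "real \<Rightarrow> real"
  assumes w: "integrable lborel w" and supp: "\<And>u. u \<notin> {-1..1} \<Longrightarrow> w u = 0"
  shows "integrable lborel (\<lambda>u. poly p u * w u)"
proof -
  have "bounded (poly p ` {-1..1})"
    by (intro compact_imp_bounded compact_continuous_image continuous_intros) auto
  then obtain B where B: "\<And>u. u \<in> {-1..1} \<Longrightarrow> \<bar>poly p u\<bar> \<le> B"
    by (auto simp: bounded_iff simp del: atLeastAtMost_iff)
  have "integrable lborel (\<lambda>u. B * w u)" using w by simp
  then show ?thesis
  proof (rule Bochner_Integration.integrable_bound)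
    have "poly p \<in> borel_measurable borel"
      by (intro borel_measurable_continuous_onI continuous_intros)
    with w show "(\<lambda>u. poly p u * w u) \<in> borel_measurable lborel" by measurable
    show "AE u in lborel. norm (poly p u * w u) \<le> norm (B * w u)"
    proof (rule AE_I2)
      fix u
      show "norm (poly p u * w u) \<le> norm (B * w u)"
      proof (cases "u \<in> {-1..1}")
        case True
        then show ?thesis using B[OF True]
          by (auto simp: abs_mult intro!: mult_right_mono)
      qed (simp add: supp)
    qed
  qed
qed

text \<open>
  A vanishing integral would force the polynomial to vanish almost everywhere on \<open>(0, 1)\<close>, but it has
  finitely many roots.
\<close>

lemma integral_square_poly_weight_pos:
  fixes w :: "real \<Rightarrow> real"
  assumes int: "integrable lborel (\<lambda>u. (poly p u)\<^sup>2 * w u)"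
    and nn: "\<And>u. w u \<ge> 0" and pos: "\<And>u. 0 < u \<Longrightarrow> u < 1 \<Longrightarrow> w u > 0" and "p \<noteq> 0"
  shows "(\<integral>u. (poly p u)\<^sup>2 * w u \<partial>lborel) > 0"
proof -
  let ?f = "\<lambda>u. (poly p u)\<^sup>2 * w u"
  have "(\<integral>u. ?f u \<partial>lborel) \<noteq> 0"
  proof
    assume "(\<integral>u. ?f u \<partial>lborel) = 0"
    then have "AE u in lborel. ?f u = 0"
      using integral_nonneg_eq_0_iff_AE[OF int] nn by simp
    moreover have "AE u in lborel. u \<notin> {u. poly p u = 0}"
      using poly_roots_finite[OF \<open>p \<noteq> 0\<close>]
      by (intro AE_not_in) (auto intro: countable_imp_null_set_lborel countable_finite)
    ultimately have "AE u in lborel. \<not> (0 < u \<and> u < (1::real))"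
    proof eventually_elim
      case (elim u)
      then show ?case using pos[of u] by auto
    qed
    then have "AE u in lborel. u \<notin> {0<..<1::real}" by simp
    then have "emeasure lborel {0<..<1::real} = 0"
      by (subst (asm) AE_iff_null_sets[symmetric]) auto
    then show False by simp
  qed
  moreover have "(\<integral>u. ?f u \<partial>lborel) \<ge> 0" using nn by (intro integral_nonneg_AE) auto
  ultimately show ?thesis by linarith
qed

lemma beta_weight_outside: "u \<notin> {-1..1} \<Longrightarrow> beta_weight a b u = 0"
  by (auto simp: beta_weight_def)

lemma beta_weight_pos: "0 < u \<Longrightarrow> u < 1 \<Longrightarrow> beta_weight a b u > 0"
  by (simp add: beta_weight_def)

lemma integrable_poly_beta_weight:
  assumes "a > -1" "b > -1"
  shows "integrable lborel (\<lambda>u. poly p u * beta_weight a b u)"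
  by (intro integrable_poly_mult_weight integrable_beta_weight beta_weight_outside assms)

definition jacobi_coeff :: "nat \<Rightarrow> real \<Rightarrow> real \<Rightarrow> nat \<Rightarrow> real" where
  "jacobi_coeff n \<alpha> \<beta> k =
     pochhammer (real n + \<alpha> + \<beta> + 1) k * pochhammer (\<alpha> + real k + 1) (n - k)
       / (fact k * fact (n - k))"

text \<open>
  Jacobi polynomials on \<open>[0, 1]\<close>, as formal polynomials, so that degree and leading coefficient can be
  spoken of.
\<close>

definition shifted_jacobi :: "nat \<Rightarrow> real \<Rightarrow> real \<Rightarrow> real poly" where
  "shifted_jacobi n \<alpha> \<beta> = (\<Sum>k\<le>n. smult (jacobi_coeff n \<alpha> \<beta> k) ([:-1, 1:] ^ k))"

lemma poly_shifted_jacobi: "poly (shifted_jacobi n \<alpha> \<beta>) u = jacobi n \<alpha> \<beta> (2 * u - 1)"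
proof -
  have *: "(2 * u - 1 - 1) / 2 = u - 1" by (simp add: field_simps)
  show ?thesis
    unfolding shifted_jacobi_def jacobi_def jacobi_coeff_def poly_sum * by simp
qed

lemma jacobi_coeff_top_pos:
  assumes "\<alpha> > -1" "\<beta> > -1"
  shows "jacobi_coeff n \<alpha> \<beta> n > 0"
proof (cases "n = 0")
  case False
  then show ?thesis using assms
    by (auto simp: jacobi_coeff_def intro!: divide_pos_pos pochhammer_pos)
qed (simp add: jacobi_coeff_def)

lemma degree_linear_power: "degree ([:-1, 1::real:] ^ k) = k"
  by (simp add: degree_power_eq)

lemma coeff_shifted_jacobi_top: "coeff (shifted_jacobi n \<alpha> \<beta>) n = jacobi_coeff n \<alpha> \<beta> n"
proof -
  have "coeff ([:-1, 1::real:] ^ k) n = (if k = n then 1 else 0)" if "k \<le> n" for k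
  proof (cases "k = n")
    case True
    have "lead_coeff ([:-1, 1::real:] ^ n) = 1" by (simp add: lead_coeff_power)
    then show ?thesis using True by (simp add: degree_linear_power)
  next
    case False
    then show ?thesis using that by (auto simp: degree_linear_power intro!: coeff_eq_0)
  qed
  then have "coeff (shifted_jacobi n \<alpha> \<beta>) n = (\<Sum>k\<le>n. jacobi_coeff n \<alpha> \<beta> k * (if k = n then 1 else 0))"
    unfolding shifted_jacobi_def coeff_sum by (intro sum.cong) auto
  also have "\<dots> = (\<Sum>k\<in>{n}. jacobi_coeff n \<alpha> \<beta> k)"
    by (rule sum.mono_neutral_cong_right) auto
  finally show ?thesis by simp
qed

lemma degree_shifted_jacobi:
  assumes "\<alpha> > -1" "\<beta> > -1"
  shows "degree (shifted_jacobi n \<alpha> \<beta>) = n"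
proof (rule antisym)
  show "degree (shifted_jacobi n \<alpha> \<beta>) \<le> n"
    unfolding shifted_jacobi_def
    by (intro degree_sum_le) (auto intro: order_trans[OF degree_smult_le] simp: degree_linear_power)
  show "n \<le> degree (shifted_jacobi n \<alpha> \<beta>)"
    using jacobi_coeff_top_pos[OF assms, of n] by (intro le_degree) (simp add: coeff_shifted_jacobi_top)
qed

text \<open>
  The two Pochhammer symbols on the right come from cancelling Gamma values whose arguments differ by
  an integer. Together they are a polynomial of degree \<open>n - 1\<close> in \<open>k\<close>, which is what makes the moments
  of the Jacobi polynomials vanish.
\<close>

lemma jacobi_coeff_times_Beta:
  fixes a b :: real
  assumes "a > -1" "b > -1" "l < n" "k \<le> n"
  shows "jacobi_coeff n b a k * Beta (a + 1) (b + real (k + l) + 1)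
    = Gamma (a + 1) * Gamma (b + real n + 1) / (fact n * Gamma (real n + a + b + 1))
      * (real (n choose k) * (pochhammer (real k + (b + 1)) l
          * pochhammer (real k + (a + b + 2 + real l)) (n - Suc l)))"
proof -
  have pG: "pochhammer z m = Gamma (z + real m) / Gamma z" if "z > 0" for z :: real and m
    using that by (intro pochhammer_Gamma) (auto elim!: nonpos_Ints_cases)
  have n: "real n \<ge> 1" using assms by simp
  have e1: "pochhammer (real n + b + a + 1) k
      = Gamma (real n + a + b + 1 + real k) / Gamma (real n + a + b + 1)"
    using assms n by (subst pG) (auto simp: algebra_simps)
  have e2: "pochhammer (b + real k + 1) (n - k) = Gamma (b + real n + 1) / Gamma (b + real k + 1)"
    using assms n by (subst pG) (auto simp: algebra_simps of_nat_diff)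
  have e3: "pochhammer (real k + (b + 1)) l = Gamma (b + real (k + l) + 1) / Gamma (b + real k + 1)"
    using assms n by (subst pG) (auto simp: algebra_simps)
  have e4: "pochhammer (real k + (a + b + 2 + real l)) (n - Suc l)
      = Gamma (real n + a + b + 1 + real k) / Gamma (a + b + real (k + l) + 2)"
    using assms n by (subst pG) (auto simp: algebra_simps of_nat_diff)
  have e5: "Beta (a + 1) (b + real (k + l) + 1)
     = Gamma (a + 1) * Gamma (b + real (k + l) + 1) / Gamma (a + b + real (k + l) + 2)"
    by (simp add: Beta_def algebra_simps)
  have e6: "real (n choose k) = fact n / (fact k * fact (n - k))"
    using assms by (simp add: binomial_fact)
  have regroup: "x1 / x2 * (x3 / x4) / (f * g) * (x5 * x6 / x7)
      = x5 * x3 / (N * x2) * (N / (f * g) * (x6 / x4 * (x1 / x7)))" if "N \<noteq> 0"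
    for x1 x2 x3 x4 x5 x6 x7 f g N :: real using that by (simp add: mult_ac)
  show ?thesis
    unfolding jacobi_coeff_def e1 e2 e3 e4 e5 e6 by (rule regroup) simp
qed

text \<open>
  The series of the Jacobi polynomial is in powers of \<open>1 - u\<close>, so every term integrates to a Beta value
  and the sum is an \<open>n\<close>-th difference of a polynomial of degree \<open>n - 1\<close>.
\<close>

lemma shifted_jacobi_orthogonal_power:
  assumes "a > -1" "b > -1" "l < n"
  shows "(\<integral>u. poly (shifted_jacobi n b a) u * (1 - u) ^ l * beta_weight a b u \<partial>lborel) = 0"
proof -
  define K where "K = Gamma (a + 1) * Gamma (b + real n + 1) / (fact n * Gamma (real n + a + b + 1))"
  define cs where "cs = map (\<lambda>i. b + 1 + real i) [0..<l]
    @ map (\<lambda>i. a + b + 2 + real l + real i) [0..<n - Suc l]"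
  have "poly (shifted_jacobi n b a) u * (1 - u) ^ l * beta_weight a b u
     = (\<Sum>k\<le>n. (-1) ^ k * jacobi_coeff n b a k * beta_weight a (b + real (k + l)) u)" for u
  proof -
    have "(u - 1) ^ k = (-1) ^ k * (1 - u) ^ k" for k
      by (metis minus_diff_eq power_minus)
    then have "jacobi_coeff n b a k * (u - 1) ^ k * (1 - u) ^ l * beta_weight a b u
        = (-1) ^ k * jacobi_coeff n b a k * beta_weight a (b + real (k + l)) u" for k
      unfolding power_mult_beta_weight[of u "k + l" a b, symmetric] power_add
      by (simp only: mult_ac)
    moreover have "poly (shifted_jacobi n b a) u = (\<Sum>k\<le>n. jacobi_coeff n b a k * (u - 1) ^ k)"
      by (simp add: shifted_jacobi_def poly_sum)
    ultimately show ?thesis by (simp only: sum_distrib_right)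
  qed
  then have "(\<integral>u. poly (shifted_jacobi n b a) u * (1 - u) ^ l * beta_weight a b u \<partial>lborel)
      = (\<Sum>k\<le>n. (-1) ^ k * jacobi_coeff n b a k * Beta (a + 1) (b + real (k + l) + 1))"
    using assms
    by (simp add: Bochner_Integration.integral_sum integrable_beta_weight integral_beta_weight)
  also have "\<dots> = (\<Sum>k\<le>n. K * ((-1) ^ k * real (n choose k) * (\<Prod>c\<leftarrow>cs. real k + c)))"
  proof (intro sum.cong refl)
    fix k assume "k \<in> {..n}"
    then have "jacobi_coeff n b a k * Beta (a + 1) (b + real (k + l) + 1)
       = K * (real (n choose k) * (\<Prod>c\<leftarrow>cs. real k + c))"
      using jacobi_coeff_times_Beta[OF assms, of k]
      unfolding K_def cs_def pochhammer_eq_prod_list map_append prod_list.append by simp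
    then show "(-1) ^ k * jacobi_coeff n b a k * Beta (a + 1) (b + real (k + l) + 1)
       = K * ((-1) ^ k * real (n choose k) * (\<Prod>c\<leftarrow>cs. real k + c))"
      by (simp only: mult_ac)
  qed
  also have "\<dots> = 0"
    using alternating_binomial_sum_prod_eq_0[of cs n] assms(3)
    by (simp add: cs_def sum_distrib_left[symmetric] del: prod_list.append map_append)
  finally show ?thesis .
qed

lemma shifted_jacobi_orthogonal:
  assumes "a > -1" "b > -1" "degree q < n"
  shows "(\<integral>u. poly (shifted_jacobi n b a) u * poly q u * beta_weight a b u \<partial>lborel) = 0"
proof -
  define q' where "q' = pcompose q [:1, -1:]"
  have deg: "degree q' < n" using assms(3) by (simp add: q'_def degree_pcompose)
  have q: "poly q u = (\<Sum>l\<le>degree q'. coeff q' l * (1 - u) ^ l)" for u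
  proof -
    have "poly q u = poly q' (1 - u)" by (simp add: q'_def poly_pcompose)
    then show ?thesis by (simp add: poly_altdef)
  qed
  have int: "integrable lborel (\<lambda>u. poly (shifted_jacobi n b a) u * (1 - u) ^ l * beta_weight a b u)" for l
    using integrable_poly_beta_weight[OF assms(1,2), of "shifted_jacobi n b a * [:1, -1:] ^ l"] by simp
  have "(\<lambda>u. poly (shifted_jacobi n b a) u * poly q u * beta_weight a b u)
     = (\<lambda>u. \<Sum>l\<le>degree q'. coeff q' l * (poly (shifted_jacobi n b a) u * (1 - u) ^ l * beta_weight a b u))"
    unfolding q by (simp add: sum_distrib_left sum_distrib_right mult_ac)
  then have "(\<integral>u. poly (shifted_jacobi n b a) u * poly q u * beta_weight a b u \<partial>lborel)
     = (\<Sum>l\<le>degree q'. coeff q' l * (\<integral>u. poly (shifted_jacobi n b a) u * (1 - u) ^ l * beta_weight a b u \<partial>lborel))"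
    by (simp add: Bochner_Integration.integral_sum int)
  also have "\<dots> = 0"
    using shifted_jacobi_orthogonal_power[OF assms(1,2)] deg by (intro sum.neutral) auto
  finally show ?thesis .
qed

lemma shifted_jacobi_orthogonal_pair:
  assumes "a > -1" "b > -1" "n \<noteq> m"
  shows "(\<integral>u. poly (shifted_jacobi n b a) u * poly (shifted_jacobi m b a) u * beta_weight a b u \<partial>lborel) = 0"
proof (cases "m < n")
  case True
  then show ?thesis using assms by (intro shifted_jacobi_orthogonal) (auto simp: degree_shifted_jacobi)
next
  case False
  then have "(\<integral>u. poly (shifted_jacobi m b a) u * poly (shifted_jacobi n b a) u * beta_weight a b u \<partial>lborel) = 0"
    using assms by (intro shifted_jacobi_orthogonal) (auto simp: degree_shifted_jacobi)
  then show ?thesis by (simp add: mult.commute[of "poly (shifted_jacobi n b a) _"])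
qed

section \<open>The substitution of squares\<close>

text \<open>
  Both half-lines contribute equally, which cancels the factor 2 in \<open>ds = 2 * t * dt\<close>. The bounded
  interval suffices for functions on the ball.
\<close>

lemma nn_integral_square:
  fixes f :: "real \<Rightarrow> ennreal"
  assumes [measurable]: "f \<in> borel_measurable borel"
  shows "(\<integral>\<^sup>+t. f (t\<^sup>2) * ennreal (\<bar>t\<bar> * indicator {-1..1} t) \<partial>lborel)
    = (\<integral>\<^sup>+s. f s * indicator {0..1} s \<partial>lborel)"
proof -
  let ?g = "\<lambda>t::real. f (t\<^sup>2) * ennreal (t * indicator {0..1} t)"
  have split: "ennreal (\<bar>t\<bar> * indicator {-1..1} t)
      = ennreal (t * indicator {0..1} t) + ennreal ((-t) * indicator {0..1} (-t))" for t :: real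
    by (auto simp: indicator_def)
  have "(\<integral>\<^sup>+t. f (t\<^sup>2) * ennreal (\<bar>t\<bar> * indicator {-1..1} t) \<partial>lborel)
      = (\<integral>\<^sup>+t. ?g t + ?g (-t) \<partial>lborel)"
    by (simp only: split distrib_left power2_minus)
  also have "\<dots> = (\<integral>\<^sup>+t. ?g t \<partial>lborel) + (\<integral>\<^sup>+t. ?g (-t) \<partial>lborel)"
    by (rule nn_integral_add) measurable
  also have "(\<integral>\<^sup>+t. ?g (-t) \<partial>lborel) = (\<integral>\<^sup>+t. ?g t \<partial>lborel)"
    using nn_integral_real_affine[of ?g "-1" 0] by simp
  also have "(\<integral>\<^sup>+t. ?g t \<partial>lborel) + (\<integral>\<^sup>+t. ?g t \<partial>lborel)
      = (\<integral>\<^sup>+t. ?g t + ?g t \<partial>lborel)"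
    by (rule nn_integral_add[symmetric]) measurable
  also have "\<dots> = (\<integral>\<^sup>+t. f (t\<^sup>2) * ennreal (2 * t) * indicator {0..1} t \<partial>lborel)"
    by (intro nn_integral_cong)
       (auto simp: indicator_def distrib_left[symmetric] mult.commute simp flip: ennreal_plus)
  also have "\<dots> = (\<integral>\<^sup>+s. f s * indicator {0\<^sup>2..1\<^sup>2} s \<partial>lborel)"
    by (rule nn_integral_substitution_aux[symmetric])
       (auto intro!: derivative_eq_intros continuous_intros)
  finally show ?thesis by simp
qed

lemma distr_square:
  "distr (density lborel (\<lambda>t. ennreal (\<bar>t\<bar> * indicator {-1..1} t))) borel (\<lambda>t. t\<^sup>2)
     = density lborel (\<lambda>s::real. ennreal (indicator {0..1} s))"
proof (rule measure_eqI)
  fix A :: "real set"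
  assume "A \<in> sets (distr (density lborel (\<lambda>t. ennreal (\<bar>t\<bar> * indicator {-1..1} t))) borel (\<lambda>t. t\<^sup>2))"
  then have A [measurable]: "A \<in> sets borel" by simp
  have "emeasure (distr (density lborel (\<lambda>t. ennreal (\<bar>t\<bar> * indicator {-1..1} t))) borel (\<lambda>t. t\<^sup>2)) A
    = (\<integral>\<^sup>+t. indicator A (t\<^sup>2) * ennreal (\<bar>t\<bar> * indicator {-1..1} t) \<partial>lborel)"
    by (subst emeasure_distr, (simp; fail), simp, subst emeasure_density, measurable)
       (auto intro!: nn_integral_cong simp: indicator_def)
  also have "\<dots> = (\<integral>\<^sup>+s. indicator A s * indicator {0..1} s \<partial>lborel)"
    by (rule nn_integral_square) measurable
  also have "\<dots> = emeasure (density lborel (\<lambda>s::real. ennreal (indicator {0..1} s))) A"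
    by (subst emeasure_density, measurable) (auto intro!: nn_integral_cong simp: indicator_def)
  finally show "emeasure (distr (density lborel (\<lambda>t. ennreal (\<bar>t\<bar> * indicator {-1..1} t))) borel (\<lambda>t. t\<^sup>2)) A
     = emeasure (density lborel (\<lambda>s::real. ennreal (indicator {0..1} s))) A" .
qed simp

lemma integral_square:
  fixes h :: "real \<Rightarrow> real"
  assumes [measurable]: "h \<in> borel_measurable borel"
  shows "(\<integral>t. (\<bar>t\<bar> * indicator {-1..1} t) * h (t\<^sup>2) \<partial>lborel) = (\<integral>s. indicator {0..1} s * h s \<partial>lborel)"
    and "integrable lborel (\<lambda>t. (\<bar>t\<bar> * indicator {-1..1} t) * h (t\<^sup>2))
      \<longleftrightarrow> integrable lborel (\<lambda>s. indicator {0..1} s * h s)"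
proof -
  let ?M = "density lborel (\<lambda>t. ennreal (\<bar>t\<bar> * indicator {-1..1} t))"
  let ?N = "density lborel (\<lambda>s::real. ennreal (indicator {0..1} s))"
  have "(\<integral>s. h s \<partial>?N) = (\<integral>s. indicator {0..1} s * h s \<partial>lborel)"
    by (subst integral_density) auto
  moreover have "(\<integral>s. h s \<partial>?N) = (\<integral>t. h (t\<^sup>2) \<partial>?M)"
    by (subst distr_square[symmetric], subst integral_distr) auto
  moreover have "\<dots> = (\<integral>t. (\<bar>t\<bar> * indicator {-1..1} t) * h (t\<^sup>2) \<partial>lborel)"
    by (subst integral_density) auto
  ultimately show "(\<integral>t. (\<bar>t\<bar> * indicator {-1..1} t) * h (t\<^sup>2) \<partial>lborel) = (\<integral>s. indicator {0..1} s * h s \<partial>lborel)"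
    by simp
  have "integrable ?N h \<longleftrightarrow> integrable lborel (\<lambda>s. indicator {0..1} s * h s)"
    by (subst integrable_density) auto
  moreover have "integrable ?N h \<longleftrightarrow> integrable ?M (\<lambda>t. h (t\<^sup>2))"
    by (subst distr_square[symmetric], subst integrable_distr_eq) auto
  moreover have "\<dots> \<longleftrightarrow> integrable lborel (\<lambda>t. (\<bar>t\<bar> * indicator {-1..1} t) * h (t\<^sup>2))"
    by (subst integrable_density) auto
  ultimately show "integrable lborel (\<lambda>t. (\<bar>t\<bar> * indicator {-1..1} t) * h (t\<^sup>2))
      \<longleftrightarrow> integrable lborel (\<lambda>s. indicator {0..1} s * h s)"
    by simp
qed

interpretation lborel_product: product_sigma_finite "\<lambda>_::nat. lborel :: real measure"
  by standard

text \<open>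
  Fubini reduces this to the one-dimensional substitution.
\<close>

lemma nn_integral_PiM_square:
  fixes F :: "(nat \<Rightarrow> real) \<Rightarrow> ennreal"
  assumes "finite I" "F \<in> borel_measurable (Pi\<^sub>M I (\<lambda>_. lborel))"
  shows "(\<integral>\<^sup>+x. F (\<lambda>i\<in>I. (x i)\<^sup>2) * (\<Prod>i\<in>I. ennreal (\<bar>x i\<bar> * indicator {-1..1} (x i))) \<partial>Pi\<^sub>M I (\<lambda>_. lborel))
     = (\<integral>\<^sup>+s. F s * (\<Prod>i\<in>I. indicator {0..1} (s i)) \<partial>Pi\<^sub>M I (\<lambda>_. lborel))"
  using assms
proof (induction I arbitrary: F rule: finite_induct)
  case empty
  then show ?case by (simp add: lborel_product.nn_integral_empty PiM_empty nn_integral_count_space_finite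
    restrict_def)
next
  case (insert j I)
  note [measurable] = insert.prems
  let ?w = "\<lambda>t::real. ennreal (\<bar>t\<bar> * indicator {-1..1} t)"
  let ?sq = "\<lambda>J x. \<lambda>i\<in>J. (x i)\<^sup>2 :: real"
  \<comment> \<open>The integral over the new coordinate, as a function of the squares of the old ones: it takes the
    same value before and after substituting, so the induction hypothesis applies to it.\<close>
  define G where "G z = (\<integral>\<^sup>+s. F (z(j := s)) * indicator {0..1} s \<partial>lborel)" for z
  have F2 [measurable]: "(\<lambda>p. F ((fst p)(j := snd p))) \<in> borel_measurable (Pi\<^sub>M I (\<lambda>_. lborel) \<Otimes>\<^sub>M lborel)"
    by measurable
  have G [measurable]: "G \<in> borel_measurable (Pi\<^sub>M I (\<lambda>_. lborel))"
    unfolding G_def by measurable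
  have sq [measurable]: "?sq J \<in> measurable (Pi\<^sub>M J (\<lambda>_. lborel)) (Pi\<^sub>M J (\<lambda>_. lborel))" for J :: "nat set"
    by measurable
  have upd: "?sq (insert j I) (x(j := y)) = (?sq I x)(j := y\<^sup>2)" for x :: "nat \<Rightarrow> real" and y
    using insert.hyps by (auto simp: fun_eq_iff restrict_def)
  have Fj [measurable]: "(\<lambda>s. F (z(j := s))) \<in> borel_measurable borel" if "z \<in> space (Pi\<^sub>M I (\<lambda>_. lborel))" for z
    using measurable_compose[OF measurable_component_update[OF that insert.hyps(2)] insert.prems]
    by (simp del: fun_upd_apply)
  have "(\<integral>\<^sup>+x. F (?sq (insert j I) x) * (\<Prod>i\<in>insert j I. ?w (x i)) \<partial>Pi\<^sub>M (insert j I) (\<lambda>_. lborel))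
    = (\<integral>\<^sup>+x. (\<integral>\<^sup>+y. F (?sq (insert j I) (x(j := y))) * (\<Prod>i\<in>insert j I. ?w ((x(j := y)) i)) \<partial>lborel) \<partial>Pi\<^sub>M I (\<lambda>_. lborel))"
    using insert.hyps by (intro lborel_product.product_nn_integral_insert) measurable
  also have "\<dots> = (\<integral>\<^sup>+x. G (?sq I x) * (\<Prod>i\<in>I. ?w (x i)) \<partial>Pi\<^sub>M I (\<lambda>_. lborel))"
  proof (intro nn_integral_cong)
    fix x assume x: "x \<in> space (Pi\<^sub>M I (\<lambda>_. lborel :: real measure))"
    have x': "?sq I x \<in> space (Pi\<^sub>M I (\<lambda>_. lborel :: real measure))"
      by (auto simp: space_PiM)
    have p: "(\<Prod>i\<in>insert j I. ?w ((x(j := y)) i)) = ?w y * (\<Prod>i\<in>I. ?w (x i))" for y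
      using insert.hyps by (auto intro!: arg_cong2[where f="(*)"] prod.cong)
    have "(\<integral>\<^sup>+y. F (?sq (insert j I) (x(j := y))) * (\<Prod>i\<in>insert j I. ?w ((x(j := y)) i)) \<partial>lborel)
      = (\<integral>\<^sup>+y. F ((?sq I x)(j := y\<^sup>2)) * ?w y * (\<Prod>i\<in>I. ?w (x i)) \<partial>lborel)"
      unfolding upd p by (simp only: mult_ac)
    also have "\<dots> = (\<integral>\<^sup>+y. F ((?sq I x)(j := y\<^sup>2)) * ?w y \<partial>lborel) * (\<Prod>i\<in>I. ?w (x i))"
      using Fj[OF x'] by (intro nn_integral_multc) measurable
    also have "(\<integral>\<^sup>+y. F ((?sq I x)(j := y\<^sup>2)) * ?w y \<partial>lborel) = G (?sq I x)"
      unfolding G_def by (rule nn_integral_square[OF Fj[OF x']])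
    finally show "(\<integral>\<^sup>+y. F (?sq (insert j I) (x(j := y))) * (\<Prod>i\<in>insert j I. ?w ((x(j := y)) i)) \<partial>lborel)
      = G (?sq I x) * (\<Prod>i\<in>I. ?w (x i))" .
  qed
  also have "\<dots> = (\<integral>\<^sup>+s. G s * (\<Prod>i\<in>I. indicator {0..1} (s i)) \<partial>Pi\<^sub>M I (\<lambda>_. lborel))"
    by (rule insert.IH) measurable
  also have "\<dots> = (\<integral>\<^sup>+x. (\<integral>\<^sup>+y. F (x(j := y)) * (\<Prod>i\<in>insert j I. indicator {0..1} ((x(j := y)) i)) \<partial>lborel) \<partial>Pi\<^sub>M I (\<lambda>_. lborel))"
  proof (intro nn_integral_cong)
    fix x assume x: "x \<in> space (Pi\<^sub>M I (\<lambda>_. lborel :: real measure))"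
    have p: "(\<Prod>i\<in>insert j I. indicator {0..1} ((x(j := y)) i))
      = (indicator {0..1} y :: ennreal) * (\<Prod>i\<in>I. indicator {0..1} (x i))" for y
      using insert.hyps by (auto intro!: arg_cong2[where f="(*)"] prod.cong)
    have "G x * (\<Prod>i\<in>I. indicator {0..1} (x i))
      = (\<integral>\<^sup>+y. F (x(j := y)) * indicator {0..1} y * (\<Prod>i\<in>I. indicator {0..1} (x i)) \<partial>lborel)"
      unfolding G_def using Fj[OF x]
      by (intro nn_integral_multc[symmetric] borel_measurable_times_ennreal) auto
    also have "\<dots> = (\<integral>\<^sup>+y. F (x(j := y)) * (\<Prod>i\<in>insert j I. indicator {0..1} ((x(j := y)) i)) \<partial>lborel)"
      unfolding p by (simp only: mult_ac)
    finally show "G x * (\<Prod>i\<in>I. indicator {0..1} (x i))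
      = (\<integral>\<^sup>+y. F (x(j := y)) * (\<Prod>i\<in>insert j I. indicator {0..1} ((x(j := y)) i)) \<partial>lborel)" .
  qed
  also have "\<dots> = (\<integral>\<^sup>+s. F s * (\<Prod>i\<in>insert j I. indicator {0..1} (s i)) \<partial>Pi\<^sub>M (insert j I) (\<lambda>_. lborel))"
    using insert.hyps by (intro lborel_product.product_nn_integral_insert[symmetric]) measurable
  finally show ?case .
qed

section \<open>Generalized Gegenbauer polynomials as Jacobi polynomials\<close>

definition gegenbauer_weight :: "real \<Rightarrow> real \<Rightarrow> real \<Rightarrow> real" where
  "gegenbauer_weight lam \<mu> t = indicator {-1..1} t * (\<bar>t\<bar> powr (2 * \<mu>) * (1 - t\<^sup>2) powr (lam - 1/2))"

text \<open>
  This is the form to which the substitution of squares applies. Also at \<open>t = 0\<close> both sides agree,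
  since \<open>0 powr a = 0\<close>.
\<close>

lemma gegenbauer_weight_eq:
  "gegenbauer_weight lam \<mu> t = (\<bar>t\<bar> * indicator {-1..1} t) * beta_weight (\<mu> - 1/2) (lam - 1/2) (t\<^sup>2)"
proof (cases "t = 0")
  case False
  have "\<bar>t\<bar> powr (2 * \<mu>) = \<bar>t\<bar> powr (1 + 2 * (\<mu> - 1/2))" by (simp add: algebra_simps)
  also have "\<dots> = \<bar>t\<bar> * (\<bar>t\<bar> powr 2) powr (\<mu> - 1/2)"
    using False unfolding powr_add powr_powr by simp
  also have "\<bar>t\<bar> powr 2 = t\<^sup>2" by simp
  finally have "\<bar>t\<bar> powr (2 * \<mu>) = \<bar>t\<bar> * (t\<^sup>2) powr (\<mu> - 1/2)" .
  moreover have "indicator {-1..1} t = (indicator {0..1} (t\<^sup>2) :: real)"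
    by (auto simp: indicator_def abs_square_le_1[unfolded abs_le_iff])
  ultimately show ?thesis
    by (cases "t\<^sup>2 \<in> {0..1}") (simp_all add: gegenbauer_weight_def beta_weight_def)
qed (simp add: gegenbauer_weight_def)

lemma integrable_gegenbauer_weight:
  assumes "lam > -1/2" "\<mu> > -1/2"
  shows "integrable lborel (gegenbauer_weight lam \<mu>)"
proof -
  have "(\<lambda>s. indicator {0..1} s * beta_weight a b s) = beta_weight a b" for a b
    by (auto simp: fun_eq_iff beta_weight_def indicator_def)
  then show ?thesis
    unfolding gegenbauer_weight_eq[abs_def]
    by (subst integral_square(2)) (use assms in \<open>auto intro!: integrable_beta_weight\<close>)
qed

lemma integrable_poly_gegenbauer_weight:
  assumes "lam > -1/2" "\<mu> > -1/2"
  shows "integrable lborel (\<lambda>t. poly p t * gegenbauer_weight lam \<mu> t)"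
  using integrable_gegenbauer_weight[OF assms]
  by (rule integrable_poly_mult_weight) (simp add: gegenbauer_weight_def)

lemma is_gen_gegenbauer_iff:
  "is_gen_gegenbauer lam \<mu> n p \<longleftrightarrow> degree p = n \<and> lead_coeff p > 0 \<and>
     (\<forall>q. q = 0 \<or> degree q < n \<longrightarrow> (\<integral>t. poly p t * poly q t * gegenbauer_weight lam \<mu> t \<partial>lborel) = 0)"
  unfolding is_gen_gegenbauer_def set_lebesgue_integral_def gegenbauer_weight_def
  by (simp add: mult_ac)

definition gegenbauer_jacobi :: "nat \<Rightarrow> nat \<Rightarrow> real \<Rightarrow> real \<Rightarrow> real poly" where
  "gegenbauer_jacobi e n a b = monom 1 e * pcompose (shifted_jacobi n b a) [:0, 0, 1:]"

lemma poly_gegenbauer_jacobi: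
  "poly (gegenbauer_jacobi e n a b) t = t ^ e * poly (shifted_jacobi n b a) (t\<^sup>2)"
  by (simp add: gegenbauer_jacobi_def poly_monom poly_pcompose power2_eq_square)

text \<open>
  For \<open>i + e\<close> odd the integrand is odd; for \<open>i + e\<close> even it is a function of \<open>t\<^sup>2\<close>, and the integral
  becomes a Jacobi moment on \<open>[0, 1]\<close>. The power \<open>t ^ (2 * e)\<close> raises the exponent at 0 by \<open>e\<close>.
\<close>

lemma gegenbauer_jacobi_orthogonal_power:
  assumes "lam > -1/2" "\<mu> > -1/2" "e \<in> {0, 1}" "i < 2 * n + e"
  defines "a \<equiv> \<mu> - 1/2 + real e" and "b \<equiv> lam - 1/2"
  shows "(\<integral>t. poly (gegenbauer_jacobi e n a b) t * t ^ i * gegenbauer_weight lam \<mu> t \<partial>lborel) = 0"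
    (is "(\<integral>t. ?f t \<partial>lborel) = 0")
proof (cases "even (i + e)")
  case False
  have "?f (-t) = - ?f t" for t
  proof -
    have "(-t) ^ e * (-t) ^ i = - (t ^ e * t ^ i)"
      using False unfolding power_add[symmetric] by (simp add: add.commute)
    then have neg: "(-t) ^ e * ((-t) ^ i * z) = - (t ^ e * (t ^ i * z))" for z
      by (simp add: mult.assoc[symmetric])
    have w: "gegenbauer_weight lam \<mu> (-t) = gegenbauer_weight lam \<mu> t"
      by (auto simp: gegenbauer_weight_def indicator_def)
    have "?f (-t) = (-t) ^ e * ((-t) ^ i * (poly (shifted_jacobi n b a) (t\<^sup>2) * gegenbauer_weight lam \<mu> (-t)))"
      by (simp only: poly_gegenbauer_jacobi power2_minus mult_ac)
    also have "\<dots> = - ?f t"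
      unfolding neg w by (simp only: poly_gegenbauer_jacobi mult_ac)
    finally show ?thesis .
  qed
  then have "(\<integral>t. ?f t \<partial>lborel) = (\<integral>t. - ?f t \<partial>lborel)"
    using lborel_integral_real_affine[of "-1" ?f 0] by simp
  also have "\<dots> = - (\<integral>t. ?f t \<partial>lborel)" by simp
  finally show ?thesis by simp
next
  case True
  then obtain l where i: "i = 2 * l + e" "l < n"
  proof -
    have "\<exists>l. i = 2 * l + e \<and> l < n"
      using True assms(3,4) by (intro exI[of _ "i div 2"]) (auto; presburger)
    then show thesis using that by auto
  qed
  let ?h = "\<lambda>s. poly (shifted_jacobi n b a) s * s ^ l * (s ^ e * beta_weight (\<mu> - 1/2) b s)"
  have meas [measurable]: "poly p \<in> borel_measurable borel" for p :: "real poly"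
    by (intro borel_measurable_continuous_onI continuous_intros)
  have "?f t = (\<bar>t\<bar> * indicator {-1..1} t) * ?h (t\<^sup>2)" for t
  proof -
    have "t ^ e * t ^ i = (t\<^sup>2) ^ l * (t\<^sup>2) ^ e"
      by (simp add: i power_add power_mult power_mult_distrib power2_eq_square mult_ac)
    moreover have "poly (gegenbauer_jacobi e n a b) t * t ^ i = poly (shifted_jacobi n b a) (t\<^sup>2) * (t ^ e * t ^ i)"
      by (simp only: poly_gegenbauer_jacobi mult_ac)
    ultimately have "poly (gegenbauer_jacobi e n a b) t * t ^ i = poly (shifted_jacobi n b a) (t\<^sup>2) * ((t\<^sup>2) ^ l * (t\<^sup>2) ^ e)"
      by simp
    then show ?thesis
      unfolding gegenbauer_weight_eq b_def by (simp only: mult_ac)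
  qed
  then have "(\<integral>t. ?f t \<partial>lborel) = (\<integral>t. (\<bar>t\<bar> * indicator {-1..1} t) * ?h (t\<^sup>2) \<partial>lborel)"
    by (simp only:)
  also have "\<dots> = (\<integral>s. indicator {0..1} s * ?h s \<partial>lborel)"
    by (intro integral_square) measurable
  also have "\<dots> = (\<integral>s. poly (shifted_jacobi n b a) s * poly (monom 1 l) s * beta_weight a b s \<partial>lborel)"
  proof (intro Bochner_Integration.integral_cong refl)
    fix s :: real
    have "indicator {0..1} s * (s ^ e * beta_weight (\<mu> - 1/2) b s) = beta_weight a b s"
      using assms(3) by (auto simp: beta_weight_def a_def indicator_def powr_add)
    then show "indicator {0..1} s * ?h s
       = poly (shifted_jacobi n b a) s * poly (monom 1 l) s * beta_weight a b s"
      by (simp add: poly_monom mult_ac)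
  qed
  also have "\<dots> = 0"
    using assms(1-3) i by (intro shifted_jacobi_orthogonal) (auto simp: a_def b_def degree_monom_eq)
  finally show ?thesis .
qed

lemma gegenbauer_jacobi_orthogonal:
  assumes "lam > -1/2" "\<mu> > -1/2" "e \<in> {0, 1}" "degree q < 2 * n + e"
  shows "(\<integral>t. poly (gegenbauer_jacobi e n (\<mu> - 1/2 + real e) (lam - 1/2)) t * poly q t
            * gegenbauer_weight lam \<mu> t \<partial>lborel) = 0"
proof -
  let ?g = "gegenbauer_jacobi e n (\<mu> - 1/2 + real e) (lam - 1/2)"
  have int: "integrable lborel (\<lambda>t. poly ?g t * t ^ i * gegenbauer_weight lam \<mu> t)" for i
    using integrable_poly_gegenbauer_weight[OF assms(1,2), of "?g * monom 1 i"] by (simp add: poly_monom)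
  have "poly ?g t * poly q t * gegenbauer_weight lam \<mu> t
      = (\<Sum>i\<le>degree q. coeff q i * (poly ?g t * t ^ i * gegenbauer_weight lam \<mu> t))" for t
    unfolding poly_altdef[of q] by (simp add: sum_distrib_left sum_distrib_right mult_ac)
  then have "(\<integral>t. poly ?g t * poly q t * gegenbauer_weight lam \<mu> t \<partial>lborel)
     = (\<Sum>i\<le>degree q. coeff q i * (\<integral>t. poly ?g t * t ^ i * gegenbauer_weight lam \<mu> t \<partial>lborel))"
    by (simp add: Bochner_Integration.integral_sum int)
  also have "\<dots> = 0"
    using gegenbauer_jacobi_orthogonal_power[OF assms(1-3)] assms(4) by (intro sum.neutral) auto
  finally show ?thesis .
qed

lemma gegenbauer_jacobi_degree_lead_coeff:
  assumes "a > -1" "b > -1"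
  shows "degree (gegenbauer_jacobi e n a b) = 2 * n + e"
    and "lead_coeff (gegenbauer_jacobi e n a b) > 0"
proof -
  let ?p = "pcompose (shifted_jacobi n b a) [:0, 0, 1:]"
  have deg: "degree ?p = 2 * n"
    by (simp add: degree_pcompose degree_shifted_jacobi assms)
  have lc: "lead_coeff ?p = jacobi_coeff n b a n"
    by (subst lead_coeff_comp) (simp_all add: degree_shifted_jacobi assms coeff_shifted_jacobi_top)
  have pos: "jacobi_coeff n b a n > 0" using assms by (intro jacobi_coeff_top_pos)
  then have "?p \<noteq> 0" using lc by auto
  then show "degree (gegenbauer_jacobi e n a b) = 2 * n + e"
    by (simp add: gegenbauer_jacobi_def degree_mult_eq degree_monom_eq deg)
  show "lead_coeff (gegenbauer_jacobi e n a b) > 0"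
    using lc pos by (simp add: gegenbauer_jacobi_def lead_coeff_mult degree_monom_eq)
qed

text \<open>
  Uniqueness of orthogonal polynomials: subtracting the multiple with the same leading coefficient
  leaves a polynomial \<open>q\<close> of lower degree that is orthogonal to itself.
\<close>

lemma gen_gegenbauer_eq_jacobi:
  assumes "lam > -1/2" "\<mu> > -1/2" "e \<in> {0, 1}" and p: "is_gen_gegenbauer lam \<mu> (2 * n + e) p"
  obtains c where "c > 0" "p = smult c (gegenbauer_jacobi e n (\<mu> - 1/2 + real e) (lam - 1/2))"
proof -
  let ?g = "gegenbauer_jacobi e n (\<mu> - 1/2 + real e) (lam - 1/2)"
  let ?N = "2 * n + e" and ?w = "gegenbauer_weight lam \<mu>"
  have ab: "\<mu> - 1/2 + real e > -1" "lam - 1/2 > -1" using assms(1-3) by auto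
  note g = gegenbauer_jacobi_degree_lead_coeff[OF ab, of e n]
  note pp = p[unfolded is_gen_gegenbauer_iff]
  \<comment> \<open>With this factor the leading coefficients of \<open>p\<close> and \<open>c * ?g\<close> agree.\<close>
  define c where "c = lead_coeff p / lead_coeff ?g"
  have c: "c > 0" unfolding c_def using pp g(2) by (intro divide_pos_pos) auto
  define q where "q = p - smult c ?g"
  have low: "q = 0 \<or> degree q < ?N"
  proof -
    have "degree q \<le> ?N" unfolding q_def
      using pp g c by (intro degree_diff_le) auto
    moreover have "coeff q ?N = 0"
      using pp g c by (simp add: q_def c_def)
    ultimately show ?thesis by (metis leading_coeff_0_iff order_le_less)
  qed
  have "q = 0"
  proof (rule ccontr)
    assume q0: "q \<noteq> 0"
    then have dq: "degree q < ?N" using low by auto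
    have 1: "(\<integral>t. poly p t * poly q t * ?w t \<partial>lborel) = 0" using pp low by blast
    have 2: "(\<integral>t. poly ?g t * poly q t * ?w t \<partial>lborel) = 0"
      by (rule gegenbauer_jacobi_orthogonal[OF assms(1-3) dq])
    have i1: "integrable lborel (\<lambda>t. poly p t * poly q t * ?w t)"
      using integrable_poly_gegenbauer_weight[OF assms(1,2), of "p * q"] by simp
    have i2: "integrable lborel (\<lambda>t. poly ?g t * poly q t * ?w t)"
      using integrable_poly_gegenbauer_weight[OF assms(1,2), of "?g * q"] by simp
    have i3: "integrable lborel (\<lambda>t. (poly q t)\<^sup>2 * ?w t)"
      using integrable_poly_gegenbauer_weight[OF assms(1,2), of "q ^ 2"] by simp
    have "(poly q t)\<^sup>2 * ?w t = poly p t * poly q t * ?w t - c * (poly ?g t * poly q t * ?w t)" for t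
      by (simp add: q_def power2_eq_square algebra_simps)
    then have "(\<integral>t. (poly q t)\<^sup>2 * ?w t \<partial>lborel) = 0"
      using 1 2 i1 i2 by simp
    moreover have "(\<integral>t. (poly q t)\<^sup>2 * ?w t \<partial>lborel) > 0"
    proof (rule integral_square_poly_weight_pos[OF i3 _ _ q0])
      show "?w t \<ge> 0" for t by (simp add: gegenbauer_weight_def)
      show "?w t > 0" if "0 < t" "t < 1" for t
        using that power_strict_mono[of t 1 2] by (simp add: gegenbauer_weight_def)
    qed
    ultimately show False by simp
  qed
  then show thesis using c that[of c] by (simp add: q_def)
qed

section \<open>Finite expansions\<close>

definition in_span :: "'x set \<Rightarrow> 'i set \<Rightarrow> ('i \<Rightarrow> 'x \<Rightarrow> real) \<Rightarrow> ('x \<Rightarrow> real) \<Rightarrow> bool" where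
  "in_span D I B f \<longleftrightarrow> (\<exists>c. \<forall>x\<in>D. f x = (\<Sum>i\<in>I. c i * B i x))"

lemma in_span_cong: "in_span D I B g \<Longrightarrow> (\<And>x. x \<in> D \<Longrightarrow> f x = g x) \<Longrightarrow> in_span D I B f"
  by (auto simp: in_span_def)

lemma in_span_base:
  assumes "finite I" "i \<in> I"
  shows "in_span D I B (B i)"
proof -
  have "B i x = (\<Sum>j\<in>I. (if j = i then 1 else 0) * B j x)" for x
    using assms by (simp add: if_distrib[of "\<lambda>c. c * _"] cong: if_cong)
  then show ?thesis unfolding in_span_def by (intro exI[of _ "\<lambda>j. if j = i then 1 else 0"]) simp
qed

lemma in_span_add:
  assumes "in_span D I B f" "in_span D I B g"
  shows "in_span D I B (\<lambda>x. f x + g x)"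
proof -
  obtain c c' where "\<forall>x\<in>D. f x = (\<Sum>i\<in>I. c i * B i x)" "\<forall>x\<in>D. g x = (\<Sum>i\<in>I. c' i * B i x)"
    using assms unfolding in_span_def by blast
  then show ?thesis unfolding in_span_def
    by (intro exI[of _ "\<lambda>i. c i + c' i"]) (auto simp: distrib_right sum.distrib)
qed

lemma in_span_scale:
  assumes "in_span D I B f"
  shows "in_span D I B (\<lambda>x. a * f x)"
proof -
  obtain c where "\<forall>x\<in>D. f x = (\<Sum>i\<in>I. c i * B i x)"
    using assms unfolding in_span_def by blast
  then show ?thesis unfolding in_span_def
    by (intro exI[of _ "\<lambda>i. a * c i"]) (auto simp: sum_distrib_left mult_ac)
qed

lemma in_span_sum:
  assumes "finite K" "\<And>k. k \<in> K \<Longrightarrow> in_span D I B (f k)"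
  shows "in_span D I B (\<lambda>x. \<Sum>k\<in>K. f k x)"
  using assms
proof (induction K rule: finite_induct)
  case empty
  show ?case unfolding in_span_def by (intro exI[of _ "\<lambda>_. 0"]) auto
next
  case (insert k K)
  then have "in_span D I B (\<lambda>x. f k x + (\<Sum>k\<in>K. f k x))"
    by (intro in_span_add) auto
  then show ?case using insert.hyps by simp
qed

text \<open>
  A coefficient function given by a definite description is known once an expansion exists and the
  family is linearly independent on the domain.
\<close>

lemma expansion_coeffs_eqI:
  assumes "\<And>i. i \<notin> I \<Longrightarrow> c i = 0" "\<And>x. x \<in> D \<Longrightarrow> f x = (\<Sum>i\<in>I. c i * B i x)"
    and indep: "\<And>c' i. (\<And>x. x \<in> D \<Longrightarrow> (\<Sum>i\<in>I. c' i * B i x) = 0) \<Longrightarrow> i \<in> I \<Longrightarrow> c' i = 0"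
  shows "expansion_coeffs D I B f = c"
  unfolding expansion_coeffs_def
proof (rule the_equality)
  show "(\<forall>i. i \<notin> I \<longrightarrow> c i = 0) \<and> (\<forall>x\<in>D. f x = (\<Sum>i\<in>I. c i * B i x))"
    using assms by blast
next
  fix c' assume c': "(\<forall>i. i \<notin> I \<longrightarrow> c' i = 0) \<and> (\<forall>x\<in>D. f x = (\<Sum>i\<in>I. c' i * B i x))"
  have "c' i - c i = 0" if "i \<in> I" for i
  proof (rule indep[of "\<lambda>i. c' i - c i"])
    fix x assume "x \<in> D"
    then have "(\<Sum>i\<in>I. c' i * B i x) = (\<Sum>i\<in>I. c i * B i x)" using assms(2) c' by metis
    then show "(\<Sum>i\<in>I. (c' i - c i) * B i x) = 0"
      by (simp add: left_diff_distrib sum_subtractf)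
  qed fact
  then show "c' = c" using assms(1) c' by (metis eq_iff_diff_eq_0 ext)
qed

section \<open>Polynomial functions\<close>

text \<open>
  Polynomial functions of degree at most \<open>n\<close> in the first \<open>d\<close> coordinates. An inductive
  characterization replaces multivariate polynomials: every closure property needed follows by rule
  induction.
\<close>

inductive polyfun :: "nat \<Rightarrow> nat \<Rightarrow> ((nat \<Rightarrow> real) \<Rightarrow> real) \<Rightarrow> bool" for d where
  const: "polyfun d n (\<lambda>x. c)"
| coord: "i \<in> {1..d} \<Longrightarrow> polyfun d n f \<Longrightarrow> polyfun d (Suc n) (\<lambda>x. x i * f x)"
| add: "polyfun d n f \<Longrightarrow> polyfun d n g \<Longrightarrow> polyfun d n (\<lambda>x. f x + g x)"

lemma polyfun_mono: "polyfun d n f \<Longrightarrow> n \<le> m \<Longrightarrow> polyfun d m f"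
proof (induction arbitrary: m rule: polyfun.induct)
  case (coord i n f)
  then obtain m' where "m = Suc m'" "n \<le> m'" by (cases m) auto
  then show ?case using coord by (auto intro: polyfun.coord)
qed (auto intro: polyfun.intros)

lemma polyfun_scale: "polyfun d n f \<Longrightarrow> polyfun d n (\<lambda>x. a * f x)"
proof (induction rule: polyfun.induct)
  case (coord i n f)
  then have "polyfun d (Suc n) (\<lambda>x. x i * (a * f x))" by (intro polyfun.coord)
  then show ?case by (simp add: mult_ac)
qed (auto intro: polyfun.intros simp: distrib_left)

lemma polyfun_mult:
  "polyfun d m f \<Longrightarrow> polyfun d n g \<Longrightarrow> polyfun d (m + n) (\<lambda>x. f x * g x)"
proof (induction rule: polyfun.induct)
  case (const m c)
  then show ?case by (intro polyfun_scale polyfun_mono[OF const]) auto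
next
  case (coord i n' f)
  then show ?case
    using polyfun.coord[OF coord.hyps(1) coord.IH[OF coord.prems]] by (simp add: mult_ac)
qed (auto intro: polyfun.intros simp: distrib_right)

lemma polyfun_coord: "i \<in> {1..d} \<Longrightarrow> polyfun d 1 (\<lambda>x. x i)"
  using polyfun.coord[of i d 0 "\<lambda>_. 1"] polyfun.const by simp

lemma polyfun_power: "polyfun d m f \<Longrightarrow> polyfun d (m * k) (\<lambda>x. f x ^ k)"
proof (induction k)
  case (Suc k)
  then show ?case using polyfun_mult[of d m f "m * k"] by simp
qed (simp add: polyfun.const)

lemma polyfun_sum:
  assumes "finite K" "\<And>k. k \<in> K \<Longrightarrow> polyfun d n (f k)"
  shows "polyfun d n (\<lambda>x. \<Sum>k\<in>K. f k x)"
  using assms by (induction K rule: finite_induct) (auto intro: polyfun.intros)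

lemma polyfun_prod:
  assumes "finite K" "\<And>k. k \<in> K \<Longrightarrow> polyfun d (n k) (f k)"
  shows "polyfun d (\<Sum>k\<in>K. n k) (\<lambda>x. \<Prod>k\<in>K. f k x)"
  using assms by (induction K rule: finite_induct) (auto intro: polyfun.const polyfun_mult)

lemma polyfun_compose_perm:
  assumes "polyfun d n f" "\<sigma> permutes {1..d}"
  shows "polyfun d n (\<lambda>x. f (\<lambda>i\<in>{1..d}. x (\<sigma> i)))"
  using assms
proof (induction rule: polyfun.induct)
  case (coord i n f)
  then have "\<sigma> i \<in> {1..d}" using permutes_in_image by metis
  then show ?case using polyfun.coord coord by simp
qed (auto intro: polyfun.intros)

lemma polyfun_measurable: "polyfun d n f \<Longrightarrow> f \<in> borel_measurable (lborel_pow d)"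
proof (induction rule: polyfun.induct)
  case (coord i n f)
  then have "(\<lambda>x. x i) \<in> borel_measurable (lborel_pow d)"
    using measurable_component_singleton[of i "{1..d}" "\<lambda>_. lborel"] by simp
  with coord show ?case by measurable
qed auto

text \<open>
  The simplex without the requirement that points be extensional. Then a point of the simplex in
  dimension \<open>d + 1\<close> is also one in dimension \<open>d\<close>, which is what inductions on the dimension need.
\<close>

definition solid_simplex :: "nat \<Rightarrow> (nat \<Rightarrow> real) set" where
  "solid_simplex d = {x. (\<forall>i\<in>{1..d}. 0 \<le> x i) \<and> (\<Sum>i=1..d. x i) \<le> 1}"

lemma std_simplex_subset: "std_simplex d \<subseteq> solid_simplex d"
  by (auto simp: std_simplex_def solid_simplex_def)

lemma solid_simplex_le_1:
  assumes "x \<in> solid_simplex d" "i \<in> {1..d}"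
  shows "x i \<le> 1"
proof -
  have "x i \<le> (\<Sum>i=1..d. x i)" using assms by (intro member_le_sum) (auto simp: solid_simplex_def)
  then show ?thesis using assms by (auto simp: solid_simplex_def)
qed

lemma solid_simplex_partial_sum:
  assumes "x \<in> solid_simplex d" "j \<in> {1..d}"
  shows "(\<Sum>i=1..<j. x i) + x j \<le> 1"
proof -
  have "(\<Sum>i=1..<j. x i) + x j = (\<Sum>i\<in>{1..j}. x i)"
    using assms by (simp add: atLeastLessThanSuc_atLeastAtMost[symmetric] sum.atLeastLessThan_Suc)
  also have "\<dots> \<le> (\<Sum>i=1..d. x i)" using assms by (intro sum_mono2) (auto simp: solid_simplex_def)
  finally show ?thesis using assms by (auto simp: solid_simplex_def)
qed

lemma solid_simplex_Suc:
  assumes "x \<in> solid_simplex (Suc d)"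
  shows "x \<in> solid_simplex d" "0 \<le> x (Suc d)" "x (Suc d) \<le> 1 - (\<Sum>i=1..d. x i)"
proof -
  have *: "\<And>i. i \<in> {1..Suc d} \<Longrightarrow> 0 \<le> x i" "(\<Sum>i=1..d. x i) + x (Suc d) \<le> 1"
    using assms by (auto simp: solid_simplex_def)
  show last: "0 \<le> x (Suc d)" using *(1)[of "Suc d"] by simp
  have "(\<Sum>i=1..d. x i) \<le> 1" using last *(2) by linarith
  then show "x \<in> solid_simplex d" using *(1) by (auto simp: solid_simplex_def)
  show "x (Suc d) \<le> 1 - (\<Sum>i=1..d. x i)" using *(2) by simp
qed

lemma polyfun_bounded:
  "polyfun d n f \<Longrightarrow> \<exists>M. \<forall>x\<in>solid_simplex d. \<bar>f x\<bar> \<le> M"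
proof (induction rule: polyfun.induct)
  case (coord i n f)
  then obtain M where M: "\<And>x. x \<in> solid_simplex d \<Longrightarrow> \<bar>f x\<bar> \<le> M" by auto
  have "\<bar>x i * f x\<bar> \<le> 1 * M" if "x \<in> solid_simplex d" for x
    unfolding abs_mult
    using M[OF that] solid_simplex_le_1[OF that coord.hyps(1)] that coord.hyps(1)
    by (intro mult_mono) (auto simp: solid_simplex_def)
  then show ?case by blast
next
  case (add n f g)
  then obtain M N where "\<And>x. x \<in> solid_simplex d \<Longrightarrow> \<bar>f x\<bar> \<le> M" "\<And>x. x \<in> solid_simplex d \<Longrightarrow> \<bar>g x\<bar> \<le> N"
    by blast
  then have "\<bar>f x + g x\<bar> \<le> M + N" if "x \<in> solid_simplex d" for x
    using that abs_triangle_ineq[of "f x" "g x"] by fastforce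
  then show ?case by blast
qed auto

text \<open>
  The polynomial \<open>r ^ n * p (x / r)\<close> in \<open>x\<close> and \<open>r\<close>, which has no division. Each factor of a Jacobi
  polynomial on the simplex has this form, with \<open>r\<close> the room \<open>1 - x\<^sub>1 - \<dots>\<close> left by the earlier
  coordinates.
\<close>

definition homogenize :: "real poly \<Rightarrow> nat \<Rightarrow> real \<Rightarrow> real \<Rightarrow> real" where
  "homogenize p n x r = (\<Sum>i\<le>n. coeff p i * x ^ i * r ^ (n - i))"

text \<open>
  On the simplex \<open>r = 0\<close> forces \<open>x = 0\<close>, and then both sides are 0 or, for \<open>n = 0\<close>, the constant \<open>p\<close>;
  the convention \<open>x / 0 = 0\<close> does no harm.
\<close>

lemma homogenize_eq:
  assumes "degree p \<le> n" "r = 0 \<Longrightarrow> x = 0"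
  shows "homogenize p n x r = r ^ n * poly p (x / r)"
proof (cases "r = 0")
  case False
  have "poly p (x / r) = (\<Sum>i\<le>n. coeff p i * (x / r) ^ i)"
    unfolding poly_altdef using assms(1) by (intro sum.mono_neutral_left) (auto simp: coeff_eq_0)
  then have "r ^ n * poly p (x / r) = (\<Sum>i\<le>n. r ^ n * (coeff p i * (x / r) ^ i))"
    by (simp add: sum_distrib_left)
  also have "\<dots> = homogenize p n x r" unfolding homogenize_def
  proof (intro sum.cong refl)
    fix i assume "i \<in> {..n}"
    then have "r ^ n = r ^ i * r ^ (n - i)" by (simp flip: power_add)
    then show "r ^ n * (coeff p i * (x / r) ^ i) = coeff p i * x ^ i * r ^ (n - i)"
      using False by (simp add: power_divide)
  qed
  finally show ?thesis by simp
next
  case True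
  show ?thesis
  proof (cases "n = 0")
    case n: True
    then have "poly p z = coeff p 0" for z
      using assms(1) by (simp add: poly_altdef)
    then show ?thesis using n by (simp add: homogenize_def)
  next
    case n: False
    have "x ^ i * r ^ (n - i) = 0" if "i \<le> n" for i
      using n True assms(2) that by (cases "i = 0") auto
    then have "homogenize p n x r = 0" unfolding homogenize_def
      by (intro sum.neutral) (auto simp: mult.assoc)
    then show ?thesis using n True by simp
  qed
qed

text \<open>
  The parameter \<open>a\<^sub>j\<close> of the factor number \<open>j\<close> of a Jacobi polynomial on the simplex. The same number,
  for \<open>\<kappa> + \<epsilon>\<close>, is the parameter \<open>\<lambda>\<^sub>j\<close> of the ball polynomial with index \<open>2 * \<nu> + \<epsilon>\<close>.
\<close>

definition simplex_index :: "nat \<Rightarrow> (nat \<Rightarrow> real) \<Rightarrow> (nat \<Rightarrow> nat) \<Rightarrow> nat \<Rightarrow> real" where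
  "simplex_index d \<kappa> \<nu> j =
     (\<Sum>i=j+1..d+1. \<kappa> i) + 2 * real (\<Sum>i=j+1..d. \<nu> i) + real d - real j"

text \<open>
  The sum over \<open>\<kappa>\<close> has \<open>d + 1 - j\<close> terms, each greater than -1.
\<close>

lemma simplex_index_gt:
  assumes "\<forall>i\<in>{1..d+1}. \<kappa> i > -1" "j \<in> {1..d}"
  shows "simplex_index d \<kappa> \<nu> j > -1"
proof -
  have "(\<Sum>i=j+1..d+1. -1 :: real) < (\<Sum>i=j+1..d+1. \<kappa> i)"
    using assms by (intro sum_strict_mono) auto
  then have "- (real d + 1 - real j) < (\<Sum>i=j+1..d+1. \<kappa> i)"
    using assms(2) by (simp add: of_nat_diff)
  then show ?thesis using of_nat_0_le_iff[of "\<Sum>i=j+1..d. \<nu> i", where 'a = real]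
    unfolding simplex_index_def by linarith
qed

lemma simplex_poly_eq:
  "simplex_poly d \<kappa> \<nu> x = (\<Prod>j=1..d. (1 - (\<Sum>i=1..<j. x i)) ^ \<nu> j
     * poly (shifted_jacobi (\<nu> j) (simplex_index d \<kappa> \<nu> j) (\<kappa> j)) (x j / (1 - (\<Sum>i=1..<j. x i))))"
  unfolding simplex_poly_def poly_shifted_jacobi simplex_index_def by simp

lemma simplex_poly_homogenize:
  assumes "\<forall>i\<in>{1..d+1}. \<kappa> i > -1" "x \<in> solid_simplex d"
  shows "simplex_poly d \<kappa> \<nu> x = (\<Prod>j=1..d. homogenize
    (shifted_jacobi (\<nu> j) (simplex_index d \<kappa> \<nu> j) (\<kappa> j)) (\<nu> j) (x j) (1 - (\<Sum>i=1..<j. x i)))"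
  unfolding simplex_poly_eq
proof (intro prod.cong refl homogenize_eq[symmetric])
  fix j assume j: "j \<in> {1..d}"
  have "simplex_index d \<kappa> \<nu> j > -1" "\<kappa> j > -1" using simplex_index_gt[OF assms(1) j] assms(1) j by auto
  then show "degree (shifted_jacobi (\<nu> j) (simplex_index d \<kappa> \<nu> j) (\<kappa> j)) \<le> \<nu> j"
    by (simp add: degree_shifted_jacobi)
  show "x j = 0" if "1 - (\<Sum>i=1..<j. x i) = 0"
    using that solid_simplex_partial_sum[OF assms(2) j] assms(2) j by (auto simp: solid_simplex_def intro!: antisym)
qed

lemma polyfun_homogenize:
  assumes "polyfun d 1 f" "polyfun d 1 g"
  shows "polyfun d n (\<lambda>x. homogenize p n (f x) (g x))"
  unfolding homogenize_def
proof (intro polyfun_sum)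
  fix i assume i: "i \<in> {..n}"
  have "polyfun d (1 * i + 1 * (n - i)) (\<lambda>x. f x ^ i * g x ^ (n - i))"
    using assms by (intro polyfun_mult polyfun_power)
  then show "polyfun d n (\<lambda>x. coeff p i * f x ^ i * g x ^ (n - i))"
    using i polyfun_scale[of d n _ "coeff p i"] by (simp add: mult.assoc)
qed simp

lemma polyfun_one_minus_sum:
  assumes "J \<subseteq> {1..d}"
  shows "polyfun d 1 (\<lambda>x. 1 - (\<Sum>i\<in>J. x i))"
proof -
  have "polyfun d 1 (\<lambda>x. 1 + (-1) * (\<Sum>i\<in>J. x i))"
    using assms finite_subset[OF assms]
    by (intro polyfun.add polyfun.const polyfun_scale polyfun_sum polyfun_coord) auto
  then show ?thesis by simp
qed

lemma simplex_poly_polyfun: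
  assumes "\<forall>i\<in>{1..d+1}. \<kappa> i > -1"
  obtains p where "polyfun d (\<Sum>i=1..d. \<nu> i) p"
    "\<And>x. x \<in> solid_simplex d \<Longrightarrow> simplex_poly d \<kappa> \<nu> x = p x"
proof
  show "polyfun d (\<Sum>i=1..d. \<nu> i) (\<lambda>x. \<Prod>j=1..d. homogenize
    (shifted_jacobi (\<nu> j) (simplex_index d \<kappa> \<nu> j) (\<kappa> j)) (\<nu> j) (x j) (1 - (\<Sum>i=1..<j. x i)))"
    by (intro polyfun_prod polyfun_homogenize polyfun_coord polyfun_one_minus_sum) auto
qed (use simplex_poly_homogenize[OF assms] in auto)

section \<open>The Jacobi basis spans the polynomials\<close>

text \<open>
  Integrating out the last of \<open>d + 1\<close> coordinates turns the exponents \<open>a, b\<close> of the last coordinate and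
  of the remaining room \<open>r\<close> into the exponent \<open>a + b + 1\<close> of \<open>r\<close>; a factor \<open>r ^ m\<close> of the integrand
  raises it further by \<open>m\<close>.
\<close>

definition merge_last :: "nat \<Rightarrow> (nat \<Rightarrow> real) \<Rightarrow> real \<Rightarrow> nat \<Rightarrow> real" where
  "merge_last d \<kappa> m = \<kappa>(Suc d := \<kappa> (Suc d) + \<kappa> (Suc (Suc d)) + 1 + m)"

lemma merge_last_gt:
  assumes "\<forall>i\<in>{1..Suc d+1}. \<kappa> i > -1" "m \<ge> 0"
  shows "\<forall>i\<in>{1..d+1}. merge_last d \<kappa> m i > -1"
proof
  fix i assume i: "i \<in> {1..d+1}"
  have "\<kappa> (Suc d) > -1" "\<kappa> (Suc (Suc d)) > -1" using assms(1) by auto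
  then have "\<kappa> (Suc d) + \<kappa> (Suc (Suc d)) + 1 + m > -1" using assms(2) by linarith
  then show "merge_last d \<kappa> m i > -1"
    using assms i by (cases "i = Suc d") (auto simp: merge_last_def)
qed

lemma simplex_index_merge_last:
  assumes "j \<le> d"
  shows "simplex_index (Suc d) \<kappa> \<nu> j = simplex_index d (merge_last d \<kappa> (2 * real (\<nu> (Suc d)))) \<nu> j"
proof -
  have "(\<Sum>i=j+1..d. merge_last d \<kappa> (2 * real (\<nu> (Suc d))) i) = (\<Sum>i=j+1..d. \<kappa> i)"
    by (intro sum.cong) (auto simp: merge_last_def)
  then show ?thesis using assms
    by (simp add: simplex_index_def) (simp add: merge_last_def)
qed

text \<open>
  The parameters \<open>a\<^sub>j\<close> for \<open>j \<le> d\<close> see the last exponent, the last degree and the dimension only through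
  \<open>merge_last\<close>. Splitting off the last factor therefore leaves a Jacobi polynomial of the same kind,
  and every later induction on the dimension rests on this.
\<close>

lemma simplex_poly_Suc:
  "simplex_poly (Suc d) \<kappa> \<nu> x = simplex_poly d (merge_last d \<kappa> (2 * real (\<nu> (Suc d)))) \<nu> x *
     ((1 - (\<Sum>i=1..d. x i)) ^ \<nu> (Suc d) *
       poly (shifted_jacobi (\<nu> (Suc d)) (\<kappa> (Suc (Suc d))) (\<kappa> (Suc d)))
         (x (Suc d) / (1 - (\<Sum>i=1..d. x i))))"
proof -
  have "simplex_index (Suc d) \<kappa> \<nu> (Suc d) = \<kappa> (Suc (Suc d))"
    by (simp add: simplex_index_def)
  moreover have "(\<Sum>i=1..<Suc d. x i) = (\<Sum>i=1..d. x i)"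
    by (simp only: atLeastLessThanSuc_atLeastAtMost)
  moreover have "(\<Prod>j=1..d. (1 - (\<Sum>i=1..<j. x i)) ^ \<nu> j
      * poly (shifted_jacobi (\<nu> j) (simplex_index (Suc d) \<kappa> \<nu> j) (\<kappa> j)) (x j / (1 - (\<Sum>i=1..<j. x i))))
    = simplex_poly d (merge_last d \<kappa> (2 * real (\<nu> (Suc d)))) \<nu> x"
    unfolding simplex_poly_eq
    by (intro prod.cong refl) (auto simp: simplex_index_merge_last merge_last_def)
  ultimately show ?thesis
    unfolding simplex_poly_eq[of "Suc d"] by (subst prod.nat_ivl_Suc') (auto simp: mult.commute)
qed

lemma simplex_poly_cong:
  assumes "\<And>i. i \<in> {1..d} \<Longrightarrow> x i = y i" "\<And>i. i \<in> {1..d} \<Longrightarrow> \<nu> i = \<mu> i"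
  shows "simplex_poly d \<kappa> \<nu> x = simplex_poly d \<kappa> \<mu> y"
  unfolding simplex_poly_def
proof (intro prod.cong refl)
  fix j assume j: "j \<in> {1..d}"
  then have *: "(\<Sum>i=1..<j. x i) = (\<Sum>i=1..<j. y i)" "(\<Sum>i=j+1..d. \<nu> i) = (\<Sum>i=j+1..d. \<mu> i)"
    "x j = y j" "\<nu> j = \<mu> j"
    using assms by (auto intro!: sum.cong)
  show "(1 - (\<Sum>i=1..<j. x i)) ^ \<nu> j
        * jacobi (\<nu> j)
            ((\<Sum>i=j+1..d+1. \<kappa> i) + 2 * real (\<Sum>i=j+1..d. \<nu> i) + real d - real j) (\<kappa> j)
            (2 * x j / (1 - (\<Sum>i=1..<j. x i)) - 1)
      = (1 - (\<Sum>i=1..<j. y i)) ^ \<mu> j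
        * jacobi (\<mu> j)
            ((\<Sum>i=j+1..d+1. \<kappa> i) + 2 * real (\<Sum>i=j+1..d. \<mu> i) + real d - real j) (\<kappa> j)
            (2 * y j / (1 - (\<Sum>i=1..<j. y i)) - 1)"
    unfolding * by simp
qed

definition multi_indices_upto :: "nat \<Rightarrow> nat \<Rightarrow> (nat \<Rightarrow> nat) set" where
  "multi_indices_upto d n = {\<alpha> \<in> multi_indices d. (\<Sum>i=1..d. \<alpha> i) \<le> n}"

lemma finite_multi_indices_upto [simp]: "finite (multi_indices_upto d n)"
proof (rule finite_subset)
  show "finite {f. \<forall>x. (x \<in> {1..d} \<longrightarrow> f x \<in> {..n}) \<and> (x \<notin> {1..d} \<longrightarrow> f x = (0::nat))}"
    by (intro finite_set_of_finite_funs) auto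
  show "multi_indices_upto d n \<subseteq> {f. \<forall>x. (x \<in> {1..d} \<longrightarrow> f x \<in> {..n}) \<and> (x \<notin> {1..d} \<longrightarrow> f x = (0::nat))}"
  proof safe
    fix f x assume f: "f \<in> multi_indices_upto d n" and x: "x \<in> {1..d}"
    have "f x \<le> (\<Sum>i=1..d. f i)" using x by (intro member_le_sum) auto
    then show "f x \<le> n" using f by (auto simp: multi_indices_upto_def)
  qed (auto simp: multi_indices_upto_def multi_indices_def)
qed

lemma finite_multi_indices_deg [simp]: "finite (multi_indices_deg d n)"
  by (rule finite_subset[OF _ finite_multi_indices_upto[of d n]])
     (auto simp: multi_indices_deg_def multi_indices_upto_def)

text \<open>
  A polynomial in \<open>d + 1\<close> variables is a polynomial in the last one whose coefficients depend on the
  others, with the total degree bounded.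
\<close>

lemma polyfun_decompose_last:
  assumes "polyfun (Suc d) n f"
  shows "\<exists>g. (\<forall>k\<le>n. polyfun d (n - k) (g k)) \<and> (\<forall>x. f x = (\<Sum>k\<le>n. g k x * x (Suc d) ^ k))"
  using assms
proof (induction rule: polyfun.induct)
  case (const n c)
  have "c = (\<Sum>k\<le>n. (if k = 0 then c else 0) * x (Suc d) ^ k)" for x :: "nat \<Rightarrow> real"
    by (simp add: if_distrib[of "\<lambda>c. c * _"] cong: if_cong)
  then show ?case
    by (intro exI[of _ "\<lambda>k x. if k = 0 then c else 0"] conjI allI impI polyfun.const)
next
  case (coord i n f)
  then obtain g where g: "\<And>k. k \<le> n \<Longrightarrow> polyfun d (n - k) (g k)"
    "\<And>x. f x = (\<Sum>k\<le>n. g k x * x (Suc d) ^ k)" by blast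
  show ?case
  proof (cases "i = Suc d")
    case False
    define h where "h k = (if k \<le> n then (\<lambda>x. x i * g k x) else (\<lambda>x. 0))" for k
    have "polyfun d (Suc n - k) (h k)" if "k \<le> Suc n" for k
      using polyfun.coord[of i d "n - k" "g k"] False coord.hyps(1) g(1)[of k]
      by (auto simp: h_def Suc_diff_le polyfun.const)
    moreover have "x i * f x = (\<Sum>k\<le>Suc n. h k x * x (Suc d) ^ k)" for x
      by (simp add: g(2) h_def sum_distrib_left mult_ac)
    ultimately show ?thesis by blast
  next
    case True
    define h where "h k = (case k of 0 \<Rightarrow> (\<lambda>x. 0) | Suc k' \<Rightarrow> g k')" for k
    have "polyfun d (Suc n - k) (h k)" if "k \<le> Suc n" for k
      using g(1) that by (cases k) (auto simp: h_def polyfun.const)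
    moreover have "x i * f x = (\<Sum>k\<le>Suc n. h k x * x (Suc d) ^ k)" for x
      by (subst sum.atMost_Suc_shift) (simp add: g(2) True h_def sum_distrib_left mult_ac)
    ultimately show ?thesis by blast
  qed
next
  case (add n f f')
  then obtain g g' where "\<And>k. k \<le> n \<Longrightarrow> polyfun d (n - k) (g k)"
    "\<And>x. f x = (\<Sum>k\<le>n. g k x * x (Suc d) ^ k)"
    "\<And>k. k \<le> n \<Longrightarrow> polyfun d (n - k) (g' k)"
    "\<And>x. f' x = (\<Sum>k\<le>n. g' k x * x (Suc d) ^ k)" by blast
  then show ?case
    by (intro exI[of _ "\<lambda>k x. g k x + g' k x"])
       (auto intro: polyfun.add simp: distrib_right sum.distrib)
qed

lemma polyfun_0_const:
  "polyfun 0 n f \<Longrightarrow> \<exists>c. \<forall>x. f x = c"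
  by (induction rule: polyfun.induct) auto

text \<open>
  The last factor of a basis polynomial is a nonzero multiple of \<open>x\<^bsub>d+1\<^esub> ^ k\<close> plus terms of lower degree
  in \<open>x\<^bsub>d+1\<^esub>\<close>, whose missing degree is made up by powers of \<open>r\<close>, a polynomial in the earlier variables.
  So powers of the last variable can be replaced one after the other by such factors, and the
  coefficients are expanded by induction on the dimension.
\<close>

lemma in_span_simplex_poly:
  assumes "\<forall>i\<in>{1..d+1}. \<kappa> i > -1" "polyfun d n f"
  shows "in_span (solid_simplex d) (multi_indices_upto d n) (simplex_poly d \<kappa>) f"
  using assms
proof (induction d arbitrary: \<kappa> n f)
  case 0
  then obtain c where c: "\<And>x. f x = c" using polyfun_0_const by blast
  have "in_span (solid_simplex 0) (multi_indices_upto 0 n) (simplex_poly 0 \<kappa>)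
     (\<lambda>x. c * simplex_poly 0 \<kappa> (\<lambda>_. 0) x)"
    by (intro in_span_scale in_span_base finite_multi_indices_upto)
       (auto simp: multi_indices_upto_def multi_indices_def)
  then show ?case by (rule in_span_cong) (simp add: simplex_poly_def c)
next
  case (Suc d)
  let ?S = "\<lambda>n. in_span (solid_simplex (Suc d)) (multi_indices_upto (Suc d) n) (simplex_poly (Suc d) \<kappa>)"
  let ?r = "\<lambda>x. 1 - (\<Sum>i=1..d. x i)"
  let ?J = "\<lambda>k. shifted_jacobi k (\<kappa> (Suc (Suc d))) (\<kappa> (Suc d))"
  let ?H = "\<lambda>k x. homogenize (?J k) k (x (Suc d)) (?r x)"
  have pos: "\<kappa> (Suc (Suc d)) > -1" "\<kappa> (Suc d) > -1" using Suc.prems(1) by auto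
  \<comment> \<open>The parameters of the lower-dimensional basis are chosen according to the degree \<open>k\<close> of the
    last factor.\<close>
  have H: "?S (m + k) (\<lambda>x. g x * ?H k x)" if g: "polyfun d m g" for m k g
  proof -
    let ?\<kappa> = "merge_last d \<kappa> (2 * real k)"
    have "\<forall>i\<in>{1..d+1}. ?\<kappa> i > -1" using Suc.prems(1) by (intro merge_last_gt) auto
    from Suc.IH[OF this g] obtain c where
      c: "\<And>x. x \<in> solid_simplex d \<Longrightarrow> g x = (\<Sum>\<nu>\<in>multi_indices_upto d m. c \<nu> * simplex_poly d ?\<kappa> \<nu> x)"
      unfolding in_span_def by blast
    have "?S (m + k) (\<lambda>x. \<Sum>\<nu>\<in>multi_indices_upto d m. c \<nu> * simplex_poly (Suc d) \<kappa> (\<nu>(Suc d := k)) x)"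
      by (intro in_span_sum in_span_scale in_span_base finite_multi_indices_upto)
         (auto simp: multi_indices_upto_def multi_indices_def)
    then show ?thesis
    proof (rule in_span_cong)
      fix x assume x: "x \<in> solid_simplex (Suc d)"
      have "simplex_poly (Suc d) \<kappa> (\<nu>(Suc d := k)) x = simplex_poly d ?\<kappa> \<nu> x * ?H k x" for \<nu>
      proof -
        have "?H k x = ?r x ^ k * poly (?J k) (x (Suc d) / ?r x)"
          using pos solid_simplex_Suc[OF x] by (intro homogenize_eq) (auto simp: degree_shifted_jacobi)
        moreover have "simplex_poly d ?\<kappa> (\<nu>(Suc d := k)) x = simplex_poly d ?\<kappa> \<nu> x"
          by (rule simplex_poly_cong) auto
        ultimately show ?thesis by (simp add: simplex_poly_Suc)
      qed
      then show "g x * ?H k x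
         = (\<Sum>\<nu>\<in>multi_indices_upto d m. c \<nu> * simplex_poly (Suc d) \<kappa> (\<nu>(Suc d := k)) x)"
        using c[OF solid_simplex_Suc(1)[OF x]] by (simp add: sum_distrib_right mult.assoc)
    qed
  qed
  have pow: "?S (m + k) (\<lambda>x. g x * x (Suc d) ^ k)" if "polyfun d m g" for m k g
    using that
  proof (induction k arbitrary: m g rule: less_induct)
    case (less k)
    define L where "L = coeff (?J k) k"
    have L: "L \<noteq> 0" using jacobi_coeff_top_pos[OF pos, of k] by (simp add: L_def coeff_shifted_jacobi_top)
    have lower: "?S (m + k) (\<lambda>x. (g x * ?r x ^ (k - i)) * x (Suc d) ^ i)" if "i < k" for i
    proof -
      have "polyfun d (m + 1 * (k - i)) (\<lambda>x. g x * ?r x ^ (k - i))"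
        using less.prems by (intro polyfun_mult polyfun_power polyfun_one_minus_sum) auto
      from less.IH[OF that this] show ?thesis using that by simp
    qed
    have "?S (m + k) (\<lambda>x. (1 / L) * (g x * ?H k x)
        + (\<Sum>i<k. (- coeff (?J k) i / L) * ((g x * ?r x ^ (k - i)) * x (Suc d) ^ i)))"
      by (intro in_span_add in_span_scale in_span_sum H lower less.prems) auto
    then show ?case
    proof (rule in_span_cong)
      fix x
      have "?H k x = (\<Sum>i<k. coeff (?J k) i * x (Suc d) ^ i * ?r x ^ (k - i)) + L * x (Suc d) ^ k"
        by (simp add: homogenize_def L_def lessThan_Suc_atMost[symmetric])
      then have "(1 / L) * (g x * ?H k x)
        = (\<Sum>i<k. (coeff (?J k) i / L) * ((g x * ?r x ^ (k - i)) * x (Suc d) ^ i)) + g x * x (Suc d) ^ k"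
        using L by (simp add: distrib_left sum_distrib_left mult_ac)
      then show "g x * x (Suc d) ^ k = (1 / L) * (g x * ?H k x)
        + (\<Sum>i<k. (- coeff (?J k) i / L) * ((g x * ?r x ^ (k - i)) * x (Suc d) ^ i))"
        by (simp add: sum_negf)
    qed
  qed
  obtain g where g: "\<And>k. k \<le> n \<Longrightarrow> polyfun d (n - k) (g k)" "\<And>x. f x = (\<Sum>k\<le>n. g k x * x (Suc d) ^ k)"
    using polyfun_decompose_last[OF Suc.prems(2)] by blast
  have "?S n (\<lambda>x. \<Sum>k\<le>n. g k x * x (Suc d) ^ k)"
  proof (intro in_span_sum)
    fix k assume "k \<in> {..n}"
    then show "?S n (\<lambda>x. g k x * x (Suc d) ^ k)" using pow[OF g(1), of k k] by simp
  qed simp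
  then show ?case by (rule in_span_cong) (simp add: g(2))
qed

section \<open>Integration over the simplex\<close>

text \<open>
  The weight cut off outside the simplex, so that integrals over the simplex are integrals over the
  whole product space.
\<close>

definition dirichlet_density :: "nat \<Rightarrow> (nat \<Rightarrow> real) \<Rightarrow> (nat \<Rightarrow> real) \<Rightarrow> real" where
  "dirichlet_density d \<kappa> x = indicator (solid_simplex d) x * simplex_weight d \<kappa> x"

lemma measurable_coord_borel:
  "i \<in> {1..d} \<Longrightarrow> (\<lambda>x. x i) \<in> borel_measurable (lborel_pow d)"
  using measurable_component_singleton[of i "{1..d}" "\<lambda>_. lborel"] by simp

lemma simplex_weight_nonneg: "simplex_weight d \<kappa> x \<ge> 0"
  by (auto simp: simplex_weight_def intro!: mult_nonneg_nonneg prod_nonneg)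

lemma dirichlet_density_nonneg [simp]: "dirichlet_density d \<kappa> x \<ge> 0"
  by (simp add: dirichlet_density_def simplex_weight_nonneg)

lemma dirichlet_density_measurable [measurable]:
  "dirichlet_density d \<kappa> \<in> borel_measurable (lborel_pow d)"
proof -
  note [measurable] = measurable_coord_borel
  have [measurable]: "(\<lambda>x. \<Sum>i=1..d. x i) \<in> borel_measurable (lborel_pow d)"
    by (intro borel_measurable_sum) measurable
  have [measurable]: "Measurable.pred (lborel_pow d) (\<lambda>x. \<forall>i\<in>{1..d}. 0 \<le> x i)"
    by (intro pred_intros_finite) (simp, measurable)
  have [measurable]: "(\<lambda>x. \<Prod>i=1..d. x i powr \<kappa> i) \<in> borel_measurable (lborel_pow d)"
    by (intro borel_measurable_prod) measurable
  have "dirichlet_density d \<kappa> = (\<lambda>x. (if (\<forall>i\<in>{1..d}. 0 \<le> x i) \<and> (\<Sum>i=1..d. x i) \<le> 1 then 1 else 0)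
    * ((\<Prod>i=1..d. x i powr \<kappa> i) * (1 - (\<Sum>i=1..d. x i)) powr \<kappa> (d + 1)))"
    by (auto simp: fun_eq_iff dirichlet_density_def solid_simplex_def simplex_weight_def indicator_def)
  also have "\<dots> \<in> borel_measurable (lborel_pow d)" by measurable
  finally show ?thesis .
qed

lemma dirichlet_density_Suc:
  assumes "x \<in> solid_simplex d"
  shows "dirichlet_density (Suc d) \<kappa> (x(Suc d := y)) = (\<Prod>i=1..d. x i powr \<kappa> i)
     * (indicator {0..1 - (\<Sum>i=1..d. x i)} y
        * (y powr \<kappa> (Suc d) * (1 - (\<Sum>i=1..d. x i) - y) powr \<kappa> (Suc (Suc d))))"
proof -
  have s: "(\<Sum>i=1..d. (x(Suc d := y)) i) = (\<Sum>i=1..d. x i)"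
    by (intro sum.cong) auto
  have p: "(\<Prod>i=1..d. (x(Suc d := y)) i powr \<kappa> i) = (\<Prod>i=1..d. x i powr \<kappa> i)"
    by (intro prod.cong) auto
  have "(x(Suc d := y) \<in> solid_simplex (Suc d)) = (y \<in> {0..1 - (\<Sum>i=1..d. x i)})"
  proof -
    have "(x(Suc d := y) \<in> solid_simplex (Suc d)) \<longleftrightarrow> 0 \<le> y \<and> (\<Sum>i=1..d. x i) + y \<le> 1"
      using assms s unfolding solid_simplex_def mem_Collect_eq
      by (subst sum.nat_ivl_Suc') (auto simp: le_Suc_eq add.commute)
    then show ?thesis by auto
  qed
  moreover have "simplex_weight (Suc d) \<kappa> (x(Suc d := y)) = (\<Prod>i=1..d. x i powr \<kappa> i)
     * (y powr \<kappa> (Suc d) * (1 - (\<Sum>i=1..d. x i) - y) powr \<kappa> (Suc (Suc d)))"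
    unfolding simplex_weight_def
    by (subst prod.nat_ivl_Suc', simp, subst sum.nat_ivl_Suc', simp)
       (simp add: s[simplified] p[simplified] algebra_simps)
  ultimately show ?thesis
    unfolding dirichlet_density_def indicator_def by simp
qed

lemma dirichlet_density_Suc_outside:
  assumes "x \<notin> solid_simplex d"
  shows "dirichlet_density (Suc d) \<kappa> (x(Suc d := y)) = 0"
proof -
  have "x(Suc d := y) \<notin> solid_simplex (Suc d)"
  proof
    assume "x(Suc d := y) \<in> solid_simplex (Suc d)"
    then have "x(Suc d := y) \<in> solid_simplex d" by (rule solid_simplex_Suc)
    moreover have "(\<Sum>i=1..d. (x(Suc d := y)) i) = (\<Sum>i=1..d. x i)"
      by (intro sum.cong) auto
    ultimately show False using assms by (auto simp: solid_simplex_def)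
  qed
  then show ?thesis by (simp add: dirichlet_density_def)
qed

text \<open>
  The substitution \<open>y = r * u\<close>. For \<open>r = 0\<close> both sides are 0 because \<open>0 powr a = 0\<close>.
\<close>

lemma scaled_beta_integral:
  fixes r :: real
  assumes "r \<ge> 0" "a > -1" "b > -1"
  shows "integrable lborel (\<lambda>y. poly p (y / r) * (indicator {0..r} y * (y powr a * (r - y) powr b)))"
    and "(\<integral>y. poly p (y / r) * (indicator {0..r} y * (y powr a * (r - y) powr b)) \<partial>lborel)
       = r powr (a + b + 1) * (\<integral>u. poly p u * beta_weight a b u \<partial>lborel)"
proof -
  let ?f = "\<lambda>y. poly p (y / r) * (indicator {0..r} y * (y powr a * (r - y) powr b))"
  have "integrable lborel ?f \<and>
    integral\<^sup>L lborel ?f = r powr (a + b + 1) * (\<integral>u. poly p u * beta_weight a b u \<partial>lborel)"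
  proof (cases "r = 0")
    case True
    then have "?f = (\<lambda>_. 0)" by (auto simp: fun_eq_iff indicator_def)
    then show ?thesis using True by simp
  next
    case False
    then have r: "r > 0" using assms by simp
    have sub: "?f (0 + r * u) = r powr (a + b) * (poly p u * beta_weight a b u)" for u
    proof (cases "u \<in> {0..1}")
      case True
      then have "r * u \<in> {0..r}" using r by (auto simp: mult_le_cancel_left1)
      moreover have "r - r * u = r * (1 - u)" by (simp add: algebra_simps)
      ultimately show ?thesis using True r
        by (simp add: beta_weight_def powr_mult powr_add)
    next
      case False
      then have "r * u \<notin> {0..r}" using r by (auto simp: zero_le_mult_iff mult_le_cancel_left1)
      then show ?thesis using False by (simp add: beta_weight_def)
    qed
    have "integrable lborel (\<lambda>u. ?f (0 + r * u))"
      unfolding sub using integrable_poly_beta_weight[OF assms(2,3), of p] by simp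
    then have "integrable lborel ?f" using r lborel_integrable_real_affine_iff[of r ?f 0] by simp
    moreover have "integral\<^sup>L lborel ?f = \<bar>r\<bar> *\<^sub>R (\<integral>u. ?f (0 + r * u) \<partial>lborel)"
      using r by (intro lborel_integral_real_affine) simp
    moreover have "\<dots> = r powr (a + b + 1) * (\<integral>u. poly p u * beta_weight a b u \<partial>lborel)"
      unfolding sub using r by (simp add: powr_add)
    ultimately show ?thesis by simp
  qed
  then show "integrable lborel ?f"
    "integral\<^sup>L lborel ?f = r powr (a + b + 1) * (\<integral>u. poly p u * beta_weight a b u \<partial>lborel)"
    by auto
qed

lemma dirichlet_density_merge_last:
  assumes "x \<in> solid_simplex d"
  shows "dirichlet_density d (merge_last d \<kappa> (real m)) x = (\<Prod>i=1..d. x i powr \<kappa> i)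
     * (1 - (\<Sum>i=1..d. x i)) ^ m * (1 - (\<Sum>i=1..d. x i)) powr (\<kappa> (Suc d) + \<kappa> (Suc (Suc d)) + 1)"
proof -
  let ?r = "1 - (\<Sum>i=1..d. x i)"
  have r: "?r \<ge> 0" using assms by (auto simp: solid_simplex_def)
  have p: "(\<Prod>i=1..d. x i powr merge_last d \<kappa> (real m) i) = (\<Prod>i=1..d. x i powr \<kappa> i)"
    by (intro prod.cong) (auto simp: merge_last_def)
  have "?r powr (\<kappa> (Suc d) + \<kappa> (Suc (Suc d)) + 1 + real m)
     = ?r ^ m * ?r powr (\<kappa> (Suc d) + \<kappa> (Suc (Suc d)) + 1)"
  proof (cases "?r = 0")
    case False
    then have "?r > 0" using r by linarith
    then show ?thesis by (simp add: powr_add[of _ _ "real m"] powr_realpow)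
  qed simp
  then show ?thesis using assms p
    by (simp add: dirichlet_density_def simplex_weight_def merge_last_def)
qed

text \<open>
  By induction on the dimension: integrating out the last coordinate gives a Beta value times a
  density of the same kind in one dimension less.
\<close>

lemma integrable_dirichlet_density:
  assumes "\<forall>i\<in>{1..d+1}. \<kappa> i > -1"
  shows "integrable (lborel_pow d) (dirichlet_density d \<kappa>)"
  using assms
proof (induction d arbitrary: \<kappa>)
  case 0
  have "finite_measure (lborel_pow 0)"
    by (rule finite_measureI) (simp add: PiM_empty)
  then show ?case
    using finite_measure.integrable_const[of "lborel_pow 0" "1 :: real"]
    by (subst Bochner_Integration.integrable_cong[of _ "lborel_pow 0" _ "\<lambda>_. 1"])
       (auto simp: dirichlet_density_def solid_simplex_def simplex_weight_def)
next
  case (Suc d)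
  let ?\<kappa> = "merge_last d \<kappa> (real 0)"
  let ?a = "\<kappa> (Suc d)" and ?b = "\<kappa> (Suc (Suc d))"
  let ?B = "\<integral>u. beta_weight ?a ?b u \<partial>lborel"
  have ab: "?a > -1" "?b > -1" using Suc.prems by auto
  have B: "?B \<ge> 0" by (intro integral_nonneg_AE) auto
  have IH: "integrable (lborel_pow d) (dirichlet_density d ?\<kappa>)"
    using Suc.prems by (intro Suc.IH merge_last_gt) auto
  have ins: "{1..Suc d} = insert (Suc d) {1..d}" by auto
  have inner: "(\<integral>\<^sup>+y. ennreal (dirichlet_density (Suc d) \<kappa> (x(Suc d := y))) \<partial>lborel)
     = ennreal (dirichlet_density d ?\<kappa> x * ?B)" for x
  proof (cases "x \<in> solid_simplex d")
    case True
    let ?r = "1 - (\<Sum>i=1..d. x i)" and ?P = "\<Prod>i=1..d. x i powr \<kappa> i"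
    have r: "?r \<ge> 0" using True by (auto simp: solid_simplex_def)
    have P: "?P \<ge> 0" by (intro prod_nonneg) auto
    note sc = scaled_beta_integral[OF r ab, of 1]
    have "integrable lborel (\<lambda>y. dirichlet_density (Suc d) \<kappa> (x(Suc d := y)))"
      unfolding dirichlet_density_Suc[OF True] using sc(1) by (intro integrable_mult_right) simp
    then have "(\<integral>\<^sup>+y. ennreal (dirichlet_density (Suc d) \<kappa> (x(Suc d := y))) \<partial>lborel)
      = ennreal (\<integral>y. dirichlet_density (Suc d) \<kappa> (x(Suc d := y)) \<partial>lborel)"
      by (intro nn_integral_eq_integral) auto
    also have "(\<integral>y. dirichlet_density (Suc d) \<kappa> (x(Suc d := y)) \<partial>lborel) = dirichlet_density d ?\<kappa> x * ?B"
      unfolding dirichlet_density_Suc[OF True] dirichlet_density_merge_last[OF True]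
      using sc(2) by simp
    finally show ?thesis .
  next
    case False
    then show ?thesis by (simp add: dirichlet_density_Suc_outside) (simp add: dirichlet_density_def)
  qed
  have meas: "(\<lambda>x. ennreal (dirichlet_density (Suc d) \<kappa> x)) \<in> borel_measurable (Pi\<^sub>M (insert (Suc d) {1..d}) (\<lambda>_. lborel))"
    using dirichlet_density_measurable[of "Suc d" \<kappa>] unfolding ins
    by (rule measurable_compose[OF _ measurable_ennreal])
  have "(\<integral>\<^sup>+x. ennreal (dirichlet_density (Suc d) \<kappa> x) \<partial>lborel_pow (Suc d))
     = (\<integral>\<^sup>+x. (\<integral>\<^sup>+y. ennreal (dirichlet_density (Suc d) \<kappa> (x(Suc d := y))) \<partial>lborel) \<partial>lborel_pow d)"
    unfolding ins by (intro lborel_product.product_nn_integral_insert meas) auto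
  also have "\<dots> = (\<integral>\<^sup>+x. ennreal (dirichlet_density d ?\<kappa> x * ?B) \<partial>lborel_pow d)"
    by (simp only: inner)
  also have "\<dots> < \<infinity>"
    using integrableD(2)[OF integrable_mult_left[OF IH, of ?B]] B by (simp add: less_top[symmetric])
  finally have "(\<integral>\<^sup>+x. ennreal (dirichlet_density (Suc d) \<kappa> x) \<partial>lborel_pow (Suc d)) < \<infinity>" .
  then show ?case
    by (intro integrableI_nonneg dirichlet_density_measurable) auto
qed

lemma integrable_polyfun_dirichlet:
  assumes "\<forall>i\<in>{1..d+1}. \<kappa> i > -1" "polyfun d n p"
  shows "integrable (lborel_pow d) (\<lambda>x. p x * dirichlet_density d \<kappa> x)"
proof -
  obtain M where M: "\<And>x. x \<in> solid_simplex d \<Longrightarrow> \<bar>p x\<bar> \<le> M"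
    using polyfun_bounded[OF assms(2)] by blast
  have "integrable (lborel_pow d) (\<lambda>x. M * dirichlet_density d \<kappa> x)"
    using integrable_dirichlet_density[OF assms(1)] by simp
  then show ?thesis
  proof (rule Bochner_Integration.integrable_bound)
    show "(\<lambda>x. p x * dirichlet_density d \<kappa> x) \<in> borel_measurable (lborel_pow d)"
      using polyfun_measurable[OF assms(2)] by measurable
    show "AE x in lborel_pow d. norm (p x * dirichlet_density d \<kappa> x) \<le> norm (M * dirichlet_density d \<kappa> x)"
    proof (rule AE_I2)
      fix x
      show "norm (p x * dirichlet_density d \<kappa> x) \<le> norm (M * dirichlet_density d \<kappa> x)"
      proof (cases "x \<in> solid_simplex d")
        case True
        have "\<bar>p x\<bar> \<le> \<bar>M\<bar>" using M[OF True] by linarith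
        then show ?thesis by (simp add: abs_mult mult_right_mono)
      qed (simp add: dirichlet_density_def)
    qed
  qed
qed

text \<open>
  In terms of the ratio \<open>u = y / r\<close> of the last coordinate to the room left for it, the integral is a
  product.
\<close>

lemma integral_dirichlet_Suc:
  fixes G g :: "(nat \<Rightarrow> real) \<Rightarrow> real"
  assumes \<kappa>: "\<forall>i\<in>{1..Suc d+1}. \<kappa> i > -1"
    and int: "integrable (lborel_pow (Suc d)) (\<lambda>x. G x * dirichlet_density (Suc d) \<kappa> x)"
    and G: "\<And>x y. G (x(Suc d := y))
      = g x * (1 - (\<Sum>i=1..d. x i)) ^ m * poly h (y / (1 - (\<Sum>i=1..d. x i)))"
  shows "(\<integral>x. G x * dirichlet_density (Suc d) \<kappa> x \<partial>lborel_pow (Suc d))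
    = (\<integral>x. g x * dirichlet_density d (merge_last d \<kappa> (real m)) x \<partial>lborel_pow d)
      * (\<integral>u. poly h u * beta_weight (\<kappa> (Suc d)) (\<kappa> (Suc (Suc d))) u \<partial>lborel)"
proof -
  let ?a = "\<kappa> (Suc d)" and ?b = "\<kappa> (Suc (Suc d))"
  let ?B = "\<integral>u. poly h u * beta_weight ?a ?b u \<partial>lborel"
  have ab: "?a > -1" "?b > -1" using \<kappa> by auto
  have ins: "{1..Suc d} = insert (Suc d) {1..d}" by auto
  have inner: "(\<integral>y. G (x(Suc d := y)) * dirichlet_density (Suc d) \<kappa> (x(Suc d := y)) \<partial>lborel)
     = g x * dirichlet_density d (merge_last d \<kappa> (real m)) x * ?B" for x
  proof (cases "x \<in> solid_simplex d")
    case True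
    let ?r = "1 - (\<Sum>i=1..d. x i)" and ?P = "\<Prod>i=1..d. x i powr \<kappa> i"
    have r: "?r \<ge> 0" using True by (auto simp: solid_simplex_def)
    have "(\<integral>y. G (x(Suc d := y)) * dirichlet_density (Suc d) \<kappa> (x(Suc d := y)) \<partial>lborel)
      = (\<integral>y. (g x * ?r ^ m * ?P) * (poly h (y / ?r) * (indicator {0..?r} y * (y powr ?a * (?r - y) powr ?b))) \<partial>lborel)"
      unfolding G dirichlet_density_Suc[OF True] by (simp only: mult_ac)
    also have "\<dots> = (g x * ?r ^ m * ?P) * (?r powr (?a + ?b + 1) * ?B)"
      by (simp only: integral_mult_right_zero scaled_beta_integral(2)[OF r ab])
    also have "\<dots> = g x * dirichlet_density d (merge_last d \<kappa> (real m)) x * ?B"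
      unfolding dirichlet_density_merge_last[OF True] by (simp only: mult_ac)
    finally show ?thesis .
  next
    case False
    then show ?thesis by (simp add: dirichlet_density_Suc_outside) (simp add: dirichlet_density_def)
  qed
  have "(\<integral>x. G x * dirichlet_density (Suc d) \<kappa> x \<partial>lborel_pow (Suc d))
    = (\<integral>x. (\<integral>y. G (x(Suc d := y)) * dirichlet_density (Suc d) \<kappa> (x(Suc d := y)) \<partial>lborel) \<partial>lborel_pow d)"
    using int unfolding ins by (intro lborel_product.product_integral_insert) auto
  also have "\<dots> = (\<integral>x. g x * dirichlet_density d (merge_last d \<kappa> (real m)) x * ?B \<partial>lborel_pow d)"
    by (simp only: inner)
  finally show ?thesis by simp
qed

section \<open>Orthogonality on the simplex\<close>

definition dirichlet_inner ::
    "nat \<Rightarrow> (nat \<Rightarrow> real) \<Rightarrow> ((nat \<Rightarrow> real) \<Rightarrow> real) \<Rightarrow> ((nat \<Rightarrow> real) \<Rightarrow> real) \<Rightarrow> real" where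
  "dirichlet_inner d \<kappa> f g = (\<integral>x. f x * g x * dirichlet_density d \<kappa> x \<partial>lborel_pow d)"

lemma dirichlet_density_cong:
  "(\<And>x. x \<in> solid_simplex d \<Longrightarrow> f x = g x) \<Longrightarrow> f x * dirichlet_density d \<kappa> x = g x * dirichlet_density d \<kappa> x"
  by (cases "x \<in> solid_simplex d") (auto simp: dirichlet_density_def)

lemma integrable_simplex_poly_mult:
  assumes "\<forall>i\<in>{1..d+1}. \<kappa> i > -1" "\<forall>i\<in>{1..d+1}. \<kappa>' i > -1" "\<forall>i\<in>{1..d+1}. \<kappa>'' i > -1"
  shows "integrable (lborel_pow d) (\<lambda>x. simplex_poly d \<kappa>' \<nu> x * simplex_poly d \<kappa>'' \<mu> x * dirichlet_density d \<kappa> x)"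
proof -
  obtain p where p: "polyfun d (\<Sum>i=1..d. \<nu> i) p" "\<And>x. x \<in> solid_simplex d \<Longrightarrow> simplex_poly d \<kappa>' \<nu> x = p x"
    using simplex_poly_polyfun[OF assms(2)] by blast
  obtain q where q: "polyfun d (\<Sum>i=1..d. \<mu> i) q" "\<And>x. x \<in> solid_simplex d \<Longrightarrow> simplex_poly d \<kappa>'' \<mu> x = q x"
    using simplex_poly_polyfun[OF assms(3)] by blast
  have "(\<lambda>x. simplex_poly d \<kappa>' \<nu> x * simplex_poly d \<kappa>'' \<mu> x * dirichlet_density d \<kappa> x)
     = (\<lambda>x. (p x * q x) * dirichlet_density d \<kappa> x)"
    by (intro ext dirichlet_density_cong) (simp add: p q)
  then show ?thesis using integrable_polyfun_dirichlet[OF assms(1) polyfun_mult[OF p(1) q(1)]] by simp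
qed

text \<open>
  If the last degrees of \<open>\<nu>\<close> and \<open>\<mu>\<close> differ, the one-dimensional factor vanishes. If they agree, the
  three parameter vectors on the right are the same, so the first factor is again an inner product of
  two basis polynomials with respect to their own weight.
\<close>

lemma dirichlet_inner_simplex_poly_Suc:
  assumes \<kappa>: "\<forall>i\<in>{1..Suc d+1}. \<kappa> i > -1"
  defines "J \<equiv> \<lambda>k. shifted_jacobi k (\<kappa> (Suc (Suc d))) (\<kappa> (Suc d))"
    and "\<kappa>' \<equiv> \<lambda>k. merge_last d \<kappa> (real k)"
  shows "dirichlet_inner (Suc d) \<kappa> (simplex_poly (Suc d) \<kappa> \<nu>) (simplex_poly (Suc d) \<kappa> \<mu>)
    = dirichlet_inner d (\<kappa>' (\<nu> (Suc d) + \<mu> (Suc d)))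
        (simplex_poly d (\<kappa>' (2 * \<nu> (Suc d))) \<nu>) (simplex_poly d (\<kappa>' (2 * \<mu> (Suc d))) \<mu>)
      * (\<integral>u. poly (J (\<nu> (Suc d))) u * poly (J (\<mu> (Suc d))) u
           * beta_weight (\<kappa> (Suc d)) (\<kappa> (Suc (Suc d))) u \<partial>lborel)"
proof -
  have eq: "simplex_poly (Suc d) \<kappa> \<nu> (x(Suc d := y)) = simplex_poly d (\<kappa>' (2 * \<nu> (Suc d))) \<nu> x
     * ((1 - (\<Sum>i=1..d. x i)) ^ \<nu> (Suc d) * poly (J (\<nu> (Suc d))) (y / (1 - (\<Sum>i=1..d. x i))))" for \<nu> x y
  proof -
    have "(\<Sum>i=1..d. (x(Suc d := y)) i) = (\<Sum>i=1..d. x i)"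
      by (intro sum.cong) auto
    moreover have "simplex_poly d (\<kappa>' (2 * \<nu> (Suc d))) \<nu> (x(Suc d := y)) = simplex_poly d (\<kappa>' (2 * \<nu> (Suc d))) \<nu> x"
      by (rule simplex_poly_cong) auto
    ultimately show ?thesis unfolding simplex_poly_Suc J_def \<kappa>'_def by simp
  qed
  show ?thesis
    unfolding dirichlet_inner_def poly_mult[symmetric] \<kappa>'_def
    by (rule integral_dirichlet_Suc[OF \<kappa> integrable_simplex_poly_mult[OF \<kappa> \<kappa> \<kappa>]])
       (simp only: eq \<kappa>'_def poly_mult power_add mult_ac)
qed

lemma simplex_poly_orthogonal:
  assumes "\<forall>i\<in>{1..d+1}. \<kappa> i > -1" "\<exists>i\<in>{1..d}. \<nu> i \<noteq> \<mu> i"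
  shows "dirichlet_inner d \<kappa> (simplex_poly d \<kappa> \<nu>) (simplex_poly d \<kappa> \<mu>) = 0"
  using assms
proof (induction d arbitrary: \<kappa>)
  case (Suc d)
  have ab: "\<kappa> (Suc d) > -1" "\<kappa> (Suc (Suc d)) > -1" using Suc.prems by auto
  show ?case
  proof (cases "\<nu> (Suc d) = \<mu> (Suc d)")
    case True
    let ?\<kappa> = "merge_last d \<kappa> (real (2 * \<mu> (Suc d)))"
    have "\<exists>i\<in>{1..d}. \<nu> i \<noteq> \<mu> i" 
    proof -
      obtain i where i: "i \<in> {1..Suc d}" "\<nu> i \<noteq> \<mu> i" using Suc.prems(2) by blast
      then have "i \<in> {1..d}" using True by (cases "i = Suc d") auto
      then show ?thesis using i by blast
    qed
    moreover have "\<forall>i\<in>{1..d+1}. ?\<kappa> i > -1" using Suc.prems(1) by (intro merge_last_gt) auto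
    ultimately have IH: "dirichlet_inner d ?\<kappa> (simplex_poly d ?\<kappa> \<nu>) (simplex_poly d ?\<kappa> \<mu>) = 0"
      by (intro Suc.IH)
    have two: "\<mu> (Suc d) + \<mu> (Suc d) = 2 * \<mu> (Suc d)" by simp
    show ?thesis
      unfolding dirichlet_inner_simplex_poly_Suc[OF Suc.prems(1)] True two IH by (rule mult_zero_left)
  next
    case False
    show ?thesis
      unfolding dirichlet_inner_simplex_poly_Suc[OF Suc.prems(1)] shifted_jacobi_orthogonal_pair[OF ab False]
      by simp
  qed
qed simp

lemma simplex_poly_norm_pos:
  assumes "\<forall>i\<in>{1..d+1}. \<kappa> i > -1"
  shows "dirichlet_inner d \<kappa> (simplex_poly d \<kappa> \<nu>) (simplex_poly d \<kappa> \<nu>) > 0"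
  using assms
proof (induction d arbitrary: \<kappa>)
  case 0
  have "(\<lambda>x. simplex_poly 0 \<kappa> \<nu> x * simplex_poly 0 \<kappa> \<nu> x * dirichlet_density 0 \<kappa> x) = (\<lambda>_. 1)"
    by (auto simp: fun_eq_iff simplex_poly_def dirichlet_density_def simplex_weight_def solid_simplex_def)
  then show ?case by (simp add: dirichlet_inner_def PiM_empty measure_count_space)
next
  case (Suc d)
  have ab: "\<kappa> (Suc d) > -1" "\<kappa> (Suc (Suc d)) > -1" using Suc.prems by auto
  let ?\<kappa> = "merge_last d \<kappa> (real (2 * \<nu> (Suc d)))"
  let ?J = "shifted_jacobi (\<nu> (Suc d)) (\<kappa> (Suc (Suc d))) (\<kappa> (Suc d))"
  have "\<forall>i\<in>{1..d+1}. ?\<kappa> i > -1" using Suc.prems(1) by (intro merge_last_gt) auto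
  then have 1: "dirichlet_inner d ?\<kappa> (simplex_poly d ?\<kappa> \<nu>) (simplex_poly d ?\<kappa> \<nu>) > 0"
    by (intro Suc.IH)
  have "?J \<noteq> 0" using jacobi_coeff_top_pos[OF ab(2,1), of "\<nu> (Suc d)"]
    by (metis coeff_0 coeff_shifted_jacobi_top less_irrefl)
  then have "(\<integral>u. (poly ?J u)\<^sup>2 * beta_weight (\<kappa> (Suc d)) (\<kappa> (Suc (Suc d))) u \<partial>lborel) > 0"
    using integrable_poly_beta_weight[OF ab, of "?J ^ 2"]
    by (intro integral_square_poly_weight_pos) (auto simp: beta_weight_pos)
  then show ?case
    unfolding dirichlet_inner_simplex_poly_Suc[OF Suc.prems(1)]
    using 1 by (simp add: power2_eq_square mult_2 del: of_nat_mult of_nat_add)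
qed

lemma dirichlet_inner_sum_left:
  assumes \<kappa>: "\<forall>i\<in>{1..d+1}. \<kappa> i > -1"
    and f: "\<And>x. x \<in> solid_simplex d \<Longrightarrow> f x = (\<Sum>\<mu>\<in>I. c \<mu> * simplex_poly d \<kappa> \<mu> x)"
  shows "dirichlet_inner d \<kappa> f (simplex_poly d \<kappa> \<nu>)
    = (\<Sum>\<mu>\<in>I. c \<mu> * dirichlet_inner d \<kappa> (simplex_poly d \<kappa> \<mu>) (simplex_poly d \<kappa> \<nu>))"
proof -
  have "f x * simplex_poly d \<kappa> \<nu> x * dirichlet_density d \<kappa> x
    = (\<Sum>\<mu>\<in>I. c \<mu> * (simplex_poly d \<kappa> \<mu> x * simplex_poly d \<kappa> \<nu> x * dirichlet_density d \<kappa> x))" for x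
  proof -
    have "f x * simplex_poly d \<kappa> \<nu> x * dirichlet_density d \<kappa> x
      = (\<Sum>\<mu>\<in>I. c \<mu> * simplex_poly d \<kappa> \<mu> x) * simplex_poly d \<kappa> \<nu> x * dirichlet_density d \<kappa> x"
      by (rule dirichlet_density_cong) (simp add: f)
    then show ?thesis by (simp add: sum_distrib_right mult.assoc)
  qed
  then have "dirichlet_inner d \<kappa> f (simplex_poly d \<kappa> \<nu>) = (\<integral>x. (\<Sum>\<mu>\<in>I. c \<mu> *
      (simplex_poly d \<kappa> \<mu> x * simplex_poly d \<kappa> \<nu> x * dirichlet_density d \<kappa> x)) \<partial>lborel_pow d)"
    unfolding dirichlet_inner_def by (simp only:)
  also have "\<dots> = (\<Sum>\<mu>\<in>I. (\<integral>x. c \<mu> *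
      (simplex_poly d \<kappa> \<mu> x * simplex_poly d \<kappa> \<nu> x * dirichlet_density d \<kappa> x) \<partial>lborel_pow d))"
    by (intro Bochner_Integration.integral_sum integrable_mult_right integrable_simplex_poly_mult \<kappa>)
  finally show ?thesis by (simp only: integral_mult_right_zero dirichlet_inner_def)
qed

lemma multi_index_neq:
  assumes "\<nu> \<in> multi_indices d" "\<mu> \<in> multi_indices d" "\<nu> \<noteq> \<mu>"
  shows "\<exists>i\<in>{1..d}. \<nu> i \<noteq> \<mu> i"
proof -
  obtain i where "\<nu> i \<noteq> \<mu> i" using assms(3) by auto
  moreover from this have "i \<in> {1..d}" using assms(1,2) unfolding multi_indices_def by force
  ultimately show ?thesis by blast
qed

lemma dirichlet_inner_coeff:
  assumes \<kappa>: "\<forall>i\<in>{1..d+1}. \<kappa> i > -1" and I: "finite I" "I \<subseteq> multi_indices d" "\<nu> \<in> I"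
    and f: "\<And>x. x \<in> solid_simplex d \<Longrightarrow> f x = (\<Sum>\<mu>\<in>I. c \<mu> * simplex_poly d \<kappa> \<mu> x)"
  shows "dirichlet_inner d \<kappa> f (simplex_poly d \<kappa> \<nu>)
    = c \<nu> * dirichlet_inner d \<kappa> (simplex_poly d \<kappa> \<nu>) (simplex_poly d \<kappa> \<nu>)"
proof -
  have "dirichlet_inner d \<kappa> f (simplex_poly d \<kappa> \<nu>)
    = (\<Sum>\<mu>\<in>I. c \<mu> * dirichlet_inner d \<kappa> (simplex_poly d \<kappa> \<mu>) (simplex_poly d \<kappa> \<nu>))"
    using \<kappa> f by (rule dirichlet_inner_sum_left)
  also have "\<dots> = (\<Sum>\<mu>\<in>{\<nu>}. c \<mu> * dirichlet_inner d \<kappa> (simplex_poly d \<kappa> \<mu>) (simplex_poly d \<kappa> \<nu>))"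
  proof (rule sum.mono_neutral_right)
    show "\<forall>\<mu>\<in>I - {\<nu>}. c \<mu> * dirichlet_inner d \<kappa> (simplex_poly d \<kappa> \<mu>) (simplex_poly d \<kappa> \<nu>) = 0"
    proof
      fix \<mu> assume "\<mu> \<in> I - {\<nu>}"
      then have "\<exists>i\<in>{1..d}. \<mu> i \<noteq> \<nu> i" using I by (intro multi_index_neq) auto
      then show "c \<mu> * dirichlet_inner d \<kappa> (simplex_poly d \<kappa> \<mu>) (simplex_poly d \<kappa> \<nu>) = 0"
        by (simp add: simplex_poly_orthogonal[OF \<kappa>])
    qed
  qed (use I in auto)
  finally show ?thesis by simp
qed

text \<open>
  Equality is required only at points with positive coordinates: elsewhere on the simplex some base
  vanishes and so does the weight, because \<open>0 powr a = 0\<close>. On the ball this makes it possible to cancel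
  the monomial factor \<open>\<Prod>i. x i ^ e i\<close>.
\<close>

lemma simplex_poly_independent:
  assumes \<kappa>: "\<forall>i\<in>{1..d+1}. \<kappa> i > -1" and I: "finite I" "I \<subseteq> multi_indices d" "\<nu> \<in> I"
    and zero: "\<And>x. x \<in> solid_simplex d \<Longrightarrow> (\<And>i. i \<in> {1..d} \<Longrightarrow> x i > 0)
      \<Longrightarrow> (\<Sum>\<mu>\<in>I. c \<mu> * simplex_poly d \<kappa> \<mu> x) = 0"
  shows "c \<nu> = 0"
proof -
  define f where "f x = (\<Sum>\<mu>\<in>I. c \<mu> * simplex_poly d \<kappa> \<mu> x)" for x
  have "f x * simplex_poly d \<kappa> \<nu> x * dirichlet_density d \<kappa> x = 0" for x
  proof (cases "x \<in> solid_simplex d \<and> (\<forall>i\<in>{1..d}. x i > 0)")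
    case True
    then have "f x = 0" unfolding f_def by (intro zero) auto
    then show ?thesis by simp
  next
    case False
    then consider "x \<notin> solid_simplex d" | i where "i \<in> {1..d}" "x i = 0"
      by (force simp: solid_simplex_def)
    then have "dirichlet_density d \<kappa> x = 0"
    proof cases
      case 2
      then have "(\<Prod>i=1..d. x i powr \<kappa> i) = 0" by (intro prod_zero) auto
      then show ?thesis by (simp add: dirichlet_density_def simplex_weight_def)
    qed (simp add: dirichlet_density_def)
    then show ?thesis by simp
  qed
  then have "dirichlet_inner d \<kappa> f (simplex_poly d \<kappa> \<nu>) = 0"
    unfolding dirichlet_inner_def by (simp only: integral_zero)
  then show ?thesis
    using dirichlet_inner_coeff[OF \<kappa> I, of f c] simplex_poly_norm_pos[OF \<kappa>, of \<nu>] by (simp add: f_def)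
qed

section \<open>Permuting the coordinates of the simplex\<close>

lemma integral_lborel_pow_perm:
  fixes F :: "(nat \<Rightarrow> real) \<Rightarrow> real"
  assumes \<tau>: "\<tau> permutes {1..d}" and F: "F \<in> borel_measurable (lborel_pow d)"
  shows "(\<integral>x. F (\<lambda>i\<in>{1..d}. x (\<tau> i)) \<partial>lborel_pow d) = (\<integral>x. F x \<partial>lborel_pow d)"
proof -
  let ?T = "\<lambda>x. \<lambda>i\<in>{1..d}. x (\<tau> i) :: real"
  have im: "\<tau> i \<in> {1..d}" if "i \<in> {1..d}" for i using that \<tau> permutes_in_image by metis
  have im': "inv \<tau> i \<in> {1..d}" if "i \<in> {1..d}" for i
    using that permutes_in_image[OF permutes_inv[OF \<tau>]] by metis
  have T [measurable]: "?T \<in> measurable (lborel_pow d) (lborel_pow d)"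
    by (intro measurable_restrict measurable_component_singleton im)
  have "distr (lborel_pow d) (lborel_pow d) ?T = lborel_pow d"
  proof (rule lborel_product.PiM_eqI)
    fix A :: "nat \<Rightarrow> real set" assume A: "\<And>i. i \<in> {1..d} \<Longrightarrow> A i \<in> sets lborel"
    have "?T -` Pi\<^sub>E {1..d} A \<inter> space (lborel_pow d) = Pi\<^sub>E {1..d} (\<lambda>i. A (inv \<tau> i))"
    proof (intro set_eqI iffI)
      fix x assume x: "x \<in> ?T -` Pi\<^sub>E {1..d} A \<inter> space (lborel_pow d)"
      show "x \<in> Pi\<^sub>E {1..d} (\<lambda>i. A (inv \<tau> i))"
      proof (rule PiE_I)
        fix i assume i: "i \<in> {1..d}"
        have "?T x (inv \<tau> i) \<in> A (inv \<tau> i)" using x im'[OF i]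
          by (intro PiE_mem[of _ "{1..d}" A]) blast+
        then show "x i \<in> A (inv \<tau> i)" using im'[OF i] permutes_inverses(1)[OF \<tau>] by simp
      qed (use x in \<open>auto simp: space_PiM PiE_def extensional_def\<close>)
    next
      fix x assume x: "x \<in> Pi\<^sub>E {1..d} (\<lambda>i. A (inv \<tau> i))"
      have "x (\<tau> i) \<in> A i" if "i \<in> {1..d}" for i
        using PiE_mem[OF x im[OF that]] permutes_inverses(2)[OF \<tau>] by simp
      then show "x \<in> ?T -` Pi\<^sub>E {1..d} A \<inter> space (lborel_pow d)"
        using x by (auto simp: space_PiM PiE_def)
    qed
    then have "emeasure (distr (lborel_pow d) (lborel_pow d) ?T) (Pi\<^sub>E {1..d} A)
      = emeasure (lborel_pow d) (Pi\<^sub>E {1..d} (\<lambda>i. A (inv \<tau> i)))"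
      using A by (subst emeasure_distr[OF T]) (auto intro: sets_PiM_I_finite)
    also have "\<dots> = (\<Prod>i\<in>{1..d}. emeasure lborel (A (inv \<tau> i)))"
      using A im' by (subst lborel_product.emeasure_PiM) auto
    also have "\<dots> = (\<Prod>i\<in>{1..d}. emeasure lborel (A i))"
      using prod.permute[OF permutes_inv[OF \<tau>], of "\<lambda>i. emeasure lborel (A i)"] by (simp add: o_def)
    finally show "emeasure (distr (lborel_pow d) (lborel_pow d) ?T) (Pi\<^sub>E {1..d} A)
      = (\<Prod>i\<in>{1..d}. emeasure lborel (A i))" .
  qed auto
  then have "(\<integral>x. F x \<partial>lborel_pow d) = (\<integral>x. F x \<partial>distr (lborel_pow d) (lborel_pow d) ?T)" by simp
  also have "\<dots> = (\<integral>x. F (?T x) \<partial>lborel_pow d)" using F by (intro integral_distr T)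
  finally show ?thesis by simp
qed

lemma sum_restrict_perm:
  fixes x :: "nat \<Rightarrow> real"
  assumes "\<tau> permutes {1..d}"
  shows "(\<Sum>i=1..d. (\<lambda>i\<in>{1..d}. x (\<tau> i)) i) = (\<Sum>i=1..d. x i)"
  using sum.permute[OF assms, of x] by (simp add: o_def)

lemma solid_simplex_perm_iff:
  assumes "\<tau> permutes {1..d}"
  shows "(\<lambda>i\<in>{1..d}. x (\<tau> i)) \<in> solid_simplex d \<longleftrightarrow> x \<in> solid_simplex d"
proof -
  have "(\<forall>i\<in>{1..d}. 0 \<le> x (\<tau> i)) \<longleftrightarrow> (\<forall>i\<in>{1..d}. 0 \<le> x i)"
    using permutes_image[OF assms] by (metis image_iff imageI)
  then show ?thesis using sum_restrict_perm[OF assms, of x]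
    by (simp add: solid_simplex_def)
qed

lemma dirichlet_density_perm:
  assumes "\<tau> permutes {1..d}"
  shows "dirichlet_density d (\<kappa> \<circ> \<tau>) (\<lambda>i\<in>{1..d}. x (\<tau> i)) = dirichlet_density d \<kappa> x"
proof -
  have "\<tau> (d + 1) = d + 1" using assms by (intro permutes_not_in) auto
  moreover have "(\<Prod>i=1..d. (\<lambda>i\<in>{1..d}. x (\<tau> i)) i powr (\<kappa> \<circ> \<tau>) i) = (\<Prod>i=1..d. x i powr \<kappa> i)"
    using prod.permute[OF assms, of "\<lambda>i. x i powr \<kappa> i"] by (simp add: o_def)
  ultimately show ?thesis
    unfolding dirichlet_density_def simplex_weight_def sum_restrict_perm[OF assms]
    by (simp add: indicator_def solid_simplex_perm_iff[OF assms] del: One_nat_def)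
qed

lemma permutes_gt:
  fixes d :: nat
  assumes "\<tau> permutes {1..d}" "\<forall>i\<in>{1..d+1}. \<kappa> i > (-1::real)"
  shows "\<forall>i\<in>{1..d+1}. (\<kappa> \<circ> \<tau>) i > -1"
proof -
  have "\<tau> permutes {1..d+1}" 
    using assms(1) by (rule permutes_subset) force
  then show ?thesis using assms(2) permutes_in_image by fastforce
qed

text \<open>
  Undo the permutation by a change of variables. It carries the weight for \<open>\<kappa>\<close> to the weight for
  \<open>\<kappa> \<circ> \<tau>\<close> and \<open>simplex_poly d \<kappa> \<mu>\<close> to a polynomial of the same degree, which is a combination of
  basis polynomials for \<open>\<kappa> \<circ> \<tau>\<close> of degree less than that of \<open>\<nu>\<close>.
\<close>

lemma simplex_perm_orthogonal_lower:
  assumes \<kappa>: "\<forall>i\<in>{1..d+1}. \<kappa> i > -1" and \<tau>: "\<tau> permutes {1..d}"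
    and deg: "(\<Sum>i=1..d. \<mu> i) < (\<Sum>i=1..d. \<nu> i)" and \<nu>: "\<nu> \<in> multi_indices d"
  shows "dirichlet_inner d \<kappa> (\<lambda>x. simplex_poly d (\<kappa> \<circ> \<tau>) \<nu> (\<lambda>i\<in>{1..d}. x (\<tau> i)))
     (simplex_poly d \<kappa> \<mu>) = 0"
proof -
  let ?T = "\<lambda>x. \<lambda>i\<in>{1..d}. x (\<tau> i) :: real"
  let ?S = "\<lambda>y. \<lambda>i\<in>{1..d}. y (inv \<tau> i) :: real"
  note \<kappa>\<tau> = permutes_gt[OF \<tau> \<kappa>]
  obtain p where p: "polyfun d (\<Sum>i=1..d. \<mu> i) p" "\<And>x. x \<in> solid_simplex d \<Longrightarrow> simplex_poly d \<kappa> \<mu> x = p x"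
    using simplex_poly_polyfun[OF \<kappa>] by blast
  obtain q where q: "polyfun d (\<Sum>i=1..d. \<nu> i) q"
      "\<And>x. x \<in> solid_simplex d \<Longrightarrow> simplex_poly d (\<kappa> \<circ> \<tau>) \<nu> x = q x"
    using simplex_poly_polyfun[OF \<kappa>\<tau>] by blast
  have pS: "polyfun d (\<Sum>i=1..d. \<mu> i) (\<lambda>y. p (?S y))"
    by (rule polyfun_compose_perm[OF p(1) permutes_inv[OF \<tau>]])
  obtain c where c: "\<And>y. y \<in> solid_simplex d \<Longrightarrow>
      p (?S y) = (\<Sum>\<xi>\<in>multi_indices_upto d (\<Sum>i=1..d. \<mu> i). c \<xi> * simplex_poly d (\<kappa> \<circ> \<tau>) \<xi> y)"
    using in_span_simplex_poly[OF \<kappa>\<tau> pS] unfolding in_span_def by blast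
  \<comment> \<open>Written with the polynomials \<open>q\<close> and \<open>p\<close>, the integrand is visibly measurable.\<close>
  define F where "F y = q y * p (?S y) * dirichlet_density d (\<kappa> \<circ> \<tau>) y" for y
  have F: "F \<in> borel_measurable (lborel_pow d)"
    unfolding F_def using polyfun_measurable[OF q(1)] polyfun_measurable[OF pS] by measurable
  have "simplex_poly d (\<kappa> \<circ> \<tau>) \<nu> (?T x) * simplex_poly d \<kappa> \<mu> x * dirichlet_density d \<kappa> x = F (?T x)"
    for x
  proof (cases "x \<in> solid_simplex d")
    case True
    have im: "inv \<tau> i \<in> {1..d}" if "i \<in> {1..d}" for i
      using that permutes_in_image[OF permutes_inv[OF \<tau>]] by metis
    have ST: "?S (?T x) i = x i" if "i \<in> {1..d}" for i
      using that im[OF that] permutes_inverses(1)[OF \<tau>] by simp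
    have "?S (?T x) \<in> solid_simplex d"
      using True by (simp del: One_nat_def restrict_apply add: solid_simplex_perm_iff[OF permutes_inv[OF \<tau>]] solid_simplex_perm_iff[OF \<tau>])
    then have "p (?S (?T x)) = simplex_poly d \<kappa> \<mu> (?S (?T x))" by (simp add: p(2))
    also have "\<dots> = simplex_poly d \<kappa> \<mu> x" using ST by (intro simplex_poly_cong) auto
    finally have 1: "p (?S (?T x)) = simplex_poly d \<kappa> \<mu> x" .
    have 2: "q (?T x) = simplex_poly d (\<kappa> \<circ> \<tau>) \<nu> (?T x)"
      using True by (simp add: q(2) solid_simplex_perm_iff[OF \<tau>] del: One_nat_def)
    show ?thesis unfolding F_def 1 2 dirichlet_density_perm[OF \<tau>] ..
  next
    case False
    then show ?thesis unfolding F_def dirichlet_density_perm[OF \<tau>] by (simp add: dirichlet_density_def)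
  qed
  then have "dirichlet_inner d \<kappa> (\<lambda>x. simplex_poly d (\<kappa> \<circ> \<tau>) \<nu> (?T x)) (simplex_poly d \<kappa> \<mu>)
      = (\<integral>x. F (?T x) \<partial>lborel_pow d)"
    unfolding dirichlet_inner_def by (simp only:)
  also have "\<dots> = (\<integral>x. F x \<partial>lborel_pow d)" by (rule integral_lborel_pow_perm[OF \<tau> F])
  also have "\<dots> = dirichlet_inner d (\<kappa> \<circ> \<tau>) (\<lambda>y. p (?S y)) (simplex_poly d (\<kappa> \<circ> \<tau>) \<nu>)"
    unfolding dirichlet_inner_def F_def
    by (intro Bochner_Integration.integral_cong refl dirichlet_density_cong) (simp only: q(2) mult.commute)
  also have "\<dots> = (\<Sum>\<xi>\<in>multi_indices_upto d (\<Sum>i=1..d. \<mu> i). c \<xi> *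
      dirichlet_inner d (\<kappa> \<circ> \<tau>) (simplex_poly d (\<kappa> \<circ> \<tau>) \<xi>) (simplex_poly d (\<kappa> \<circ> \<tau>) \<nu>))"
    using c by (rule dirichlet_inner_sum_left[OF \<kappa>\<tau>])
  also have "\<dots> = 0"
  proof (rule sum.neutral, rule ballI)
    fix \<xi> assume l: "\<xi> \<in> multi_indices_upto d (\<Sum>i=1..d. \<mu> i)"
    then have "\<xi> \<noteq> \<nu>" using deg by (auto simp: multi_indices_upto_def)
    then have "\<exists>i\<in>{1..d}. \<xi> i \<noteq> \<nu> i"
      using l \<nu> by (intro multi_index_neq) (auto simp: multi_indices_upto_def)
    then show "c \<xi> * dirichlet_inner d (\<kappa> \<circ> \<tau>) (simplex_poly d (\<kappa> \<circ> \<tau>) \<xi>) (simplex_poly d (\<kappa> \<circ> \<tau>) \<nu>) = 0"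
      by (simp add: simplex_poly_orthogonal[OF \<kappa>\<tau>])
  qed
  finally show ?thesis .
qed

text \<open>
  Existence of the expansion: the permuted polynomial has an expansion in basis polynomials of degree
  at most \<open>n\<close>, and orthogonality to lower degrees removes those of degree less than \<open>n\<close>.
\<close>

lemma simplex_perm_in_span:
  assumes \<kappa>: "\<forall>i\<in>{1..d+1}. \<kappa> i > -1" and \<tau>: "\<tau> permutes {1..d}" and \<nu>: "\<nu> \<in> multi_indices d"
  shows "in_span (solid_simplex d) (multi_indices_deg d (\<Sum>i=1..d. \<nu> i)) (simplex_poly d \<kappa>)
    (\<lambda>x. simplex_poly d (\<kappa> \<circ> \<tau>) \<nu> (\<lambda>i\<in>{1..d}. x (\<tau> i)))"
proof -
  let ?n = "\<Sum>i=1..d. \<nu> i"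
  let ?f = "\<lambda>x. simplex_poly d (\<kappa> \<circ> \<tau>) \<nu> (\<lambda>i\<in>{1..d}. x (\<tau> i))"
  obtain q where q: "polyfun d ?n q"
      "\<And>x. x \<in> solid_simplex d \<Longrightarrow> simplex_poly d (\<kappa> \<circ> \<tau>) \<nu> x = q x"
    using simplex_poly_polyfun[OF permutes_gt[OF \<tau> \<kappa>]] by blast
  have "in_span (solid_simplex d) (multi_indices_upto d ?n) (simplex_poly d \<kappa>)
     (\<lambda>x. q (\<lambda>i\<in>{1..d}. x (\<tau> i)))"
    by (intro in_span_simplex_poly[OF \<kappa>] polyfun_compose_perm q \<tau>)
  then have "in_span (solid_simplex d) (multi_indices_upto d ?n) (simplex_poly d \<kappa>) ?f"
    by (rule in_span_cong) (simp add: q(2) solid_simplex_perm_iff[OF \<tau>] del: One_nat_def)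
  then obtain c where
    c: "\<And>x. x \<in> solid_simplex d \<Longrightarrow> ?f x = (\<Sum>\<mu>\<in>multi_indices_upto d ?n. c \<mu> * simplex_poly d \<kappa> \<mu> x)"
    unfolding in_span_def by blast
  have c0: "c \<mu> = 0" if \<mu>: "\<mu> \<in> multi_indices_upto d ?n - multi_indices_deg d ?n" for \<mu>
  proof -
    have "(\<Sum>i=1..d. \<mu> i) < ?n" using \<mu> by (auto simp: multi_indices_upto_def multi_indices_deg_def)
    then have "dirichlet_inner d \<kappa> ?f (simplex_poly d \<kappa> \<mu>) = 0"
      using simplex_perm_orthogonal_lower[OF \<kappa> \<tau> _ \<nu>] by simp
    moreover have "dirichlet_inner d \<kappa> ?f (simplex_poly d \<kappa> \<mu>)
        = c \<mu> * dirichlet_inner d \<kappa> (simplex_poly d \<kappa> \<mu>) (simplex_poly d \<kappa> \<mu>)"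
      using \<mu>
      by (intro dirichlet_inner_coeff[OF \<kappa> finite_multi_indices_upto _ _ c])
         (auto simp: multi_indices_upto_def)
    ultimately show ?thesis using simplex_poly_norm_pos[OF \<kappa>, of \<mu>] by simp
  qed
  have "(\<Sum>\<mu>\<in>multi_indices_upto d ?n. c \<mu> * simplex_poly d \<kappa> \<mu> x)
      = (\<Sum>\<mu>\<in>multi_indices_deg d ?n. c \<mu> * simplex_poly d \<kappa> \<mu> x)" for x
    using c0
    by (intro sum.mono_neutral_right finite_multi_indices_upto)
       (auto simp: multi_indices_upto_def multi_indices_deg_def)
  then show ?thesis using c unfolding in_span_def by (intro exI[of _ c]) simp
qed

section \<open>From the simplex to the ball\<close>

abbreviation coord_squares :: "nat \<Rightarrow> (nat \<Rightarrow> real) \<Rightarrow> nat \<Rightarrow> real" where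
  "coord_squares d x \<equiv> \<lambda>i\<in>{1..d}. (x i)\<^sup>2"

lemma coord_squares_in_simplex_iff:
  assumes "x \<in> extensional {1..d}"
  shows "coord_squares d x \<in> solid_simplex d \<longleftrightarrow> x \<in> unit_ball d"
  using assms by (simp add: solid_simplex_def unit_ball_def)

definition is_gegenbauer_family :: "(real \<Rightarrow> real \<Rightarrow> nat \<Rightarrow> real poly) \<Rightarrow> bool" where
  "is_gegenbauer_family C \<longleftrightarrow>
     (\<forall>lam \<mu> n. lam > -1/2 \<longrightarrow> \<mu> > -1/2 \<longrightarrow> is_gen_gegenbauer lam \<mu> n (C lam \<mu> n))"

text \<open>
  One factor of the identity between ball and simplex polynomials. The powers of \<open>sqrt r\<close> combine to
  an integral power of \<open>r\<close>; the hypothesis on \<open>r = 0\<close> is what holds at the boundary of the ball.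
\<close>

lemma sqrt_power_mult_gegenbauer_jacobi:
  assumes "r \<ge> 0" "r = 0 \<Longrightarrow> x = 0"
  shows "sqrt r ^ (2 * n + e) * poly (gegenbauer_jacobi e n a b) (x / sqrt r)
     = x ^ e * (r ^ n * poly (shifted_jacobi n b a) (x\<^sup>2 / r))"
proof (cases "r = 0")
  case True
  then show ?thesis using assms(2)
    by (cases "e = 0"; cases "n = 0") (auto simp: poly_gegenbauer_jacobi power_add power_0_left)
next
  case False
  then have r: "r > 0" using assms(1) by simp
  have "sqrt r ^ (2 * n + e) = r ^ n * sqrt r ^ e"
    using r by (simp add: power_add power_mult)
  moreover have "(x / sqrt r) ^ e = x ^ e / sqrt r ^ e" by (simp add: power_divide)
  moreover have "(x / sqrt r)\<^sup>2 = x\<^sup>2 / r" using r by (simp add: power_divide)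
  ultimately show ?thesis using r by (simp add: poly_gegenbauer_jacobi)
qed

text \<open>
  The central identity. The constant depends on the unspecified normalization of the Gegenbauer
  polynomials, and only its sign matters, because it cancels in normalized coefficients.
\<close>

lemma ball_poly_eq_simplex_poly:
  assumes C: "is_gegenbauer_family C" and \<kappa>: "\<forall>i\<in>{1..d+1}. \<kappa> i > -1"
    and e: "e \<in> multi_indices d" "\<forall>i\<in>{1..d}. e i \<in> {0, 1}"
  shows "\<exists>K>0. \<forall>x\<in>unit_ball d. ball_poly C d \<kappa> (\<lambda>i. 2 * \<nu> i + e i) x
    = K * (\<Prod>i=1..d. x i ^ e i) * simplex_poly d (\<lambda>i. \<kappa> i + real (e i)) \<nu> (coord_squares d x)"
proof -
  let ?\<alpha> = "\<lambda>i. 2 * \<nu> i + e i" and ?\<kappa> = "\<lambda>i. \<kappa> i + real (e i)"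
  let ?lam = "\<lambda>j. simplex_index d ?\<kappa> \<nu> j"
  have lam: "real (\<Sum>i=j+1..d. ?\<alpha> i) + (\<Sum>i=j+1..d+1. \<kappa> i) + real d - real j = ?lam j"
    if "j \<in> {1..d}" for j
  proof -
    have "e (Suc d) = 0" using e(1) by (simp add: multi_indices_def)
    then have "(\<Sum>i=j+1..d+1. ?\<kappa> i) = (\<Sum>i=j+1..d+1. \<kappa> i) + real (\<Sum>i=j+1..d. e i)"
      using that by (simp add: sum.distrib)
    then show ?thesis by (simp add: simplex_index_def sum.distrib sum_distrib_left)
  qed
  have \<kappa>': "\<forall>i\<in>{1..d+1}. ?\<kappa> i > -1"
    using \<kappa> by (auto intro: less_le_trans)
  have ex: "\<exists>c>0. C (?lam j + 1/2) (\<kappa> j + 1/2) (2 * \<nu> j + e j)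
      = smult c (gegenbauer_jacobi (e j) (\<nu> j) (?\<kappa> j) (?lam j))" if j: "j \<in> {1..d}" for j
  proof -
    have 1: "?lam j + 1/2 > -1/2" using simplex_index_gt[OF \<kappa>' j, of \<nu>] by linarith
    have "\<kappa> j > -1" using \<kappa> j by auto
    then have 2: "\<kappa> j + 1/2 > -1/2" by simp
    have ej: "e j \<in> {0, 1}" using e(2) j by blast
    have "is_gen_gegenbauer (?lam j + 1/2) (\<kappa> j + 1/2) (2 * \<nu> j + e j) (C (?lam j + 1/2) (\<kappa> j + 1/2) (2 * \<nu> j + e j))"
      using C 1 2 unfolding is_gegenbauer_family_def by blast
    then obtain c where "c > 0" "C (?lam j + 1/2) (\<kappa> j + 1/2) (2 * \<nu> j + e j)
        = smult c (gegenbauer_jacobi (e j) (\<nu> j) (\<kappa> j + 1/2 - 1/2 + real (e j)) (?lam j + 1/2 - 1/2))"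
      by (rule gen_gegenbauer_eq_jacobi[OF 1 2 ej])
    then show ?thesis by (intro exI[of _ c]) (simp only: add_diff_cancel_right')
  qed
  have "\<exists>c. \<forall>j\<in>{1..d}. c j > 0 \<and> C (?lam j + 1/2) (\<kappa> j + 1/2) (2 * \<nu> j + e j)
      = smult (c j) (gegenbauer_jacobi (e j) (\<nu> j) (?\<kappa> j) (?lam j))"
    by (intro bchoice ballI) (use ex in blast)
  then obtain c where c: "\<And>j. j \<in> {1..d} \<Longrightarrow> c j > 0"
    "\<And>j. j \<in> {1..d} \<Longrightarrow> C (?lam j + 1/2) (\<kappa> j + 1/2) (2 * \<nu> j + e j)
      = smult (c j) (gegenbauer_jacobi (e j) (\<nu> j) (?\<kappa> j) (?lam j))"
    by blast
  show ?thesis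
  proof (intro exI[of _ "\<Prod>j=1..d. c j"] conjI ballI)
    show "(\<Prod>j=1..d. c j) > 0" using c(1) by (intro prod_pos) auto
    fix x assume x: "x \<in> unit_ball d"
    let ?y = "coord_squares d x"
    have y: "?y \<in> solid_simplex d"
      using x by (simp add: coord_squares_in_simplex_iff[unfolded unit_ball_def] unit_ball_def del: One_nat_def)
    let ?r = "\<lambda>j. 1 - (\<Sum>i=1..<j. ?y i)"
    have "ball_poly C d \<kappa> ?\<alpha> x = (\<Prod>j=1..d. c j * x j ^ e j * (?r j ^ \<nu> j
        * poly (shifted_jacobi (\<nu> j) (?lam j) (?\<kappa> j)) (?y j / ?r j)))"
      unfolding ball_poly_def
    proof (intro prod.cong refl)
      fix j assume j: "j \<in> {1..d}"
      have r: "1 - (\<Sum>i=1..<j. (x i)\<^sup>2) = ?r j"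
        using j by (auto intro!: sum.cong)
      have yj: "?y j = (x j)\<^sup>2" using j by simp
      have "(\<Sum>i=1..<j. ?y i) + (x j)\<^sup>2 \<le> 1"
        using solid_simplex_partial_sum[OF y j] yj by simp
      then have "?r j \<ge> 0" "?r j = 0 \<Longrightarrow> x j = 0"
        using zero_le_power2[of "x j"] zero_less_power2[of "x j"] by linarith+
      from sqrt_power_mult_gegenbauer_jacobi[OF this, of "\<nu> j" "e j" "?\<kappa> j" "?lam j"]
      show "sqrt (1 - (\<Sum>i=1..<j. (x i)\<^sup>2)) ^ ?\<alpha> j
        * poly (C ((real (\<Sum>i=j+1..d. ?\<alpha> i) + (\<Sum>i=j+1..d+1. \<kappa> i) + real d - real j) + 1/2)
                  (\<kappa> j + 1/2) (?\<alpha> j))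
            (x j / sqrt (1 - (\<Sum>i=1..<j. (x i)\<^sup>2)))
        = c j * x j ^ e j * (?r j ^ \<nu> j * poly (shifted_jacobi (\<nu> j) (?lam j) (?\<kappa> j)) (?y j / ?r j))"
        unfolding r lam[OF j] c(2)[OF j] yj by (simp only: poly_smult mult_ac)
    qed
    also have "\<dots> = (\<Prod>j=1..d. c j) * (\<Prod>i=1..d. x i ^ e i) * simplex_poly d ?\<kappa> \<nu> ?y"
      unfolding simplex_poly_eq prod.distrib ..
    finally show "ball_poly C d \<kappa> ?\<alpha> x
        = (\<Prod>j=1..d. c j) * (\<Prod>i=1..d. x i ^ e i) * simplex_poly d ?\<kappa> \<nu> ?y" .
  qed
qed

section \<open>Linear independence on the ball\<close>

lemma ball_poly_flip:
  assumes C: "is_gegenbauer_family C" and \<kappa>: "\<forall>i\<in>{1..d+1}. \<kappa> i > -1"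
    and \<beta>: "\<beta> \<in> multi_indices d" and i: "i \<in> {1..d}" and x: "x \<in> unit_ball d"
  shows "ball_poly C d \<kappa> \<beta> (x(i := - x i)) = (-1) ^ \<beta> i * ball_poly C d \<kappa> \<beta> x"
proof -
  let ?e = "\<lambda>i. \<beta> i mod 2" and ?x = "x(i := - x i)"
  have \<beta>': "\<beta> = (\<lambda>i. 2 * (\<beta> i div 2) + ?e i)" by (auto simp: fun_eq_iff)
  have "?e \<in> multi_indices d" "\<forall>i\<in>{1..d}. ?e i \<in> {0, 1}"
    using \<beta> by (auto simp: multi_indices_def)
  from ball_poly_eq_simplex_poly[OF C \<kappa> this, of "\<lambda>i. \<beta> i div 2"]
  obtain K where K: "\<And>x. x \<in> unit_ball d \<Longrightarrow> ball_poly C d \<kappa> \<beta> x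
    = K * (\<Prod>i=1..d. x i ^ ?e i) * simplex_poly d (\<lambda>i. \<kappa> i + real (?e i)) (\<lambda>i. \<beta> i div 2) (coord_squares d x)"
    unfolding \<beta>'[symmetric] by blast
  have sq: "coord_squares d ?x = coord_squares d x" by (auto simp: fun_eq_iff restrict_def)
  have x': "?x \<in> unit_ball d"
  proof -
    have "(\<Sum>j=1..d. (?x j)\<^sup>2) = (\<Sum>j=1..d. (x j)\<^sup>2)" by (intro sum.cong) auto
    then show ?thesis using x i by (auto simp: unit_ball_def extensional_def)
  qed
  have "(\<Prod>j=1..d. ?x j ^ ?e j) = (\<Prod>j=1..d. (if j = i then (-1) ^ \<beta> i else 1) * x j ^ ?e j)"
  proof (intro prod.cong refl)
    fix j
    have "(- x i) ^ ?e i = (-1) ^ ?e i * x i ^ ?e i" by (rule power_minus)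
    moreover have "(-1 :: real) ^ ?e i = (-1) ^ \<beta> i"
      by (cases "even (\<beta> i)") (auto simp: odd_iff_mod_2_eq_one)
    ultimately show "?x j ^ ?e j = (if j = i then (-1) ^ \<beta> i else 1) * x j ^ ?e j" by simp
  qed
  also have "\<dots> = (-1) ^ \<beta> i * (\<Prod>j=1..d. x j ^ ?e j)"
    using i by (simp add: prod.distrib prod.delta del: One_nat_def)
  finally show ?thesis unfolding K[OF x'] K[OF x] sq by simp
qed

text \<open>
  Reflecting the coordinate \<open>i\<close> multiplies each term by \<open>(-1) ^ \<beta> i\<close>. Averaging the relation with its
  reflection, with the sign \<open>(-1) ^ e i\<close>, keeps exactly the terms of the chosen parity in coordinate \<open>i\<close>.
\<close>

lemma ball_sum_parity_class:
  assumes C: "is_gegenbauer_family C" and \<kappa>: "\<forall>i\<in>{1..d+1}. \<kappa> i > -1"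
    and I: "finite I" "I \<subseteq> multi_indices d"
    and zero: "\<And>x. x \<in> unit_ball d \<Longrightarrow> (\<Sum>\<beta>\<in>I. c \<beta> * ball_poly C d \<kappa> \<beta> x) = 0"
    and S: "finite S" "S \<subseteq> {1..d}"
  shows "x \<in> unit_ball d \<Longrightarrow>
    (\<Sum>\<beta>\<in>{\<beta> \<in> I. \<forall>i\<in>S. \<beta> i mod 2 = e i mod 2}. c \<beta> * ball_poly C d \<kappa> \<beta> x) = 0"
  using S
proof (induction S arbitrary: x rule: finite_induct)
  case empty
  then show ?case using zero by simp
next
  case (insert i S)
  let ?T = "{\<beta> \<in> I. \<forall>i\<in>S. \<beta> i mod 2 = e i mod 2}"
  let ?T' = "{\<beta> \<in> I. \<forall>i\<in>insert i S. \<beta> i mod 2 = e i mod 2}"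
  let ?Q = "ball_poly C d \<kappa>"
  have i: "i \<in> {1..d}" and S: "S \<subseteq> {1..d}" using insert.prems by auto
  have x': "x(i := - x i) \<in> unit_ball d"
  proof -
    have "(\<Sum>j=1..d. ((x(i := - x i)) j)\<^sup>2) = (\<Sum>j=1..d. (x j)\<^sup>2)" by (intro sum.cong) auto
    then show ?thesis using insert.prems(1) i by (auto simp: unit_ball_def extensional_def)
  qed
  have 1: "(\<Sum>\<beta>\<in>?T. c \<beta> * ?Q \<beta> x) = 0" by (rule insert.IH[OF insert.prems(1) S])
  have "(\<Sum>\<beta>\<in>?T. c \<beta> * ?Q \<beta> (x(i := - x i))) = 0" by (rule insert.IH[OF x' S])
  moreover have "(\<Sum>\<beta>\<in>?T. c \<beta> * ?Q \<beta> (x(i := - x i))) = (\<Sum>\<beta>\<in>?T. c \<beta> * ((-1) ^ \<beta> i * ?Q \<beta> x))"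
    using I insert.prems(1) i by (intro sum.cong refl arg_cong2[where f="(*)"] ball_poly_flip[OF C \<kappa>]) auto
  ultimately have "(\<Sum>\<beta>\<in>?T. c \<beta> * ((-1) ^ \<beta> i * ?Q \<beta> x)) = 0" by simp
  then have 2: "(-1) ^ e i * (\<Sum>\<beta>\<in>?T. c \<beta> * ((-1) ^ \<beta> i * ?Q \<beta> x)) = 0" by simp
  have "(\<Sum>\<beta>\<in>?T. c \<beta> * ?Q \<beta> x) + (-1) ^ e i * (\<Sum>\<beta>\<in>?T. c \<beta> * ((-1) ^ \<beta> i * ?Q \<beta> x))
    = (\<Sum>\<beta>\<in>?T. if \<beta> i mod 2 = e i mod 2 then 2 * (c \<beta> * ?Q \<beta> x) else 0)"
    unfolding sum_distrib_left sum.distrib[symmetric]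
  proof (intro sum.cong refl)
    fix \<beta>
    \<comment> \<open>The sign is 1 exactly when the parities agree, so the other terms cancel.\<close>
    have "(-1 :: real) ^ e i * (-1) ^ \<beta> i = (if \<beta> i mod 2 = e i mod 2 then 1 else -1)"
      by (cases "even (e i)"; cases "even (\<beta> i)") (auto simp: even_iff_mod_2_eq_zero odd_iff_mod_2_eq_one)
    moreover have "(-1) ^ e i * (c \<beta> * ((-1) ^ \<beta> i * ?Q \<beta> x))
       = ((-1) ^ e i * (-1) ^ \<beta> i) * (c \<beta> * ?Q \<beta> x)"
      by (simp only: mult_ac)
    ultimately have h: "(-1) ^ e i * (c \<beta> * ((-1) ^ \<beta> i * ?Q \<beta> x))
       = (if \<beta> i mod 2 = e i mod 2 then 1 else -1) * (c \<beta> * ?Q \<beta> x)"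
      by (simp only:)
    show "c \<beta> * ?Q \<beta> x + (-1) ^ e i * (c \<beta> * ((-1) ^ \<beta> i * ?Q \<beta> x))
       = (if \<beta> i mod 2 = e i mod 2 then 2 * (c \<beta> * ?Q \<beta> x) else 0)"
      unfolding h by simp
  qed
  also have "\<dots> = (\<Sum>\<beta>\<in>{\<beta> \<in> ?T. \<beta> i mod 2 = e i mod 2}. 2 * (c \<beta> * ?Q \<beta> x))"
    using I(1) by (intro sum.inter_filter[symmetric]) auto
  also have "{\<beta> \<in> ?T. \<beta> i mod 2 = e i mod 2} = ?T'" by auto
  also have "(\<Sum>\<beta>\<in>?T'. 2 * (c \<beta> * ?Q \<beta> x)) = 2 * (\<Sum>\<beta>\<in>?T'. c \<beta> * ?Q \<beta> x)"
    by (simp add: sum_distrib_left)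
  finally show ?case using 1 2 by simp
qed

text \<open>
  Within one parity class all terms share the factor \<open>\<Prod>i. x i ^ e i\<close>; without it, the relation is one
  between simplex polynomials at the squares, which cover all points with positive coordinates.
\<close>

lemma ball_poly_independent:
  assumes C: "is_gegenbauer_family C" and \<kappa>: "\<forall>i\<in>{1..d+1}. \<kappa> i > -1"
    and I: "finite I" "I \<subseteq> multi_indices d" "\<beta> \<in> I"
    and zero: "\<And>x. x \<in> unit_ball d \<Longrightarrow> (\<Sum>\<beta>\<in>I. c \<beta> * ball_poly C d \<kappa> \<beta> x) = 0"
  shows "c \<beta> = 0"
proof -
  define e where "e i = \<beta> i mod 2" for i
  let ?\<kappa> = "\<lambda>i. \<kappa> i + real (e i)"
  define dbl where "dbl \<nu> = (\<lambda>i. 2 * \<nu> i + e i)" for \<nu>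
  have e: "e \<in> multi_indices d" "\<forall>i\<in>{1..d}. e i \<in> {0, 1}"
    using I by (auto simp: multi_indices_def e_def)
  have \<kappa>': "\<forall>i\<in>{1..d+1}. ?\<kappa> i > -1" using \<kappa> by (auto intro: less_le_trans)
  have "\<exists>K>0. \<forall>x\<in>unit_ball d. ball_poly C d \<kappa> (dbl \<nu>) x
    = K * (\<Prod>i=1..d. x i ^ e i) * simplex_poly d ?\<kappa> \<nu> (coord_squares d x)" for \<nu>
    using ball_poly_eq_simplex_poly[OF C \<kappa> e, of \<nu>] unfolding dbl_def .
  then have "\<exists>K. \<forall>\<nu>. K \<nu> > 0 \<and> (\<forall>x\<in>unit_ball d. ball_poly C d \<kappa> (dbl \<nu>) x
    = K \<nu> * (\<Prod>i=1..d. x i ^ e i) * simplex_poly d ?\<kappa> \<nu> (coord_squares d x))"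
    by (intro choice allI)
  then obtain K where K: "\<And>\<nu>. K \<nu> > 0" "\<And>\<nu> x. x \<in> unit_ball d \<Longrightarrow> ball_poly C d \<kappa> (dbl \<nu>) x
    = K \<nu> * (\<Prod>i=1..d. x i ^ e i) * simplex_poly d ?\<kappa> \<nu> (coord_squares d x)"
    by blast
  define J where "J = {\<nu> \<in> multi_indices d. dbl \<nu> \<in> I}"
  have inj: "inj dbl"
  proof (rule injI)
    fix \<mu> \<nu> assume "dbl \<mu> = dbl \<nu>"
    then have "dbl \<mu> i = dbl \<nu> i" for i by simp
    then show "\<mu> = \<nu>" by (auto simp: dbl_def fun_eq_iff)
  qed
  have J: "finite J" "J \<subseteq> multi_indices d"
    using finite_vimageI[OF I(1) inj] by (auto simp: J_def vimage_def intro: finite_subset rev_finite_subset)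
  have img: "{\<beta> \<in> I. \<forall>i\<in>{1..d}. \<beta> i mod 2 = e i mod 2} = dbl ` J"
  proof (intro set_eqI iffI)
    fix \<gamma> assume \<gamma>: "\<gamma> \<in> {\<beta> \<in> I. \<forall>i\<in>{1..d}. \<beta> i mod 2 = e i mod 2}"
    then have \<gamma>m: "\<gamma> \<in> multi_indices d" using I by auto
    have "\<gamma> i = dbl (\<lambda>i. \<gamma> i div 2) i" for i
    proof (cases "i \<in> {1..d}")
      case True
      then have "\<gamma> i mod 2 = e i" using \<gamma> by (auto simp: e_def)
      then show ?thesis using mult_div_mod_eq[of 2 "\<gamma> i"] by (simp add: dbl_def)
    next
      case False
      then show ?thesis using \<gamma>m e(1) by (auto simp: dbl_def multi_indices_def)
    qed
    then have "\<gamma> = dbl (\<lambda>i. \<gamma> i div 2)" by (rule ext)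
    moreover have "(\<lambda>i. \<gamma> i div 2) \<in> multi_indices d" using \<gamma>m by (auto simp: multi_indices_def)
    ultimately show "\<gamma> \<in> dbl ` J" using \<gamma> unfolding J_def by auto
  next
    fix \<gamma> assume "\<gamma> \<in> dbl ` J"
    then show "\<gamma> \<in> {\<beta> \<in> I. \<forall>i\<in>{1..d}. \<beta> i mod 2 = e i mod 2}"
      by (auto simp: J_def dbl_def)
  qed
  have "\<beta> \<in> dbl ` J" unfolding img[symmetric] using I by (auto simp: e_def)
  then obtain \<nu> where \<nu>: "\<nu> \<in> J" "\<beta> = dbl \<nu>" by auto
  have "c (dbl \<nu>) * K \<nu> = 0"
  proof (rule simplex_poly_independent[OF \<kappa>' J \<nu>(1), where c = "\<lambda>\<nu>. c (dbl \<nu>) * K \<nu>"])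
    fix s :: "nat \<Rightarrow> real" assume s: "s \<in> solid_simplex d" "\<And>i. i \<in> {1..d} \<Longrightarrow> s i > 0"
    define x where "x = (\<lambda>i\<in>{1..d}. sqrt (s i))"
    have sq: "coord_squares d x i = s i" if "i \<in> {1..d}" for i
      using that s(2)[OF that] by (simp add: x_def)
    have xb: "x \<in> unit_ball d"
    proof -
      have "(\<Sum>i=1..d. (x i)\<^sup>2) = (\<Sum>i=1..d. s i)" using sq by (intro sum.cong) auto
      then show ?thesis using s(1) by (auto simp: unit_ball_def solid_simplex_def x_def)
    qed
    define m where "m = (\<Prod>i=1..d. x i ^ e i)"
    have xpos: "m > 0"
      unfolding m_def using s(2) by (intro prod_pos) (auto simp: x_def)
    have P: "simplex_poly d ?\<kappa> \<mu> (coord_squares d x) = simplex_poly d ?\<kappa> \<mu> s" for \<mu>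
      using sq by (intro simplex_poly_cong) auto
    have "0 = (\<Sum>\<beta>\<in>dbl ` J. c \<beta> * ball_poly C d \<kappa> \<beta> x)"
      using ball_sum_parity_class[OF C \<kappa> I(1,2) zero _ _ xb, of "{1..d}" e] unfolding img by simp
    also have "\<dots> = (\<Sum>\<mu>\<in>J. c (dbl \<mu>) * ball_poly C d \<kappa> (dbl \<mu>) x)"
      using inj by (subst sum.reindex) (auto intro: inj_on_subset)
    also have "\<dots> = m * (\<Sum>\<mu>\<in>J. c (dbl \<mu>) * K \<mu> * simplex_poly d ?\<kappa> \<mu> s)"
      unfolding K(2)[OF xb] P sum_distrib_left m_def by (simp only: mult_ac)
    finally show "(\<Sum>\<mu>\<in>J. c (dbl \<mu>) * K \<mu> * simplex_poly d ?\<kappa> \<mu> s) = 0"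
      using xpos by simp
  qed
  then show ?thesis using K(1)[of \<nu>] \<nu>(2) by simp
qed

section \<open>Norms on the ball and on the simplex\<close>

lemma square_powr_substitution:
  fixes x k :: real
  assumes "e \<in> {0, 1::nat}"
  shows "(x ^ e)\<^sup>2 * \<bar>x\<bar> powr (2 * k + 1) = (x\<^sup>2) powr (k + real e) * \<bar>x\<bar>"
proof (cases "x = 0")
  case False
  have "(x\<^sup>2) powr (k + real e) * \<bar>x\<bar> = \<bar>x\<bar> powr (2 * (k + real e) + 1)"
  proof -
    have "(x\<^sup>2) powr (k + real e) = (\<bar>x\<bar> powr 2) powr (k + real e)" by simp
    also have "\<dots> = \<bar>x\<bar> powr (2 * (k + real e))" by (simp only: powr_powr)
    finally have "(x\<^sup>2) powr (k + real e) = \<bar>x\<bar> powr (2 * (k + real e))" .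
    then show ?thesis using False by (simp add: powr_add)
  qed
  moreover have "(x ^ e)\<^sup>2 = \<bar>x\<bar> powr (2 * real e)"
    using assms False by auto
  ultimately show ?thesis
    by (simp add: powr_add[symmetric] algebra_simps)
qed (use assms in auto)

text \<open>
  The monomial factor of a ball polynomial turns the weight for \<open>\<kappa>\<close> into that for \<open>\<kappa> + e\<close>; the
  remaining factors are the ones absorbed by the substitution of squares.
\<close>

lemma ball_weight_eq_dirichlet:
  assumes e: "e \<in> multi_indices d" "\<forall>i\<in>{1..d}. e i \<in> {0, 1}" and x: "x \<in> unit_ball d"
  shows "(\<Prod>i=1..d. x i ^ e i)\<^sup>2 * ball_weight d \<kappa> x
    = dirichlet_density d (\<lambda>i. \<kappa> i + real (e i)) (coord_squares d x)
      * (\<Prod>i=1..d. \<bar>x i\<bar> * indicator {-1..1} (x i))"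
proof -
  let ?y = "coord_squares d x"
  have ext: "x \<in> extensional {1..d}" using x by (simp add: unit_ball_def)
  have y: "?y \<in> solid_simplex d" using x coord_squares_in_simplex_iff[OF ext] by blast
  have e0: "e (d + 1) = 0" using e(1) by (simp add: multi_indices_def)
  have s: "(\<Sum>i=1..d. ?y i) = (\<Sum>i=1..d. (x i)\<^sup>2)" by (intro sum.cong) auto
  have "(\<Prod>i=1..d. x i ^ e i)\<^sup>2 * (\<Prod>i=1..d. \<bar>x i\<bar> powr (2 * \<kappa> i + 1))
     = (\<Prod>i=1..d. ?y i powr (\<kappa> i + real (e i))) * (\<Prod>i=1..d. \<bar>x i\<bar> * indicator {-1..1} (x i))"
    unfolding prod_power_distrib prod.distrib[symmetric]
  proof (intro prod.cong refl)
    fix i assume i: "i \<in> {1..d}"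
    have "(x i)\<^sup>2 \<le> 1" using solid_simplex_le_1[OF y i] i by simp
    then have "x i \<in> {-1..1}" by (auto simp: abs_square_le_1 abs_le_iff)
    then show "(x i ^ e i)\<^sup>2 * \<bar>x i\<bar> powr (2 * \<kappa> i + 1)
      = ?y i powr (\<kappa> i + real (e i)) * (\<bar>x i\<bar> * indicator {-1..1} (x i))"
      using square_powr_substitution[of "e i" "x i" "\<kappa> i"] e(2) i by simp
  qed
  then show ?thesis
    using y e0 unfolding ball_weight_def dirichlet_density_def simplex_weight_def s
    by (simp only: indicator_simps mult_ac) (simp add: mult_ac)
qed

lemma ball_norm_eq_dirichlet:
  assumes \<kappa>: "\<forall>i\<in>{1..d+1}. \<kappa> i > -1"
    and e: "e \<in> multi_indices d" "\<forall>i\<in>{1..d}. e i \<in> {0, 1}" and "K > 0"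
    and K: "\<And>x. x \<in> unit_ball d \<Longrightarrow> ball_poly C d \<kappa> \<alpha> x
      = K * (\<Prod>i=1..d. x i ^ e i) * simplex_poly d (\<lambda>i. \<kappa> i + real (e i)) \<nu> (coord_squares d x)"
  defines "\<kappa>' \<equiv> \<lambda>i. \<kappa> i + real (e i)"
  shows "ball_norm C d \<kappa> \<alpha> = K * sqrt (dirichlet_inner d \<kappa>' (simplex_poly d \<kappa>' \<nu>) (simplex_poly d \<kappa>' \<nu>))"
proof -
  have \<kappa>': "\<forall>i\<in>{1..d+1}. \<kappa>' i > -1" using \<kappa> by (auto intro: less_le_trans simp: \<kappa>'_def)
  obtain p where p: "polyfun d (\<Sum>i=1..d. \<nu> i) p" "\<And>x. x \<in> solid_simplex d \<Longrightarrow> simplex_poly d \<kappa>' \<nu> x = p x"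
    using simplex_poly_polyfun[OF \<kappa>'] by blast
  define F where "F s = (p s)\<^sup>2 * dirichlet_density d \<kappa>' s" for s
  let ?w = "\<lambda>x :: nat \<Rightarrow> real. \<Prod>i=1..d. \<bar>x i\<bar> * indicator {-1..1} (x i)"
  note [measurable] = measurable_coord_borel
  have F [measurable]: "F \<in> borel_measurable (lborel_pow d)"
    unfolding F_def using polyfun_measurable[OF p(1)] by measurable
  have Fnn: "F s \<ge> 0" for s by (simp add: F_def)
  have wnn: "?w x \<ge> 0" for x by (intro prod_nonneg) auto
  have sq: "coord_squares d \<in> measurable (lborel_pow d) (lborel_pow d)"
    by (intro measurable_restrict) (use measurable_coord_borel in measurable)
  have w: "?w \<in> borel_measurable (lborel_pow d)"
    by (intro borel_measurable_prod) (use measurable_coord_borel in measurable)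
  have meas: "(\<lambda>x. F (coord_squares d x) * ?w x) \<in> borel_measurable (lborel_pow d)"
    using measurable_compose[OF sq F] w by (intro borel_measurable_times)
  have pt: "indicator (unit_ball d) x *\<^sub>R ((ball_poly C d \<kappa> \<alpha> x)\<^sup>2 * ball_weight d \<kappa> x)
      = K\<^sup>2 * (F (coord_squares d x) * ?w x)" if x: "x \<in> space (lborel_pow d)" for x
  proof (cases "x \<in> unit_ball d")
    case True
    have ext: "x \<in> extensional {1..d}" using True by (simp add: unit_ball_def)
    have y: "coord_squares d x \<in> solid_simplex d" using True coord_squares_in_simplex_iff[OF ext] by blast
    have "(ball_poly C d \<kappa> \<alpha> x)\<^sup>2 * ball_weight d \<kappa> x
      = K\<^sup>2 * (p (coord_squares d x))\<^sup>2 * ((\<Prod>i=1..d. x i ^ e i)\<^sup>2 * ball_weight d \<kappa> x)"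
      unfolding K[OF True] p(2)[OF y, unfolded \<kappa>'_def] by (simp only: power_mult_distrib mult_ac)
    also have "\<dots> = K\<^sup>2 * (F (coord_squares d x) * ?w x)"
      unfolding ball_weight_eq_dirichlet[OF e True] F_def \<kappa>'_def by (simp only: mult_ac)
    finally show ?thesis using True by simp
  next
    case False
    have ext: "x \<in> extensional {1..d}" using x by (auto simp: space_PiM PiE_def)
    have "coord_squares d x \<notin> solid_simplex d" using False coord_squares_in_simplex_iff[OF ext] by blast
    then have "F (coord_squares d x) = 0" unfolding F_def dirichlet_density_def by simp
    then show ?thesis using False by simp
  qed
  have "(LINT x:unit_ball d|lborel_pow d. (ball_poly C d \<kappa> \<alpha> x)\<^sup>2 * ball_weight d \<kappa> x)
     = (\<integral>x. K\<^sup>2 * (F (coord_squares d x) * ?w x) \<partial>lborel_pow d)"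
    unfolding set_lebesgue_integral_def by (intro Bochner_Integration.integral_cong refl pt)
  also have "\<dots> = K\<^sup>2 * (\<integral>x. F (coord_squares d x) * ?w x \<partial>lborel_pow d)"
    by (rule integral_mult_right_zero)
  also have "(\<integral>x. F (coord_squares d x) * ?w x \<partial>lborel_pow d)
     = enn2real (\<integral>\<^sup>+x. ennreal (F (coord_squares d x) * ?w x) \<partial>lborel_pow d)"
    using Fnn wnn by (intro integral_eq_nn_integral meas) auto
  also have "(\<integral>\<^sup>+x. ennreal (F (coord_squares d x) * ?w x) \<partial>lborel_pow d)
     = (\<integral>\<^sup>+x. ennreal (F (coord_squares d x)) * (\<Prod>i\<in>{1..d}. ennreal (\<bar>x i\<bar> * indicator {-1..1} (x i))) \<partial>lborel_pow d)"
  proof (intro nn_integral_cong)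
    fix x :: "nat \<Rightarrow> real"
    have "(\<Prod>i\<in>{1..d}. ennreal (\<bar>x i\<bar> * indicator {-1..1} (x i))) = ennreal (?w x)"
      by (intro prod_ennreal) auto
    then show "ennreal (F (coord_squares d x) * ?w x) = ennreal (F (coord_squares d x)) *
        (\<Prod>i\<in>{1..d}. ennreal (\<bar>x i\<bar> * indicator {-1..1} (x i)))"
      using Fnn wnn by (simp only: ennreal_mult)
  qed
  also have "\<dots> = (\<integral>\<^sup>+s. ennreal (F s) * (\<Prod>i\<in>{1..d}. indicator {0..1} (s i)) \<partial>lborel_pow d)"
    using F by (intro nn_integral_PiM_square) auto
  also have "\<dots> = (\<integral>\<^sup>+s. ennreal (F s) \<partial>lborel_pow d)"
  proof (intro nn_integral_cong)
    fix s :: "nat \<Rightarrow> real"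
    show "ennreal (F s) * (\<Prod>i\<in>{1..d}. indicator {0..1} (s i)) = ennreal (F s)"
    proof (cases "s \<in> solid_simplex d")
      case True
      then have "(\<Prod>i\<in>{1..d}. indicator {0..1} (s i)) = (1 :: ennreal)"
        using solid_simplex_le_1[OF True] by (intro prod.neutral) (auto simp: solid_simplex_def)
      then show ?thesis by simp
    qed (simp add: F_def dirichlet_density_def)
  qed
  also have "enn2real \<dots> = (\<integral>s. F s \<partial>lborel_pow d)"
    using Fnn by (intro integral_eq_nn_integral[symmetric] F) auto
  also have "\<dots> = dirichlet_inner d \<kappa>' (simplex_poly d \<kappa>' \<nu>) (simplex_poly d \<kappa>' \<nu>)"
    unfolding dirichlet_inner_def F_def power2_eq_square
    by (intro Bochner_Integration.integral_cong refl dirichlet_density_cong) (simp only: p(2))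
  finally show ?thesis using \<open>K > 0\<close> by (simp add: ball_norm_def real_sqrt_mult)
qed

lemma simplex_norm_sq_eq:
  "simplex_norm_sq d \<kappa> \<nu> = Gamma ((\<Sum>i=1..d+1. \<kappa> i) + real d + 1) / (\<Prod>i=1..d+1. Gamma (\<kappa> i + 1))
     * dirichlet_inner d \<kappa> (simplex_poly d \<kappa> \<nu>) (simplex_poly d \<kappa> \<nu>)"
proof -
  have "(LINT x:std_simplex d|lborel_pow d. simplex_poly d \<kappa> \<nu> x * simplex_poly d \<kappa> \<nu> x * simplex_weight d \<kappa> x)
    = dirichlet_inner d \<kappa> (simplex_poly d \<kappa> \<nu>) (simplex_poly d \<kappa> \<nu>)"
    unfolding set_lebesgue_integral_def dirichlet_inner_def
  proof (intro Bochner_Integration.integral_cong refl)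
    fix x assume "x \<in> space (lborel_pow d)"
    then have "x \<in> std_simplex d \<longleftrightarrow> x \<in> solid_simplex d"
      by (auto simp: space_PiM PiE_def std_simplex_def solid_simplex_def)
    then show "indicat_real (std_simplex d) x *\<^sub>R
        (simplex_poly d \<kappa> \<nu> x * simplex_poly d \<kappa> \<nu> x * simplex_weight d \<kappa> x)
      = simplex_poly d \<kappa> \<nu> x * simplex_poly d \<kappa> \<nu> x * dirichlet_density d \<kappa> x"
      by (simp add: dirichlet_density_def indicator_def)
  qed
  then show ?thesis by (simp add: simplex_norm_sq_def simplex_inner_def)
qed

text \<open>
  The Gamma factors are symmetric in the entries of \<open>\<kappa>\<close>, so they cancel.
\<close>

lemma simplex_norm_ratio:
  assumes \<kappa>: "\<forall>i\<in>{1..d+1}. \<kappa> i > -1" and \<tau>: "\<tau> permutes {1..d}"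
  shows "simplex_norm_sq d \<kappa> \<mu> / simplex_norm_sq d (\<kappa> \<circ> \<tau>) \<nu>
    = dirichlet_inner d \<kappa> (simplex_poly d \<kappa> \<mu>) (simplex_poly d \<kappa> \<mu>)
      / dirichlet_inner d (\<kappa> \<circ> \<tau>) (simplex_poly d (\<kappa> \<circ> \<tau>) \<nu>) (simplex_poly d (\<kappa> \<circ> \<tau>) \<nu>)"
proof -
  have \<tau>': "\<tau> permutes {1..d+1}" using \<tau> by (rule permutes_subset) force
  let ?G = "Gamma ((\<Sum>i=1..d+1. \<kappa> i) + real d + 1) / (\<Prod>i=1..d+1. Gamma (\<kappa> i + 1))"
  have "(\<Sum>i=1..d+1. (\<kappa> \<circ> \<tau>) i) = (\<Sum>i=1..d+1. \<kappa> i)"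
    by (rule sum.permute[OF \<tau>', symmetric])
  moreover have "(\<Prod>i=1..d+1. Gamma ((\<kappa> \<circ> \<tau>) i + 1)) = (\<Prod>i=1..d+1. Gamma (\<kappa> i + 1))"
    using prod.permute[OF \<tau>', of "\<lambda>i. Gamma (\<kappa> i + 1)"] by (simp only: o_def)
  ultimately have eq: "simplex_norm_sq d (\<kappa> \<circ> \<tau>) \<nu> = ?G *
      dirichlet_inner d (\<kappa> \<circ> \<tau>) (simplex_poly d (\<kappa> \<circ> \<tau>) \<nu>) (simplex_poly d (\<kappa> \<circ> \<tau>) \<nu>)"
    unfolding simplex_norm_sq_eq by (simp only:)
  have "(\<Sum>i=1..d+1. -1 :: real) < (\<Sum>i=1..d+1. \<kappa> i)"
    using \<kappa> by (intro sum_strict_mono) auto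
  then have "Gamma ((\<Sum>i=1..d+1. \<kappa> i) + real d + 1) > 0" by (intro Gamma_real_pos) simp
  moreover have "(\<Prod>i=1..d+1. Gamma (\<kappa> i + 1)) > 0"
  proof (intro prod_pos ballI Gamma_real_pos)
    fix i assume "i \<in> {1..d+1}"
    then have "\<kappa> i > -1" using \<kappa> by blast
    then show "\<kappa> i + 1 > 0" by linarith
  qed
  ultimately have "?G > 0" by (rule divide_pos_pos)
  then have "?G \<noteq> 0" by (rule less_imp_neq[symmetric])
  then show ?thesis unfolding eq simplex_norm_sq_eq[of d \<kappa>] by (rule mult_divide_mult_cancel_left)
qed

section \<open>The connection coefficients\<close>

lemma simplex_conn_expansion:
  assumes \<kappa>: "\<forall>i\<in>{1..d+1}. \<kappa> i > -1" and \<tau>: "\<tau> permutes {1..d}" and \<nu>: "\<nu> \<in> multi_indices d"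
    and x: "x \<in> solid_simplex d"
  shows "simplex_poly d (\<kappa> \<circ> \<tau>) \<nu> (\<lambda>i\<in>{1..d}. x (\<tau> i))
    = (\<Sum>\<mu>\<in>multi_indices_deg d (\<Sum>i=1..d. \<nu> i). simplex_conn d \<tau> \<kappa> \<nu> \<mu> * simplex_poly d \<kappa> \<mu> x)"
proof -
  let ?I = "multi_indices_deg d (\<Sum>i=1..d. \<nu> i)"
  let ?f = "\<lambda>x. simplex_poly d (\<kappa> \<circ> \<tau>) \<nu> (\<lambda>i\<in>{1..d}. x (\<tau> i))"
  obtain c0 where c0: "\<And>x. x \<in> solid_simplex d \<Longrightarrow> ?f x = (\<Sum>\<mu>\<in>?I. c0 \<mu> * simplex_poly d \<kappa> \<mu> x)"
    using simplex_perm_in_span[OF \<kappa> \<tau> \<nu>] unfolding in_span_def by blast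
  define c where "c \<mu> = (if \<mu> \<in> ?I then c0 \<mu> else 0)" for \<mu>
  have c: "?f x = (\<Sum>\<mu>\<in>?I. c \<mu> * simplex_poly d \<kappa> \<mu> x)" if "x \<in> solid_simplex d" for x
    unfolding c0[OF that] by (intro sum.cong) (auto simp: c_def)
  have perm: "simplex_perm d \<tau> x = (\<lambda>i\<in>{1..d}. x (\<tau> i))" for x
  proof -
    have "\<tau> i \<noteq> d + 1" if "i \<in> {1..d}" for i
      using that permutes_in_image[OF \<tau>, of i] by auto
    then show ?thesis by (auto simp: simplex_perm_def fun_eq_iff restrict_def)
  qed
  have "simplex_conn d \<tau> \<kappa> \<nu> = c"
    unfolding simplex_conn_def perm
  proof (rule expansion_coeffs_eqI)
    show "c i = 0" if "i \<notin> ?I" for i using that by (simp add: c_def)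
    show "?f x = (\<Sum>i\<in>?I. c i * simplex_poly d \<kappa> i x)" if "x \<in> std_simplex d" for x
      using c that std_simplex_subset by blast
    fix c' i
    assume z: "\<And>x. x \<in> std_simplex d \<Longrightarrow> (\<Sum>i\<in>?I. c' i * simplex_poly d \<kappa> i x) = 0" and i: "i \<in> ?I"
    show "c' i = 0"
    proof (rule simplex_poly_independent[OF \<kappa> finite_multi_indices_deg _ i])
      show "?I \<subseteq> multi_indices d" by (auto simp: multi_indices_deg_def)
      fix x assume x: "x \<in> solid_simplex d"
      have "restrict x {1..d} \<in> std_simplex d"
        using x by (simp add: std_simplex_def solid_simplex_def)
      from z[OF this] show "(\<Sum>\<mu>\<in>?I. c' \<mu> * simplex_poly d \<kappa> \<mu> x) = 0"
        using simplex_poly_cong[of d "restrict x {1..d}" x] by simp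
    qed
  qed
  then show ?thesis using c[OF x] by simp
qed

text \<open>
  Both kinds of ball coefficients at once: the weights \<open>w, w0\<close> are 1 for the original bases and the
  norms for the orthonormal ones. The permuted ball polynomial is a monomial times a permuted simplex
  polynomial at the squares; since \<open>e\<close> is permuted along with the coordinates, the monomial is the one
  that occurs in all \<open>ball_poly\<close> of index \<open>2 * \<mu> + e\<close>. Expanding the simplex polynomial thus gives an
  expansion on the ball.
\<close>

lemma ball_perm_expansion_coeffs:
  assumes C: "is_gegenbauer_family C" and \<kappa>: "\<forall>i\<in>{1..d+1}. \<kappa> i > -1" and \<tau>: "\<tau> permutes {1..d}"
    and e: "e \<in> multi_indices d" "\<forall>i\<in>{1..d}. e i \<in> {0, 1}" and \<nu>: "\<nu> \<in> multi_indices d"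
    and K1: "\<And>x. x \<in> unit_ball d \<Longrightarrow> ball_poly C d (\<kappa> \<circ> \<tau>) (\<lambda>i. 2 * \<nu> i + e (\<tau> i)) x
      = K1 * (\<Prod>i=1..d. x i ^ e (\<tau> i)) * simplex_poly d ((\<lambda>i. \<kappa> i + real (e i)) \<circ> \<tau>) \<nu> (coord_squares d x)"
    and K: "\<And>\<mu>. K \<mu> > 0" "\<And>\<mu> x. x \<in> unit_ball d \<Longrightarrow> ball_poly C d \<kappa> (\<lambda>i. 2 * \<mu> i + e i) x
      = K \<mu> * (\<Prod>i=1..d. x i ^ e i) * simplex_poly d (\<lambda>i. \<kappa> i + real (e i)) \<mu> (coord_squares d x)"
    and w: "\<And>\<beta>. \<beta> \<in> multi_indices d \<Longrightarrow> w \<beta> \<noteq> 0" "w0 \<noteq> 0"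
  defines "b \<equiv> expansion_coeffs (unit_ball d) (multi_indices_deg d (\<Sum>i=1..d. 2 * \<nu> i + e (\<tau> i)))
       (\<lambda>\<beta> x. ball_poly C d \<kappa> \<beta> x / w \<beta>)
       (\<lambda>x. ball_poly C d (\<kappa> \<circ> \<tau>) (\<lambda>i. 2 * \<nu> i + e (\<tau> i)) (ball_perm d \<tau> x) / w0)"
  shows "\<mu> \<in> multi_indices_deg d (\<Sum>i=1..d. \<nu> i) \<Longrightarrow> b (\<lambda>i. 2 * \<mu> i + e i)
      = K1 / K \<mu> * simplex_conn d \<tau> (\<lambda>i. \<kappa> i + real (e i)) \<nu> \<mu> * w (\<lambda>i. 2 * \<mu> i + e i) / w0"
    and "\<not> (\<exists>\<mu>\<in>multi_indices d. \<beta> = (\<lambda>i. 2 * \<mu> i + e i)) \<Longrightarrow> b \<beta> = 0"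
proof -
  let ?\<kappa> = "\<lambda>i. \<kappa> i + real (e i)"
  define dbl where "dbl \<mu> = (\<lambda>i. 2 * \<mu> i + e i)" for \<mu>
  define I where "I = multi_indices_deg d (\<Sum>i=1..d. \<nu> i)"
  define N where "N = (\<Sum>i=1..d. 2 * \<nu> i + e (\<tau> i))"
  define g where "g \<mu> = K1 / K \<mu> * simplex_conn d \<tau> ?\<kappa> \<nu> \<mu> * w (dbl \<mu>) / w0" for \<mu>
  define b' where "b' \<beta> = (if \<beta> \<in> dbl ` I then g (the_inv dbl \<beta>) else 0)" for \<beta>
  have \<kappa>': "\<forall>i\<in>{1..d+1}. ?\<kappa> i > -1" using \<kappa> by (auto intro: less_le_trans)
  have inj: "inj dbl"
  proof (rule injI)
    fix \<mu> \<nu> assume "dbl \<mu> = dbl \<nu>"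
    then have "dbl \<mu> i = dbl \<nu> i" for i by simp
    then show "\<mu> = \<nu>" by (auto simp: dbl_def fun_eq_iff)
  qed
  have b'_dbl: "b' (dbl \<mu>) = g \<mu>" if "\<mu> \<in> I" for \<mu>
    using that by (simp add: b'_def the_inv_f_f[OF inj])
  have N: "N = 2 * (\<Sum>i=1..d. \<nu> i) + (\<Sum>i=1..d. e i)"
    using sum.permute[OF \<tau>, of e] by (simp add: N_def sum.distrib sum_distrib_left o_def)
  have sub: "dbl ` I \<subseteq> multi_indices_deg d N"
    using e(1)
    by (auto simp: I_def dbl_def N multi_indices_deg_def multi_indices_def sum.distrib simp flip: sum_distrib_left)
  have subm: "multi_indices_deg d N \<subseteq> multi_indices d" for N by (auto simp: multi_indices_deg_def)
  have "b = b'"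
    unfolding b_def N_def[symmetric]
  proof (rule expansion_coeffs_eqI)
    show "b' \<beta> = 0" if "\<beta> \<notin> multi_indices_deg d N" for \<beta>
      using that sub by (auto simp: b'_def)
  next
    fix x assume x: "x \<in> unit_ball d"
    let ?y = "coord_squares d x"
    have ext: "x \<in> extensional {1..d}" using x by (simp add: unit_ball_def)
    have y: "?y \<in> solid_simplex d" using x coord_squares_in_simplex_iff[OF ext] by blast
    have im: "\<tau> i \<in> {1..d}" if "i \<in> {1..d}" for i using that permutes_in_image[OF \<tau>] by metis
    have xt: "ball_perm d \<tau> x \<in> unit_ball d"
    proof -
      have "(\<Sum>i=1..d. (ball_perm d \<tau> x i)\<^sup>2) = (\<Sum>i=1..d. (x (\<tau> i))\<^sup>2)"
        by (intro sum.cong) (auto simp: ball_perm_def)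
      also have "\<dots> = (\<Sum>i=1..d. (x i)\<^sup>2)"
        using sum.permute[OF \<tau>, of "\<lambda>i. (x i)\<^sup>2"] by (simp add: o_def)
      finally show ?thesis using x by (simp add: unit_ball_def ball_perm_def)
    qed
    have yt: "coord_squares d (ball_perm d \<tau> x) = (\<lambda>i\<in>{1..d}. ?y (\<tau> i))"
    proof (rule HOL.ext)
      fix i
      show "coord_squares d (ball_perm d \<tau> x) i = (\<lambda>i\<in>{1..d}. ?y (\<tau> i)) i"
      proof (cases "i \<in> {1..d}")
        case True
        then show ?thesis using im[OF True] by (simp add: ball_perm_def)
      qed auto
    qed
    have "(\<Prod>i=1..d. ball_perm d \<tau> x i ^ e (\<tau> i)) = (\<Prod>i=1..d. x (\<tau> i) ^ e (\<tau> i))"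
      by (intro prod.cong) (auto simp: ball_perm_def)
    also have "\<dots> = (\<Prod>i=1..d. x i ^ e i)"
      using prod.permute[OF \<tau>, of "\<lambda>i. x i ^ e i"] by (simp add: o_def)
    finally have "ball_poly C d (\<kappa> \<circ> \<tau>) (\<lambda>i. 2 * \<nu> i + e (\<tau> i)) (ball_perm d \<tau> x) / w0
      = K1 * (\<Prod>i=1..d. x i ^ e i) * (\<Sum>\<mu>\<in>I. simplex_conn d \<tau> ?\<kappa> \<nu> \<mu> * simplex_poly d ?\<kappa> \<mu> ?y) / w0"
      unfolding K1[OF xt] yt simplex_conn_expansion[OF \<kappa>' \<tau> \<nu> y] I_def by simp
    also have "\<dots> = (\<Sum>\<mu>\<in>I. b' (dbl \<mu>) * (ball_poly C d \<kappa> (dbl \<mu>) x / w (dbl \<mu>)))"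
      unfolding sum_distrib_left sum_divide_distrib
    proof (intro sum.cong refl)
      fix \<mu> assume \<mu>: "\<mu> \<in> I"
      have "w (dbl \<mu>) \<noteq> 0" using w(1) sub subm \<mu> by blast
      moreover have "K \<mu> \<noteq> 0" using K(1)[of \<mu>] by simp
      ultimately show "K1 * (\<Prod>i=1..d. x i ^ e i) * (simplex_conn d \<tau> ?\<kappa> \<nu> \<mu> * simplex_poly d ?\<kappa> \<mu> ?y) / w0
        = b' (dbl \<mu>) * (ball_poly C d \<kappa> (dbl \<mu>) x / w (dbl \<mu>))"
        unfolding b'_dbl[OF \<mu>] g_def using K(2)[OF x, of \<mu>] by (simp add: dbl_def)
    qed
    also have "\<dots> = (\<Sum>\<beta>\<in>dbl ` I. b' \<beta> * (ball_poly C d \<kappa> \<beta> x / w \<beta>))"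
      using inj by (subst sum.reindex) (auto intro: inj_on_subset)
    also have "\<dots> = (\<Sum>\<beta>\<in>multi_indices_deg d N. b' \<beta> * (ball_poly C d \<kappa> \<beta> x / w \<beta>))"
      using sub by (intro sum.mono_neutral_left) (auto simp: b'_def)
    finally show "ball_poly C d (\<kappa> \<circ> \<tau>) (\<lambda>i. 2 * \<nu> i + e (\<tau> i)) (ball_perm d \<tau> x) / w0
      = (\<Sum>\<beta>\<in>multi_indices_deg d N. b' \<beta> * (ball_poly C d \<kappa> \<beta> x / w \<beta>))" .
  next
    fix c' \<beta>
    assume z: "\<And>x. x \<in> unit_ball d \<Longrightarrow> (\<Sum>\<beta>\<in>multi_indices_deg d N. c' \<beta> * (ball_poly C d \<kappa> \<beta> x / w \<beta>)) = 0"
      and \<beta>: "\<beta> \<in> multi_indices_deg d N"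
    have "c' \<beta> / w \<beta> = 0"
      using z by (intro ball_poly_independent[OF C \<kappa> finite_multi_indices_deg subm \<beta>, where c = "\<lambda>\<beta>. c' \<beta> / w \<beta>"]) simp
    moreover have "w \<beta> \<noteq> 0" using w(1) \<beta> subm by blast
    ultimately show "c' \<beta> = 0" by simp
  qed
  then show "\<mu> \<in> multi_indices_deg d (\<Sum>i=1..d. \<nu> i) \<Longrightarrow> b (\<lambda>i. 2 * \<mu> i + e i)
      = K1 / K \<mu> * simplex_conn d \<tau> ?\<kappa> \<nu> \<mu> * w (\<lambda>i. 2 * \<mu> i + e i) / w0"
    and "\<not> (\<exists>\<mu>\<in>multi_indices d. \<beta> = (\<lambda>i. 2 * \<mu> i + e i)) \<Longrightarrow> b \<beta> = 0"
    using b'_dbl[of \<mu>] subm by (auto simp: g_def I_def dbl_def b'_def)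
qed

theorem theorem9p4:
  fixes d :: nat and \<kappa> :: "nat \<Rightarrow> real" and \<tau> :: "nat \<Rightarrow> nat"
    and \<epsilon> \<nu> :: "nat \<Rightarrow> nat"
    and C :: "real \<Rightarrow> real \<Rightarrow> nat \<Rightarrow> real poly"
  assumes "d \<ge> 1"
    and "\<forall>i\<in>{1..d+1}. \<kappa> i > -1"
    and "\<tau> permutes {1..d}"
    and "\<epsilon> \<in> multi_indices d" and "\<forall>i\<in>{1..d}. \<epsilon> i \<in> {0, 1}"
    and "\<nu> \<in> multi_indices d"
    and "\<And>lam \<mu> n. lam > -1/2 \<Longrightarrow> \<mu> > -1/2 \<Longrightarrow> is_gen_gegenbauer lam \<mu> n (C lam \<mu> n)"
  shows "(\<forall>\<beta>\<in>multi_indices_deg d (2 * (\<Sum>i=1..d. \<nu> i) + (\<Sum>i=1..d. \<epsilon> i)).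
            \<not> (\<exists>\<mu>\<in>multi_indices d. \<beta> = (\<lambda>i. 2 * \<mu> i + \<epsilon> i)) \<longrightarrow>
            ball_conn C d \<tau> \<kappa> (\<lambda>i. 2 * \<nu> i + \<epsilon> (\<tau> i)) \<beta> = 0)
       \<and> (\<forall>\<mu>\<in>multi_indices_deg d (\<Sum>i=1..d. \<nu> i).
            ball_conn_normalized C d \<tau> \<kappa> (\<lambda>i. 2 * \<nu> i + \<epsilon> (\<tau> i)) (\<lambda>i. 2 * \<mu> i + \<epsilon> i)
            = simplex_conn_normalized d \<tau> (\<lambda>i. \<kappa> i + real (\<epsilon> i)) \<nu> \<mu>)"
proof -
  note \<kappa> = assms(2) and \<tau> = assms(3) and \<epsilon> = assms(4,5) and \<nu> = assms(6)
  have C: "is_gegenbauer_family C" using assms(7) by (simp add: is_gegenbauer_family_def)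
  note \<kappa>\<tau> = permutes_gt[OF \<tau> \<kappa>]
  let ?\<kappa> = "\<lambda>i. \<kappa> i + real (\<epsilon> i)"
  let ?\<alpha> = "\<lambda>i. 2 * \<nu> i + \<epsilon> (\<tau> i)"
  let ?D = "\<lambda>\<kappa> \<mu>. dirichlet_inner d \<kappa> (simplex_poly d \<kappa> \<mu>) (simplex_poly d \<kappa> \<mu>)"
  have \<kappa>': "\<forall>i\<in>{1..d+1}. ?\<kappa> i > -1" using \<kappa> by (auto intro: less_le_trans)
  have \<epsilon>\<tau>: "(\<lambda>i. \<epsilon> (\<tau> i)) \<in> multi_indices d" "\<forall>i\<in>{1..d}. \<epsilon> (\<tau> i) \<in> {0, 1}"
    using \<epsilon> permutes_in_image[OF \<tau>] permutes_not_in[OF \<tau>] by (simp_all add: multi_indices_def)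
  have comp: "(\<lambda>i. (\<kappa> \<circ> \<tau>) i + real (\<epsilon> (\<tau> i))) = ?\<kappa> \<circ> \<tau>" by (simp add: fun_eq_iff)
  obtain K1 where K1: "K1 > 0" "\<And>x. x \<in> unit_ball d \<Longrightarrow> ball_poly C d (\<kappa> \<circ> \<tau>) ?\<alpha> x
      = K1 * (\<Prod>i=1..d. x i ^ \<epsilon> (\<tau> i)) * simplex_poly d (?\<kappa> \<circ> \<tau>) \<nu> (coord_squares d x)"
    using ball_poly_eq_simplex_poly[OF C \<kappa>\<tau> \<epsilon>\<tau>, of \<nu>] unfolding comp by blast
  have "\<exists>K>0. \<forall>x\<in>unit_ball d. ball_poly C d \<kappa> (\<lambda>i. 2 * \<mu> i + \<epsilon> i) x
      = K * (\<Prod>i=1..d. x i ^ \<epsilon> i) * simplex_poly d ?\<kappa> \<mu> (coord_squares d x)" for \<mu>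
    by (rule ball_poly_eq_simplex_poly[OF C \<kappa> \<epsilon>])
  then have "\<exists>K. \<forall>\<mu>. K \<mu> > 0 \<and> (\<forall>x\<in>unit_ball d. ball_poly C d \<kappa> (\<lambda>i. 2 * \<mu> i + \<epsilon> i) x
      = K \<mu> * (\<Prod>i=1..d. x i ^ \<epsilon> i) * simplex_poly d ?\<kappa> \<mu> (coord_squares d x))"
    by (intro choice allI)
  then obtain K where K: "\<And>\<mu>. K \<mu> > 0" "\<And>\<mu> x. x \<in> unit_ball d \<Longrightarrow> ball_poly C d \<kappa> (\<lambda>i. 2 * \<mu> i + \<epsilon> i) x
      = K \<mu> * (\<Prod>i=1..d. x i ^ \<epsilon> i) * simplex_poly d ?\<kappa> \<mu> (coord_squares d x)"
    by blast
  have norm: "ball_norm C d \<kappa> (\<lambda>i. 2 * \<mu> i + \<epsilon> i) = K \<mu> * sqrt (?D ?\<kappa> \<mu>)" for \<mu>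
    using ball_norm_eq_dirichlet[OF \<kappa> \<epsilon> K(1) K(2)] by simp
  have norm1: "ball_norm C d (\<kappa> \<circ> \<tau>) ?\<alpha> = K1 * sqrt (?D (?\<kappa> \<circ> \<tau>) \<nu>)"
    using ball_norm_eq_dirichlet[OF \<kappa>\<tau> \<epsilon>\<tau> K1(1), of C ?\<alpha> \<nu>] K1(2) unfolding comp by blast
  have Dpos: "?D ?\<kappa> \<mu> > 0" "?D (?\<kappa> \<circ> \<tau>) \<mu> > 0" for \<mu>
    by (rule simplex_poly_norm_pos[OF \<kappa>'], rule simplex_poly_norm_pos[OF permutes_gt[OF \<tau> \<kappa>']])
  \<comment> \<open>The orthonormal basis contains polynomials of every parity, not only those with parity \<open>\<epsilon>\<close>.\<close>
  have norm_nz: "ball_norm C d \<kappa> \<beta> \<noteq> 0" if \<beta>: "\<beta> \<in> multi_indices d" for \<beta>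
  proof -
    let ?e = "\<lambda>i. \<beta> i mod 2"
    have e: "?e \<in> multi_indices d" "\<forall>i\<in>{1..d}. ?e i \<in> {0, 1}" using \<beta> by (auto simp: multi_indices_def)
    have \<beta>': "(\<lambda>i. 2 * (\<beta> i div 2) + ?e i) = \<beta>" by (auto simp: fun_eq_iff)
    have \<kappa>e: "\<forall>i\<in>{1..d+1}. \<kappa> i + real (?e i) > -1" using \<kappa> by (auto intro: less_le_trans)
    from ball_poly_eq_simplex_poly[OF C \<kappa> e, of "\<lambda>i. \<beta> i div 2"]
    obtain k where k: "k > 0" "\<And>x. x \<in> unit_ball d \<Longrightarrow> ball_poly C d \<kappa> \<beta> x
      = k * (\<Prod>i=1..d. x i ^ ?e i) * simplex_poly d (\<lambda>i. \<kappa> i + real (?e i)) (\<lambda>i. \<beta> i div 2) (coord_squares d x)"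
      unfolding \<beta>' by blast
    then show ?thesis
      using ball_norm_eq_dirichlet[OF \<kappa> e k] simplex_poly_norm_pos[OF \<kappa>e, of "\<lambda>i. \<beta> i div 2"] by simp
  qed
  have nz1: "ball_norm C d (\<kappa> \<circ> \<tau>) ?\<alpha> \<noteq> 0" using norm1 K1(1) Dpos(2)[of \<nu>] by simp
  show ?thesis
  proof (intro conjI ballI impI)
    fix \<beta> assume "\<not> (\<exists>\<mu>\<in>multi_indices d. \<beta> = (\<lambda>i. 2 * \<mu> i + \<epsilon> i))"
    from ball_perm_expansion_coeffs(2)[OF C \<kappa> \<tau> \<epsilon> \<nu> K1(2) K _ _ this, of "\<lambda>_. 1" 1]
    show "ball_conn C d \<tau> \<kappa> ?\<alpha> \<beta> = 0"
      by (simp add: ball_conn_def)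
  next
    fix \<mu> assume \<mu>: "\<mu> \<in> multi_indices_deg d (\<Sum>i=1..d. \<nu> i)"
    have "ball_conn_normalized C d \<tau> \<kappa> ?\<alpha> (\<lambda>i. 2 * \<mu> i + \<epsilon> i)
       = K1 / K \<mu> * simplex_conn d \<tau> ?\<kappa> \<nu> \<mu> * ball_norm C d \<kappa> (\<lambda>i. 2 * \<mu> i + \<epsilon> i)
         / ball_norm C d (\<kappa> \<circ> \<tau>) ?\<alpha>"
      unfolding ball_conn_normalized_def ball_poly_orthonormal_def[abs_def]
      by (rule ball_perm_expansion_coeffs(1)[OF C \<kappa> \<tau> \<epsilon> \<nu> K1(2) K norm_nz nz1 \<mu>])
    also have "\<dots> = sqrt (?D ?\<kappa> \<mu> / ?D (?\<kappa> \<circ> \<tau>) \<nu>) * simplex_conn d \<tau> ?\<kappa> \<nu> \<mu>"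
      unfolding norm norm1 real_sqrt_divide using K1(1) K(1)[of \<mu>] by simp
    also have "\<dots> = simplex_conn_normalized d \<tau> ?\<kappa> \<nu> \<mu>"
      unfolding simplex_conn_normalized_def simplex_norm_ratio[OF \<kappa>' \<tau>] ..
    finally show "ball_conn_normalized C d \<tau> \<kappa> ?\<alpha> (\<lambda>i. 2 * \<mu> i + \<epsilon> i) = simplex_conn_normalized d \<tau> ?\<kappa> \<nu> \<mu>" .
  qed
qed

end
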